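(* Let $\mathcal R$ be a pmp equivalence relation on a standard probability space $(X,\mu)$. Then the following assertions are equivalent. (1) $\mathcal R$ is aperiodic. (2) $[\mathcal R]$ has no nontrivial morphisms into $\mathbb Z/2\mathbb Z$. (3) $[\mathcal R]$ has no nontrivial morphisms into totally disconnected separable groups.
   Context: Everything is understood modulo null sets. $(X,\mu)$ is a standard (atomless) probability space; $\mathrm{Aut}(X,\mu)$ is the group of measure-preserving Borel bijections of $X$ up to null sets. A pmp equivalence relation is the orbit equivalence relation of a non-trivial measure-preserving action of a countable group on $(X,\mu)$; it is aperiodic if almost all its classes are infinite. The full group is $[\mathcal R]=\{T\in\mathrm{Aut}(X,\mu): T(x)\,\mathcal R\,x \text{ for a.e. } x\}$. Morphisms are abstract group homomorphisms (no continuity is assumed); in (3) the target groups are totally disconnected separable topological groups.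
   Formalization: "Non-trivial action" is taken to mean that almost every point is moved by some group element (almost no class is a single point); otherwise equality on a set of measure strictly between 0 and 1, aperiodic on the rest, satisfies (2) and (3) but not (1). *)

theory Defs
  imports
    "HOL-Probability.Probability"
    "HOL-Algebra.Elementary_Groups"
    "HOL-Algebra.Group_Action"
begin

definition standard_borel_measure :: "'a measure \<Rightarrow> bool" where
  "standard_borel_measure M \<longleftrightarrow>
     (\<exists>T. topspace T = space M \<and> completely_metrizable_space T \<and> separable_space T \<and>
          sets M = sigma_sets (space M) {U. openin T U})"

definition atomless :: "'a measure \<Rightarrow> bool" where
  "atomless M \<longleftrightarrow>
     (\<forall>A\<in>sets M. 0 < emeasure M A \<longrightarrow>
        (\<exists>B\<in>sets M. B \<subseteq> A \<and> 0 < emeasure M B \<and> emeasure M B < emeasure M A))"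

definition standard_probability_space :: "'a measure \<Rightarrow> bool" where
  "standard_probability_space M \<longleftrightarrow>
     prob_space M \<and> standard_borel_measure M \<and> atomless M"

(* Bij consists of extensional functions, so an element is determined by its values on space M. *)
definition mp_bijections :: "'a measure \<Rightarrow> ('a \<Rightarrow> 'a) set" where
  "mp_bijections M =
     {T \<in> Bij (space M). T \<in> M \<rightarrow>\<^sub>M M \<and> inv_into (space M) T \<in> M \<rightarrow>\<^sub>M M \<and> distr M M T = M}"

definition mp_group :: "'a measure \<Rightarrow> ('a \<Rightarrow> 'a) monoid" where
  "mp_group M = (BijGroup (space M)) \<lparr>carrier := mp_bijections M\<rparr>"

definition null_bijections :: "'a measure \<Rightarrow> ('a \<Rightarrow> 'a) set" where
  "null_bijections M = {T \<in> mp_bijections M. AE x in M. T x = x}"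

(* Identifying transformations that agree almost everywhere is passing to the quotient by the
   normal subgroup of those that are almost everywhere the identity. *)
definition Aut_mp :: "'a measure \<Rightarrow> ('a \<Rightarrow> 'a) set monoid" where
  "Aut_mp M = mp_group M Mod null_bijections M"

(* The orbit relation, everywhere defined on space M, of an action by measure-preserving Borel
   bijections. Taking the acting group on a set of natural numbers loses nothing, since every
   countable group has such a copy. Non-triviality is understood modulo null sets and pointwise:
   almost every point is moved by some group element. Asking only that the action as a whole be
   non-trivial would allow the relation to be equality on a set of positive measure, and if the
   relation is aperiodic on the complement, the full group does not see that set. *)
definition pmp_equivalence_relation :: "'a measure \<Rightarrow> 'a rel \<Rightarrow> bool" where
  "pmp_equivalence_relation M R \<longleftrightarrow>
     (\<exists>(G :: nat monoid) \<phi>.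
        group_action G (space M) \<phi> \<and>
        (\<forall>g\<in>carrier G. \<phi> g \<in> mp_bijections M) \<and>
        (AE x in M. \<exists>g\<in>carrier G. \<phi> g x \<noteq> x) \<and>
        R = {(x, y). x \<in> space M \<and> y \<in> orbit G \<phi> x})"

definition aperiodic :: "'a measure \<Rightarrow> 'a rel \<Rightarrow> bool" where
  "aperiodic M R \<longleftrightarrow> (AE x in M. infinite (R `` {x}))"

definition full_group :: "'a measure \<Rightarrow> 'a rel \<Rightarrow> ('a \<Rightarrow> 'a) set monoid" where
  "full_group M R =
     (Aut_mp M) \<lparr>carrier := {C \<in> carrier (Aut_mp M). \<forall>T\<in>C. AE x in M. (T x, x) \<in> R}\<rparr>"

definition no_nontrivial_morphisms :: "('a, 'c) monoid_scheme \<Rightarrow> ('b, 'd) monoid_scheme \<Rightarrow> bool" where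
  "no_nontrivial_morphisms G H \<longleftrightarrow> (\<forall>f\<in>hom G H. \<forall>x\<in>carrier G. f x = \<one>\<^bsub>H\<^esub>)"

definition topological_group :: "('g, 'c) monoid_scheme \<Rightarrow> 'g topology \<Rightarrow> bool" where
  "topological_group H T \<longleftrightarrow>
     group H \<and> topspace T = carrier H \<and>
     continuous_map (prod_topology T T) T (\<lambda>(x, y). x \<otimes>\<^bsub>H\<^esub> y) \<and>
     continuous_map T T (\<lambda>x. inv\<^bsub>H\<^esub> x)"

(* A totally disconnected topological group is Hausdorff, and a separable Hausdorff space has at most
   2^(2^aleph_0) points. Hence quantifying over groups H :: nat set set monoid covers, up to
   isomorphism, every totally disconnected separable group. *)
definition totally_disconnected :: "'g topology \<Rightarrow> bool" where
  "totally_disconnected T \<longleftrightarrow> (\<forall>x\<in>topspace T. connected_component_of_set T x = {x})"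

lemma subgroup_mp_bijections:
  "subgroup (mp_bijections M) (BijGroup (space M))"
proof -
  let ?S = "space M"
  have id: "(\<lambda>x\<in>?S. x) \<in> mp_bijections M"
  proof -
    have i: "(\<lambda>x\<in>?S. x) \<in> M \<rightarrow>\<^sub>M M" by (subst measurable_cong[where g="\<lambda>x. x"]) auto
    moreover have "inv_into ?S (\<lambda>x\<in>?S. x) x = x" if "x \<in> ?S" for x
      using that by (metis id_Bij Bij_def IntD2 bij_betw_inv_into_left mem_Collect_eq restrict_apply')
    then have "inv_into ?S (\<lambda>x\<in>?S. x) \<in> M \<rightarrow>\<^sub>M M"
      by (subst measurable_cong[where g="\<lambda>x. x"]) auto
    moreover have "distr M M (\<lambda>x\<in>?S. x) = M"
      by (subst distr_cong[of M M M M _ "\<lambda>x. x"]) (auto simp: distr_id2)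
    ultimately show ?thesis by (auto simp: mp_bijections_def id_Bij)
  qed
  have comp: "compose ?S f g \<in> mp_bijections M"
    if f: "f \<in> mp_bijections M" and g: "g \<in> mp_bijections M" for f g
  proof -
    have B: "f \<in> Bij ?S" "g \<in> Bij ?S" and m: "f \<in> M \<rightarrow>\<^sub>M M" "g \<in> M \<rightarrow>\<^sub>M M"
      and im: "inv_into ?S f \<in> M \<rightarrow>\<^sub>M M" "inv_into ?S g \<in> M \<rightarrow>\<^sub>M M"
      and d: "distr M M f = M" "distr M M g = M"
      using f g by (auto simp: mp_bijections_def)
    have c: "compose ?S f g \<in> Bij ?S" using B by (rule compose_Bij)
    have eq: "compose ?S f g x = (f \<circ> g) x" if "x \<in> ?S" for x
      using that by (simp add: compose_def)
    have cm: "compose ?S f g \<in> M \<rightarrow>\<^sub>M M"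
      by (subst measurable_cong[OF eq]) (use m in \<open>auto intro: measurable_comp\<close>)
    have "inv_into ?S (compose ?S f g) x = (inv_into ?S g \<circ> inv_into ?S f) x" if x: "x \<in> ?S" for x
    proof -
      have fb: "bij_betw f ?S ?S" "bij_betw g ?S ?S" using B by (auto simp: Bij_def)
      let ?y = "inv_into ?S g (inv_into ?S f x)"
      have y: "?y \<in> ?S" using x im by (auto dest: measurable_space)
      have "compose ?S f g ?y = x"
        using x y fb by (metis compose_eq bij_betw_inv_into_right im(1) measurable_space)
      then show ?thesis
        using y c by (metis Bij_def IntD2 bij_betw_inv_into_left comp_apply mem_Collect_eq)
    qed
    then have "inv_into ?S (compose ?S f g) \<in> M \<rightarrow>\<^sub>M M"
      using measurable_comp[OF im] by (subst measurable_cong[where g="inv_into ?S g \<circ> inv_into ?S f"]) auto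
    moreover have "distr M M (compose ?S f g) = distr M M (f \<circ> g)"
      by (rule distr_cong) (auto simp: eq)
    then have "distr M M (compose ?S f g) = M"
      using distr_distr[OF m] d by simp
    ultimately show ?thesis using c cm by (simp add: mp_bijections_def)
  qed
  have inv: "(\<lambda>x\<in>?S. inv_into ?S f x) \<in> mp_bijections M" if f: "f \<in> mp_bijections M" for f
  proof -
    have B: "f \<in> Bij ?S" and m: "f \<in> M \<rightarrow>\<^sub>M M"
      and im: "inv_into ?S f \<in> M \<rightarrow>\<^sub>M M" and d: "distr M M f = M"
      using f by (auto simp: mp_bijections_def)
    have fb: "bij_betw f ?S ?S" using B by (auto simp: Bij_def)
    let ?h = "\<lambda>x\<in>?S. inv_into ?S f x"
    have hB: "?h \<in> Bij ?S" using B by (rule restrict_inv_into_Bij)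
    have hm: "?h \<in> M \<rightarrow>\<^sub>M M"
      by (subst measurable_cong[where g="inv_into ?S f"]) (use im in auto)
    have "inv_into ?S ?h x = f x" if x: "x \<in> ?S" for x
    proof -
      have fx: "f x \<in> ?S" using m x by (auto dest: measurable_space)
      then have "?h (f x) = x" using x fb by (simp add: bij_betw_inv_into_left)
      then show ?thesis using fx hB
        by (metis Bij_def IntD2 bij_betw_inv_into_left mem_Collect_eq)
    qed
    then have ihm: "inv_into ?S ?h \<in> M \<rightarrow>\<^sub>M M"
      using m by (subst measurable_cong[where g=f]) auto
    have "distr M M ?h = distr (distr M M f) M ?h" using d by simp
    also have "\<dots> = distr M M (?h \<circ> f)" by (rule distr_distr[OF hm m])
    also have "\<dots> = distr M M (\<lambda>x. x)"
      using m fb by (intro distr_cong) (auto simp: bij_betw_inv_into_left dest: measurable_space)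
    also have "\<dots> = M" by (rule distr_id2) simp
    finally show ?thesis using hB hm ihm by (simp add: mp_bijections_def)
  qed
  have sub: "f \<in> Bij ?S" if "f \<in> mp_bijections M" for f
    using that by (simp add: mp_bijections_def)
  show ?thesis
    using group_BijGroup
    by (rule group.subgroupI)
       (use id comp inv sub in \<open>auto simp: BijGroup_def inv_BijGroup[unfolded BijGroup_def]\<close>)
qed

lemma group_mp_group: "group (mp_group M)"
  unfolding mp_group_def
  by (rule subgroup.subgroup_is_group[OF subgroup_mp_bijections group_BijGroup])

lemma carrier_mp_group: "carrier (mp_group M) = mp_bijections M"
  by (simp add: mp_group_def)

lemma mult_mp_group:
  assumes "f \<in> mp_bijections M" "g \<in> mp_bijections M" "x \<in> space M"
  shows "(f \<otimes>\<^bsub>mp_group M\<^esub> g) x = f (g x)"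
  using assms by (simp add: mp_group_def BijGroup_def mp_bijections_def compose_def)

lemma one_mp_group: "x \<in> space M \<Longrightarrow> \<one>\<^bsub>mp_group M\<^esub> x = x"
  by (simp add: mp_group_def BijGroup_def)

lemma AE_mp_bijection:
  assumes "f \<in> mp_bijections M" "AE x in M. P x"
  shows "AE x in M. P (f x)"
proof -
  have "f \<in> M \<rightarrow>\<^sub>M M" "distr M M f = M" using assms by (auto simp: mp_bijections_def)
  then show ?thesis using AE_distrD[of f M M P] assms(2) by metis
qed

lemma mp_inv_left:
  assumes "f \<in> mp_bijections M" "x \<in> space M"
  shows "(inv\<^bsub>mp_group M\<^esub> f) (f x) = x"
proof -
  interpret group "mp_group M" by (rule group_mp_group)
  have "inv\<^bsub>mp_group M\<^esub> f \<in> mp_bijections M" "inv\<^bsub>mp_group M\<^esub> f \<otimes>\<^bsub>mp_group M\<^esub> f = \<one>\<^bsub>mp_group M\<^esub>"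
    using assms inv_closed l_inv unfolding carrier_mp_group by auto
  then show ?thesis using mult_mp_group[of _ M f x] assms one_mp_group by metis
qed

lemma mp_inv_right:
  assumes "f \<in> mp_bijections M" "x \<in> space M"
  shows "f ((inv\<^bsub>mp_group M\<^esub> f) x) = x"
proof -
  interpret group "mp_group M" by (rule group_mp_group)
  have "inv\<^bsub>mp_group M\<^esub> f \<in> mp_bijections M" "f \<otimes>\<^bsub>mp_group M\<^esub> inv\<^bsub>mp_group M\<^esub> f = \<one>\<^bsub>mp_group M\<^esub>"
    using assms inv_closed r_inv unfolding carrier_mp_group by auto
  then show ?thesis using mult_mp_group[of f M _ x] assms one_mp_group by metis
qed

lemma mp_bijection_space:
  "f \<in> mp_bijections M \<Longrightarrow> x \<in> space M \<Longrightarrow> f x \<in> space M"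
  by (auto simp: mp_bijections_def dest: measurable_space)

lemma subgroup_AE_related:
  assumes "equiv (space M) R"
  shows "subgroup {T \<in> mp_bijections M. AE x in M. (T x, x) \<in> R} (mp_group M)"
proof -
  interpret group "mp_group M" by (rule group_mp_group)
  have refl: "(x, x) \<in> R" if "x \<in> space M" for x
    using assms that by (auto simp: equiv_def refl_on_def)
  have sym: "(y, x) \<in> R" if "(x, y) \<in> R" for x y
    using assms that by (auto simp: equiv_def dest: symD)
  have trans: "(x, z) \<in> R" if "(x, y) \<in> R" "(y, z) \<in> R" for x y z
    using assms that by (auto simp: equiv_def dest: transD)
  have closed: "inv\<^bsub>mp_group M\<^esub> f \<in> mp_bijections M" if "f \<in> mp_bijections M" for f
    using that inv_closed unfolding carrier_mp_group by blast
  have mclosed: "f \<otimes>\<^bsub>mp_group M\<^esub> g \<in> mp_bijections M"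
    if "f \<in> mp_bijections M" "g \<in> mp_bijections M" for f g
    using that m_closed unfolding carrier_mp_group by blast
  show ?thesis
  proof (rule subgroupI)
    have "AE x in M. (\<one>\<^bsub>mp_group M\<^esub> x, x) \<in> R" by (rule AE_I2) (simp add: one_mp_group refl)
    then show "{T \<in> mp_bijections M. AE x in M. (T x, x) \<in> R} \<noteq> {}"
      using one_closed unfolding carrier_mp_group by blast
  next
    fix f assume f: "f \<in> {T \<in> mp_bijections M. AE x in M. (T x, x) \<in> R}"
    then have "AE x in M. (f ((inv\<^bsub>mp_group M\<^esub> f) x), (inv\<^bsub>mp_group M\<^esub> f) x) \<in> R"
      using AE_mp_bijection[OF closed, of f "\<lambda>x. (f x, x) \<in> R"] by blast
    with AE_space have "AE x in M. ((inv\<^bsub>mp_group M\<^esub> f) x, x) \<in> R"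
      by eventually_elim (use f mp_inv_right sym in fastforce)
    then show "inv\<^bsub>mp_group M\<^esub> f \<in> {T \<in> mp_bijections M. AE x in M. (T x, x) \<in> R}"
      using f closed by blast
  next
    fix f g assume f: "f \<in> {T \<in> mp_bijections M. AE x in M. (T x, x) \<in> R}"
      and g: "g \<in> {T \<in> mp_bijections M. AE x in M. (T x, x) \<in> R}"
    then have "AE x in M. (f (g x), g x) \<in> R"
      using AE_mp_bijection[of g M "\<lambda>x. (f x, x) \<in> R"] by blast
    moreover have "AE x in M. (g x, x) \<in> R" using g by blast
    ultimately have "AE x in M. ((f \<otimes>\<^bsub>mp_group M\<^esub> g) x, x) \<in> R"
      using AE_space by eventually_elim (use f g mult_mp_group trans in fastforce)
    then show "f \<otimes>\<^bsub>mp_group M\<^esub> g \<in> {T \<in> mp_bijections M. AE x in M. (T x, x) \<in> R}"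
      using f g mclosed by blast
  qed (auto simp: carrier_mp_group)
qed

lemma normal_null_bijections: "null_bijections M \<lhd> mp_group M"
proof -
  interpret group "mp_group M" by (rule group_mp_group)
  have "null_bijections M = {T \<in> mp_bijections M. AE x in M. (T x, x) \<in> Id_on (space M)}"
  proof -
    have "(AE x in M. T x = x) = (AE x in M. (T x, x) \<in> Id_on (space M))" for T
      by (rule AE_cong) (auto simp: Id_on_def)
    then show ?thesis unfolding null_bijections_def by simp
  qed
  moreover have "equiv (space M) (Id_on (space M))"
    by (rule equivI) (auto simp: refl_on_def sym_def trans_def)
  ultimately have "subgroup (null_bijections M) (mp_group M)"
    using subgroup_AE_related[of M "Id_on (space M)"] by simp
  moreover have "f \<otimes>\<^bsub>mp_group M\<^esub> h \<otimes>\<^bsub>mp_group M\<^esub> inv\<^bsub>mp_group M\<^esub> f \<in> null_bijections M"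
    if f: "f \<in> carrier (mp_group M)" and h: "h \<in> null_bijections M" for f h
  proof -
    let ?i = "inv\<^bsub>mp_group M\<^esub> f"
    have fm: "f \<in> mp_bijections M" and hm: "h \<in> mp_bijections M" and im: "?i \<in> mp_bijections M"
      using f h inv_closed[OF f] by (auto simp: carrier_mp_group null_bijections_def)
    have fh: "f \<otimes>\<^bsub>mp_group M\<^esub> h \<in> mp_bijections M"
      and c: "f \<otimes>\<^bsub>mp_group M\<^esub> h \<otimes>\<^bsub>mp_group M\<^esub> ?i \<in> mp_bijections M"
      using fm hm im m_closed unfolding carrier_mp_group by blast+
    have "AE x in M. h (?i x) = ?i x"
      using AE_mp_bijection[OF im, of "\<lambda>x. h x = x"] h by (simp add: null_bijections_def)
    with AE_space have "AE x in M. (f \<otimes>\<^bsub>mp_group M\<^esub> h \<otimes>\<^bsub>mp_group M\<^esub> ?i) x = x"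
      by eventually_elim
         (simp add: mult_mp_group fm hm im fh mp_bijection_space mp_inv_right)
    then show ?thesis using c by (simp add: null_bijections_def)
  qed
  ultimately show ?thesis by (simp add: normal_inv_iff)
qed

lemma group_Aut_mp: "group (Aut_mp M)"
  unfolding Aut_mp_def by (rule normal.factorgroup_is_group[OF normal_null_bijections])

lemma equiv_pmp_equivalence_relation:
  assumes "pmp_equivalence_relation M R"
  shows "equiv (space M) R"
proof -
  obtain G :: "nat monoid" and \<phi> where act: "group_action G (space M) \<phi>"
    and R: "R = {(x, y). x \<in> space M \<and> y \<in> orbit G \<phi> x}"
    using assms by (auto simp: pmp_equivalence_relation_def)
  interpret group_action G "space M" \<phi> by (rule act)
  have sp: "y \<in> space M" if "x \<in> space M" "y \<in> orbit G \<phi> x" for x y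
    using that element_image by (auto simp: orbit_def)
  show ?thesis
  proof (rule equivI)
    show "R \<subseteq> space M \<times> space M" unfolding R using sp by auto
    show "refl_on (space M) R"
      unfolding R refl_on_def using orbit_refl by auto
    show "sym R" unfolding R sym_def using sp orbit_sym by blast
    show "trans R" unfolding R trans_def using sp orbit_trans by blast
  qed
qed

lemma full_group_eq:
  assumes "equiv (space M) R"
  shows "carrier (full_group M R) =
    (\<lambda>T. null_bijections M #>\<^bsub>mp_group M\<^esub> T) ` {T \<in> mp_bijections M. AE x in M. (T x, x) \<in> R}"
proof -
  interpret N: normal "null_bijections M" "mp_group M" by (rule normal_null_bijections)
  have ae: "AE x in M. (T' x, x) \<in> R"
    if T: "T \<in> mp_bijections M" "AE x in M. (T x, x) \<in> R"
      and T': "T' \<in> null_bijections M #>\<^bsub>mp_group M\<^esub> T" for T T'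
  proof -
    obtain h where h: "h \<in> null_bijections M" "T' = h \<otimes>\<^bsub>mp_group M\<^esub> T"
      using T' by (auto simp: r_coset_def)
    have "AE x in M. h (T x) = T x"
      using AE_mp_bijection[OF T(1), of "\<lambda>x. h x = x"] h by (simp add: null_bijections_def)
    then show ?thesis
      using T(2) AE_space
      by eventually_elim (use h T in \<open>auto simp: mult_mp_group null_bijections_def\<close>)
  qed
  have self: "T \<in> null_bijections M #>\<^bsub>mp_group M\<^esub> T" if "T \<in> mp_bijections M" for T
    using that N.rcos_self N.subgroup_axioms by (simp add: carrier_mp_group)
  show ?thesis
    unfolding full_group_def Aut_mp_def
    using ae self by (fastforce simp: carrier_FactGroup carrier_mp_group image_iff)
qed

lemma group_full_group:
  assumes "equiv (space M) R"
  shows "group (full_group M R)"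
proof -
  let ?q = "\<lambda>T. null_bijections M #>\<^bsub>mp_group M\<^esub> T"
  interpret group_hom "mp_group M" "Aut_mp M" ?q
    using normal.r_coset_hom_Mod[OF normal_null_bijections] group_mp_group group_Aut_mp
    by (auto simp: group_hom_def group_hom_axioms_def Aut_mp_def)
  have "subgroup (carrier (full_group M R)) (Aut_mp M)"
    unfolding full_group_eq[OF assms]
    by (rule subgroup_img_is_subgroup[OF subgroup_AE_related[OF assms]])
  moreover have "full_group M R = (Aut_mp M) \<lparr>carrier := carrier (full_group M R)\<rparr>"
    by (simp add: full_group_def)
  ultimately show ?thesis
    using subgroup.subgroup_is_group[OF _ group_Aut_mp] by metis
qed

end

theory Submission
  imports Defs "HOL-Combinatorics.Permutations"
begin

text \<open>Let \<open>\<pi>\<close> be a morphism from the full group of an aperiodic relation to a totally disconnected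
  separable group. Halving the space again and again inside the orbits gives dyadic coordinates. For a
  neighbourhood \<open>V\<close> of the identity, countably many translates of \<open>V\<close> cover the target, so a diagonal
  argument shows that elements with image in \<open>V V\<^sup>-\<^sup>1\<close> realise everything on some piece of the space,
  and counting uncountably many candidates shows that they can move small sets into that piece. Hence
  suitable involutions supported on small dyadic sets have small image, such an involution is joined to
  the identity by a path with continuous image, and therefore it lies in the kernel. Up to conjugation
  these generate all involutions, and an Eilenberg swindle shows that the full group has no proper
  normal subgroup containing all involutions.

  If the relation is not aperiodic, the signature of the restriction to the finite orbits, evaluated along an
  ultrafilter that avoids null sets, is a nontrivial morphism to \<open>\<int>/2\<close>.\<close>

section \<open>Bijections inside the orbits\<close>

text \<open>The morphism is not assumed continuous and no category argument is made in the target.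
  The quantitative input is that countably many translates of a neighbourhood cover it, played
  against uncountably many subsets of the naturals. Ergodicity is not assumed either, so sets of
  equal measure need not be exchanged by the full group. The dyadic coordinates supply explicit
  exchanges of cylinders with the same length inside the orbits, and codes written in the digits
  keep sources and destinations disjoint. Digits 0 and 1 are reserved for the two switches
  \<open>\<theta>\<close> and \<open>\<kappa>\<close>; digit 2 tells sources from destinations.
  Smallness in the target is graded by sets \<open>V i\<close> whose products of two elements lie in
  \<open>V (Suc i)\<close>. Conjugation costs two steps and a product one, and this bookkeeping
  produces the index 6. The quotient by null sets is postponed: the constructions use everywhere
  defined bijections that move each point inside its orbit, so infinite products over disjoint
  supports are literal functions, and the morphism is only required to agree on maps that are equal
  almost everywhere.\<close>

abbreviation finv :: "('a \<Rightarrow> 'b) \<Rightarrow> 'b \<Rightarrow> 'a" where "finv f \<equiv> inv_into UNIV f"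

definition supported :: "('a \<Rightarrow> 'a) \<Rightarrow> 'a set \<Rightarrow> bool" where
  "supported T P \<longleftrightarrow> (\<forall>x. x \<notin> P \<longrightarrow> T x = x)"

lemma supportedD: "supported T P \<Longrightarrow> x \<notin> P \<Longrightarrow> T x = x"
  by (simp add: supported_def)

lemma supported_mono: "supported T P \<Longrightarrow> P \<subseteq> Q \<Longrightarrow> supported T Q"
  by (auto simp: supported_def)

lemma supported_inv: "bij T \<Longrightarrow> supported T P \<Longrightarrow> supported (finv T) P"
  by (metis supported_def bij_inv_eq_iff)

lemma supported_mem: "bij T \<Longrightarrow> supported T P \<Longrightarrow> T x \<in> P \<longleftrightarrow> x \<in> P"
  unfolding supported_def by (metis bij_pointE)

lemma supported_image: "bij T \<Longrightarrow> supported T P \<Longrightarrow> T ` P = P"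
  by (metis supported_mem bij_is_surj image_subset_iff subsetI subset_antisym surjD image_eqI)

section \<open>Infinite products over disjoint supports, and elementary exchanges\<close>

definition glue :: "(nat \<Rightarrow> 'a set) \<Rightarrow> (nat \<Rightarrow> 'a \<Rightarrow> 'a) \<Rightarrow> 'a \<Rightarrow> 'a" where
  "glue P T x = (if \<exists>n. x \<in> P n then T (THE n. x \<in> P n) x else x)"

lemma glue_in:
  assumes "disjoint_family P" "x \<in> P n"
  shows "glue P T x = T n x"
proof -
  have "(THE n. x \<in> P n) = n"
    using assms by (auto simp: disjoint_family_on_def)
  then show ?thesis using assms by (auto simp: glue_def)
qed

lemma glue_out: "(\<And>n. x \<notin> P n) \<Longrightarrow> glue P T x = x"
  by (simp add: glue_def)

lemma glue_comp:
  assumes "disjoint_family P" "\<And>n. bij (T n)" "\<And>n. supported (T n) (P n)"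
  shows "glue P S \<circ> glue P T = glue P (\<lambda>n. S n \<circ> T n)"
proof
  fix x
  show "(glue P S \<circ> glue P T) x = glue P (\<lambda>n. S n \<circ> T n) x"
  proof (cases "\<exists>n. x \<in> P n")
    case True
    then obtain n where n: "x \<in> P n" by auto
    then have "T n x \<in> P n" using assms supported_mem by metis
    then show ?thesis using n assms(1) by (simp add: glue_in)
  qed (simp add: glue_out)
qed

lemma glue_id: "glue P (\<lambda>n. id) = id"
  by (auto simp: glue_def)

lemma glue_supported: "supported (glue P T) (\<Union>n. P n)"
  by (auto simp: supported_def glue_def)

text \<open>The basic source of involutions: wherever it is used as one, \<open>g\<close> displaces
  \<open>P\<close> off itself, and the exchange of \<open>P\<close> with its image is then an
  involution in the same orbits as \<open>g\<close>.\<close>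

definition swap :: "('a \<Rightarrow> 'a) \<Rightarrow> 'a set \<Rightarrow> 'a \<Rightarrow> 'a" where
  "swap g P x = (if x \<in> P then g x else if x \<in> g ` P then finv g x else x)"

text \<open>Unlike \<open>restrict\<close>, the value off \<open>P\<close> is the argument itself,
  so for invariant \<open>P\<close> the result is again a bijection of the whole type.\<close>

definition rst :: "('a \<Rightarrow> 'a) \<Rightarrow> 'a set \<Rightarrow> 'a \<Rightarrow> 'a" where
  "rst g P x = (if x \<in> P then g x else x)"

lemma rst_supported: "supported (rst g P) P"
  by (simp add: supported_def rst_def)

lemma swap_supported: "supported (swap g P) (P \<union> g ` P)"
  by (simp add: supported_def swap_def)

lemma swap_in: "x \<in> P \<Longrightarrow> swap g P x = g x"
  by (simp add: swap_def)

lemma swap_in': "bij g \<Longrightarrow> P \<inter> g ` P = {} \<Longrightarrow> x \<in> P \<Longrightarrow> swap g P (g x) = x"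
  by (auto simp: swap_def bij_is_inj)

lemma swap_out: "x \<notin> P \<Longrightarrow> x \<notin> g ` P \<Longrightarrow> swap g P x = x"
  by (simp add: swap_def)

lemma swap_swap: "bij g \<Longrightarrow> P \<inter> g ` P = {} \<Longrightarrow> swap g P \<circ> swap g P = id"
  by (rule ext) (auto simp: swap_def bij_is_inj)

lemma involution_bij: "T \<circ> T = id \<Longrightarrow> bij T"
  by (metis o_bij)

lemma involution_inv: "T \<circ> T = id \<Longrightarrow> finv T = T"
  by (metis inv_unique_comp)

lemma involution_app: "T \<circ> T = id \<Longrightarrow> T (T x) = x"
  by (metis comp_apply id_apply)

text \<open>The acting group is reduced to an enumeration, possibly with repetitions, closed under
  composition and inverse. Each \<open>act n\<close> is the identity off \<open>space M\<close>,
  hence a bijection of the whole type, so plain composition and \<open>finv\<close> suffice. The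
  sets \<open>sep k\<close> carry what is used of the standard Borel structure; separation is asked
  in each order of the two points.\<close>

locale pmp_action = prob_space M for M :: "'a measure" +
  fixes act :: "nat \<Rightarrow> 'a \<Rightarrow> 'a" and sep :: "nat \<Rightarrow> 'a set"
  assumes act_bij: "bij (act n)"
    and act_meas: "act n \<in> M \<rightarrow>\<^sub>M M"
    and act_inv: "\<exists>k. finv (act n) = act k"
    and act_comp: "\<exists>k. act m \<circ> act n = act k"
    and act_id: "\<exists>k. act k = id"
    and act_off: "x \<notin> space M \<Longrightarrow> act n x = x"
    and act_mp: "distr M M (act n) = M"
    and sep_sets: "sep k \<in> sets M"
    and sep_ex: "x \<in> space M \<Longrightarrow> y \<in> space M \<Longrightarrow> x \<noteq> y \<Longrightarrow> \<exists>k. x \<in> sep k \<and> y \<notin> sep k"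
begin

section \<open>The orbit relation and its full group\<close>

definition rel :: "'a \<Rightarrow> 'a \<Rightarrow> bool" where
  "rel x y \<longleftrightarrow> (\<exists>n. y = act n x)"

lemma rel_refl: "rel x x"
  unfolding rel_def using act_id by (metis id_apply)

lemma rel_sym: "rel x y \<Longrightarrow> rel y x"
  unfolding rel_def using act_inv act_bij by (metis bij_inv_eq_iff)

lemma rel_trans: "rel x y \<Longrightarrow> rel y z \<Longrightarrow> rel x z"
  unfolding rel_def using act_comp by (metis comp_apply)

lemma rel_space: "rel x y \<Longrightarrow> x \<in> space M \<longleftrightarrow> y \<in> space M"
  unfolding rel_def using act_meas act_off act_bij by (metis bij_pointE measurable_space)

lemma rel_off: "rel x y \<Longrightarrow> x \<notin> space M \<Longrightarrow> y = x"
  unfolding rel_def using act_off by metis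

text \<open>Membership is demanded at every point and not just almost everywhere, so that gluing and
  conjugating create no exceptional sets; \<open>coset_surj\<close> later finds such a
  representative in every class.\<close>

definition FG :: "('a \<Rightarrow> 'a) set" where
  "FG = {T. bij T \<and> T \<in> M \<rightarrow>\<^sub>M M \<and> finv T \<in> M \<rightarrow>\<^sub>M M \<and> (\<forall>x. rel x (T x))}"

lemma FG_bij: "T \<in> FG \<Longrightarrow> bij T"
  and FG_meas: "T \<in> FG \<Longrightarrow> T \<in> M \<rightarrow>\<^sub>M M"
  and FG_meas_inv: "T \<in> FG \<Longrightarrow> finv T \<in> M \<rightarrow>\<^sub>M M"
  and FG_rel: "T \<in> FG \<Longrightarrow> rel x (T x)"
  by (auto simp: FG_def)

lemma FG_off: "T \<in> FG \<Longrightarrow> x \<notin> space M \<Longrightarrow> T x = x"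
  using FG_rel rel_off by blast

lemma FG_space: "T \<in> FG \<Longrightarrow> T x \<in> space M \<longleftrightarrow> x \<in> space M"
  using FG_rel rel_space by blast

lemma FG_inv:
  assumes T: "T \<in> FG"
  shows "finv T \<in> FG"
proof -
  have "rel x (finv T x)" for x
    using rel_sym[OF FG_rel[OF T, of "finv T x"]] FG_bij[OF T] by (simp add: bij_is_surj surj_f_inv_f)
  then show ?thesis
    unfolding FG_def mem_Collect_eq inv_inv_eq[OF FG_bij[OF T]]
    by (intro conjI allI bij_imp_bij_inv FG_bij FG_meas FG_meas_inv T)
qed

lemma FG_comp:
  assumes S: "S \<in> FG" and T: "T \<in> FG"
  shows "S \<circ> T \<in> FG"
proof -
  have "rel x ((S \<circ> T) x)" for x using rel_trans[OF FG_rel[OF T] FG_rel[OF S]] by simp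
  then show ?thesis
    unfolding FG_def mem_Collect_eq o_inv_distrib[OF FG_bij[OF S] FG_bij[OF T]]
    using measurable_comp[OF FG_meas[OF T] FG_meas[OF S]] measurable_comp[OF FG_meas_inv[OF S] FG_meas_inv[OF T]]
      bij_comp[OF FG_bij[OF T] FG_bij[OF S]] by blast
qed

lemma FG_id: "id \<in> FG"
  by (auto simp: FG_def rel_refl)

lemma FG_act: "act n \<in> FG"
  unfolding FG_def using act_bij act_meas act_inv by (auto simp: rel_def) (metis act_meas)

lemma FG_involutionI:
  assumes "T \<circ> T = id" "T \<in> M \<rightarrow>\<^sub>M M" "\<And>x. rel x (T x)"
  shows "T \<in> FG"
  using assms by (auto simp: FG_def involution_bij involution_inv)

lemma FG_image_eq: "T \<in> FG \<Longrightarrow> A \<in> sets M \<Longrightarrow> T ` A = finv T -` A \<inter> space M"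
  using FG_space[of T] FG_bij[of T] sets.sets_into_space[of A M]
  by (auto simp: bij_is_inj image_iff) (metis bij_inv_eq_iff)

lemma FG_image: "T \<in> FG \<Longrightarrow> A \<in> sets M \<Longrightarrow> T ` A \<in> sets M"
  using FG_image_eq FG_meas_inv by (auto intro: measurable_sets)

lemma FG_vimage: "T \<in> FG \<Longrightarrow> A \<in> sets M \<Longrightarrow> T -` A \<in> sets M"
proof -
  assume a: "T \<in> FG" "A \<in> sets M"
  have "T -` A = T -` A \<inter> space M" using a FG_space sets.sets_into_space by blast
  then show ?thesis using a FG_meas measurable_sets by metis
qed

text \<open>If \<open>f x\<close> and \<open>g x\<close> differ, some \<open>sep k\<close> contains
  the first and misses the second, so equality is a countable conjunction of measurable
  implications.\<close>

lemma eq_sets: 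
  assumes "f \<in> M \<rightarrow>\<^sub>M M" "g \<in> M \<rightarrow>\<^sub>M M"
  shows "{x \<in> space M. f x = g x} \<in> sets M"
proof -
  have "{x \<in> space M. f x = g x} = {x \<in> space M. \<forall>k. f x \<in> sep k \<longrightarrow> g x \<in> sep k}"
    using sep_ex measurable_space[OF assms(1)] measurable_space[OF assms(2)] by (auto, metis)
  moreover have "{x \<in> space M. \<forall>k. f x \<in> sep k \<longrightarrow> g x \<in> sep k} \<in> sets M"
    using assms sep_sets by measurable
  ultimately show ?thesis by simp
qed

lemma act_image_emeasure: "A \<in> sets M \<Longrightarrow> emeasure M (act n ` A) = emeasure M A"
proof -
  assume A: "A \<in> sets M"
  have "emeasure M (act n ` A) = emeasure (distr M M (act n)) (act n ` A)" by (simp add: act_mp)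
  also have "\<dots> = emeasure M (act n -` act n ` A \<inter> space M)"
    using A FG_image[OF FG_act] act_meas by (intro emeasure_distr) auto
  also have "act n -` act n ` A \<inter> space M = A"
    using A sets.sets_into_space act_bij by (auto simp: bij_is_inj inj_vimage_image_eq)
  finally show ?thesis .
qed

text \<open>\<open>T\<close> is piecewise a group element: cutting \<open>A\<close> according to the
  first \<open>n\<close> with \<open>T x = act n x\<close> leaves countably many pieces on which
  invariance under \<open>act n\<close> applies.\<close>

lemma FG_image_emeasure: 
  assumes T: "T \<in> FG" and A: "A \<in> sets M" 
  shows "emeasure M (T ` A) = emeasure M A"
proof -
  define P where "P n = {x \<in> A. T x = act n x \<and> (\<forall>m<n. T x \<noteq> act m x)}" for n
  have e: "{x \<in> space M. T x = act n x} \<in> sets M" for n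
    using eq_sets FG_meas[OF T] act_meas by auto
  have "P n = (A \<inter> {x \<in> space M. T x = act n x}) - (\<Union>m<n. {x \<in> space M. T x = act m x})" for n
    using sets.sets_into_space[OF A] by (auto simp: P_def)
  then have P: "P n \<in> sets M" for n using e A by (metis (no_types, lifting) sets.Diff sets.Int sets.finite_UN finite_lessThan)
  have un: "(\<Union>n. P n) = A"
  proof -
    have "x \<in> (\<Union>n. P n)" if x: "x \<in> A" for x
    proof -
      have "\<exists>n. T x = act n x" using FG_rel[OF T] rel_def by blast
      then have "x \<in> P (LEAST n. T x = act n x)"
        using x unfolding P_def by (auto intro: LeastI dest: not_less_Least) 
      then show ?thesis by blast
    qed
    then show ?thesis by (auto simp: P_def)
  qed
  have dj: "disjoint_family P"
    unfolding disjoint_family_on_def P_def by (auto) (metis linorder_neqE_nat)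
  have im: "T ` P n = act n ` P n" for n by (auto simp: P_def)
  have dj': "disjoint_family (\<lambda>n. T ` P n)"
    using dj FG_bij[OF T] unfolding disjoint_family_on_def
    by (metis bij_is_inj image_Int image_empty)
  have "emeasure M (T ` A) = emeasure M (\<Union>n. T ` P n)" using un by (metis image_UN)
  also have "\<dots> = (\<Sum>n. emeasure M (T ` P n))"
    using dj' P FG_image[OF T] by (intro suminf_emeasure[symmetric]) auto
  also have "\<dots> = (\<Sum>n. emeasure M (P n))" using im P act_image_emeasure by simp
  also have "\<dots> = emeasure M A"
    using dj P un by (subst suminf_emeasure) auto
  finally show ?thesis .
qed

lemma FG_distr: "T \<in> FG \<Longrightarrow> distr M M T = M"
proof (rule measure_eqI)
  fix A assume T: "T \<in> FG" and A: "A \<in> sets (distr M M T)"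
  then have A': "A \<in> sets M" by simp
  have "emeasure (distr M M T) A = emeasure M (T -` A \<inter> space M)"
    using T A' FG_meas by (intro emeasure_distr) auto
  also have "\<dots> = emeasure M (T ` (T -` A \<inter> space M))"
    using FG_image_emeasure[OF T] A' FG_meas[OF T] by simp
  also have "T ` (T -` A \<inter> space M) = A"
  proof (intro Set.set_eqI iffI)
    fix y assume y: "y \<in> A"
    then have "y = T (finv T y)" "y \<in> space M"
      using FG_bij[OF T] A' sets.sets_into_space by (auto simp: bij_is_surj surj_f_inv_f)
    then show "y \<in> T ` (T -` A \<inter> space M)"
      using y FG_space[OF T] by (metis IntI image_eqI vimageI)
  qed auto
  finally show "emeasure (distr M M T) A = emeasure M A" .
qed simp

lemma FG_AE: "T \<in> FG \<Longrightarrow> AE x in M. P x \<Longrightarrow> AE x in M. P (T x)"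
  using AE_distrD[of T M M P] FG_distr FG_meas by metis

lemma FG_swap:
  assumes g: "g \<in> FG" and P: "P \<in> sets M" and d: "P \<inter> g ` P = {}"
  shows "swap g P \<in> FG"
proof (rule FG_involutionI)
  show "swap g P \<circ> swap g P = id" using swap_swap FG_bij g d by blast
  have [measurable]: "g \<in> M \<rightarrow>\<^sub>M M" "finv g \<in> M \<rightarrow>\<^sub>M M" "P \<in> sets M" "g ` P \<in> sets M"
    using g P FG_meas FG_meas_inv FG_image by auto
  show "swap g P \<in> M \<rightarrow>\<^sub>M M" unfolding swap_def by measurable
  show "rel x (swap g P x)" for x
    unfolding swap_def using FG_rel[OF g] FG_rel[OF FG_inv[OF g]] rel_refl by auto
qed

lemma rst_inverse: "bij g \<Longrightarrow> g ` P = P \<Longrightarrow> rst (finv g) P \<circ> rst g P = id \<and> rst g P \<circ> rst (finv g) P = id"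
  unfolding rst_def fun_eq_iff by (auto simp: bij_is_inj bij_is_surj surj_f_inv_f)
    (metis bij_inv_eq_iff image_eqI bij_pointE imageE)+

lemma FG_rst:
  assumes g: "g \<in> FG" and P: "P \<in> sets M" and d: "g ` P = P"
  shows "rst g P \<in> FG"
proof -
  have [measurable]: "g \<in> M \<rightarrow>\<^sub>M M" "finv g \<in> M \<rightarrow>\<^sub>M M" "P \<in> sets M"
    using g P FG_meas FG_meas_inv FG_image by auto
  have i: "rst (finv g) P \<circ> rst g P = id" "rst g P \<circ> rst (finv g) P = id"
    using rst_inverse FG_bij g d by blast+
  then have "finv (rst g P) = rst (finv g) P" by (metis inv_unique_comp)
  moreover have "bij (rst g P)" using i o_bij by blast
  moreover have "rst g P \<in> M \<rightarrow>\<^sub>M M" "rst (finv g) P \<in> M \<rightarrow>\<^sub>M M"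
    unfolding rst_def by measurable
  ultimately show ?thesis
    unfolding FG_def using FG_rel[OF g] rel_refl by (auto simp: rst_def)
qed

lemma glue_meas:
  assumes "\<And>n. T n \<in> M \<rightarrow>\<^sub>M M" "\<And>n. P n \<in> sets M" "disjoint_family P"
  shows "glue P T \<in> M \<rightarrow>\<^sub>M M"
proof -
  let ?C = "insert (space M - (\<Union>n. P n)) (range P)"
  show ?thesis
  proof (rule measurable_piecewise_restrict[of ?C])
    fix Q assume Q: "Q \<in> ?C"
    then show "Q \<inter> space M \<in> sets M" using assms by auto
    consider "Q = space M - (\<Union>n. P n)" | n where "Q = P n" using Q by auto
    then show "glue P T \<in> restrict_space M Q \<rightarrow>\<^sub>M M"
    proof cases
      case 1
      then show ?thesis
        by (subst measurable_cong[where g="\<lambda>x. x"])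
           (auto simp: glue_out space_restrict_space intro: measurable_restrict_space1)
    next
      case 2
      then show ?thesis
        by (subst measurable_cong[where g="T n"])
           (auto simp: glue_in[OF assms(3)] space_restrict_space intro: measurable_restrict_space1 assms(1))
    qed
  qed auto
qed

lemma FG_glue:
  assumes T: "\<And>n. T n \<in> FG" and s: "\<And>n. supported (T n) (P n)" 
    and P: "\<And>n. P n \<in> sets M" and d: "disjoint_family P"
  shows "glue P T \<in> FG"
proof -
  note b = FG_bij[OF T]
  have s': "supported (finv (T n)) (P n)" for n using supported_inv b s by blast
  have i: "glue P (\<lambda>n. finv (T n)) \<circ> glue P T = id" "glue P T \<circ> glue P (\<lambda>n. finv (T n)) = id"
    using glue_comp[OF d, of "\<lambda>n. finv (T n)" T] glue_comp[OF d, of T "\<lambda>n. finv (T n)"] b s s'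
    by (auto simp: bij_imp_bij_inv glue_id[unfolded id_def] bij_is_inj bij_is_surj comp_def surj_f_inv_f id_def)
  then have "finv (glue P T) = glue P (\<lambda>n. finv (T n))" by (metis inv_unique_comp)
  moreover have "bij (glue P T)" using i o_bij by blast
  moreover have "rel x (glue P T x)" for x
    using FG_rel[OF T] rel_refl by (simp add: glue_def)
  ultimately show ?thesis
    unfolding FG_def using glue_meas d P FG_meas[OF T] FG_meas_inv[OF T] by auto
qed

end

section \<open>Transversals and matchings inside infinite orbits\<close>

context pmp_action begin

text \<open>Let \<open>Z n\<close> collect the points of \<open>Y\<close> whose image under
  \<open>act n\<close> is new. The sets \<open>act n\<close> applied to \<open>Z n\<close> are
  disjoint, so their measures are summable, and by Borel-Cantelli almost every point of
  \<open>Y\<close> has only finitely many new images, that is, a finite orbit.\<close>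

lemma null_transversal:
  assumes Y: "Y \<in> sets M" and t: "\<And>x y. x \<in> Y \<Longrightarrow> y \<in> Y \<Longrightarrow> rel x y \<Longrightarrow> x = y"
    and inf: "AE x in M. infinite {y. rel x y}"
  shows "Y \<in> null_sets M"
proof -
  define Z where "Z n = {x \<in> Y. \<forall>m<n. act n x \<noteq> act m x}" for n
  have Ysp: "Y \<subseteq> space M" using Y sets.sets_into_space by blast
  have e: "{x \<in> space M. act n x = act m x} \<in> sets M" for n m
    using eq_sets act_meas by auto
  have "Z n = Y - (\<Union>m<n. {x \<in> space M. act n x = act m x})" for n
    using Ysp by (auto simp: Z_def)
  then have Z: "Z n \<in> sets M" for n using e Y by (metis (no_types, lifting) sets.Diff sets.finite_UN finite_lessThan)
  have dj: "disjoint_family (\<lambda>n. act n ` Z n)"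
  proof -
    have "m = n" if "x \<in> Z m" "y \<in> Z n" "act m x = act n y" for x y m n
    proof -
      have "rel x (act m x)" "rel (act n y) y" unfolding rel_def[of x] using rel_sym rel_def by blast+
      then have "x = y" using that t[of x y] rel_trans unfolding Z_def by auto
      then have eq: "act m x = act n x" using that by simp
      have "\<not> n < m" "\<not> m < n" using that eq \<open>x = y\<close> by (auto simp: Z_def)
      then show ?thesis by simp
    qed
    then show ?thesis unfolding disjoint_family_on_def by auto
  qed
  have "(\<lambda>n. measure M (act n ` Z n)) sums measure M (\<Union>n. act n ` Z n)"
    using dj Z FG_image[OF FG_act] by (intro finite_measure_UNION) auto
  moreover have "measure M (act n ` Z n) = measure M (Z n)" for n
    using act_image_emeasure[OF Z] by (simp add: measure_def)
  ultimately have "summable (\<lambda>n. measure M (Z n))" by (simp add: sums_iff)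
  then have "AE x in M. eventually (\<lambda>n. x \<in> space M - Z n) sequentially"
    using Z by (intro borel_cantelli_AE1) (auto simp: emeasure_eq_measure)
  with inf have "AE x in M. x \<notin> Y"
  proof eventually_elim
    case (elim x)
    show ?case
    proof
      assume x: "x \<in> Y"
      obtain N where N: "\<And>n. n \<ge> N \<Longrightarrow> x \<notin> Z n" using elim by (auto simp: eventually_sequentially)
      have "\<exists>m<N. act n x = act m x" for n
      proof (induction n rule: less_induct)
        case (less n)
        show ?case
        proof (cases "n < N")
          case False
          then have "x \<notin> Z n" using N by simp
          then obtain m where "m < n" "act n x = act m x" using x by (auto simp: Z_def)
          then show ?thesis using less by metis
        qed auto
      qed
      then have "{y. rel x y} \<subseteq> (\<lambda>m. act m x) ` {..<N}" unfolding rel_def by auto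
      then show False using elim finite_subset by blast
    qed
  qed
  then show ?thesis using Y AE_iff_null_sets by blast
qed

text \<open>Greedy matching: \<open>Q\<close> collects, for each pair (group element, separating set) in turn, the
  still unmatched points that are moved across the separating set to an unmatched point. What is
  left over meets every orbit at most once.\<close>

lemma halving:
  assumes P: "P \<in> sets M" and inf: "AE x in M. infinite {y. rel x y}"
  shows "\<exists>Q v. Q \<in> sets M \<and> Q \<subseteq> P \<and> v \<in> FG \<and> v \<circ> v = id \<and> supported v P \<and> Q \<inter> v ` Q = {}
    \<and> P - (Q \<union> v ` Q) \<in> null_sets M"
proof -
  define a where "a j = act (fst (prod_decode j))" for j
  define V where "V j = sep (snd (prod_decode j))" for j
  define q where "q j A = {x \<in> A \<inter> V j. a j x \<in> A \<and> a j x \<notin> V j}" for j A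
  define B where "B = rec_nat P (\<lambda>j A. A - (q j A \<union> a j ` q j A))"
  have B0: "B 0 = P" and BS: "B (Suc j) = B j - (q j (B j) \<union> a j ` q j (B j))" for j
    by (simp_all add: B_def)
  let ?q = "\<lambda>j. q j (B j)"
  have aF: "a j \<in> FG" for j by (simp add: a_def FG_act)
  have V: "V j \<in> sets M" for j by (simp add: V_def sep_sets)
  have qs: "q j A \<in> sets M" if "A \<in> sets M" for j A
  proof -
    have "q j A = A \<inter> V j \<inter> (a j -` A) - a j -` V j" by (auto simp: q_def)
    then show ?thesis using that V FG_vimage[OF aF] by auto
  qed
  have Bs: "B j \<in> sets M" for j
    by (induction j) (simp_all add: B0 BS P qs FG_image[OF aF] sets.Diff sets.Un)
  have qB: "?q j \<subseteq> B j" "a j ` ?q j \<subseteq> B j" for j by (auto simp: q_def)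
  have qd: "?q j \<inter> a j ` ?q j = {}" for j by (auto simp: q_def)
  have Bdec: "B j \<subseteq> B i" if "i \<le> j" for i j
    using that by (rule lift_Suc_antimono_le[rotated]) (auto simp: BS)
  define C where "C j = ?q j \<union> a j ` ?q j" for j
  have Cdj: "C i \<inter> C j = {}" if "i < j" for i j
  proof -
    have "C j \<subseteq> B (Suc i)" using qB[of j] Bdec[of "Suc i" j] that by (auto simp: C_def)
    then show ?thesis by (auto simp: BS C_def)
  qed
  have Cd: "disjoint_family C"
    unfolding disjoint_family_on_def using Cdj by (metis linorder_neqE_nat inf_commute)
  define v where "v = glue C (\<lambda>j. swap (a j) (?q j))"
  have sF: "swap (a j) (?q j) \<in> FG" for j by (rule FG_swap[OF aF qs[OF Bs] qd])
  have ss: "supported (swap (a j) (?q j)) (C j)" for j unfolding C_def by (rule swap_supported)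
  have Cs: "C j \<in> sets M" for j unfolding C_def using qs Bs FG_image[OF aF] by auto
  have vF: "v \<in> FG" unfolding v_def using FG_glue[OF sF ss Cs Cd] .
  have vv: "v \<circ> v = id" unfolding v_def
    using glue_comp[OF Cd FG_bij[OF sF] ss, of "\<lambda>j. swap (a j) (?q j)"] swap_swap[OF FG_bij[OF aF] qd]
    by (simp add: glue_id)
  have CP: "C j \<subseteq> P" for j using qB[of j] Bdec[of 0 j] by (auto simp: C_def B0)
  have vsup: "supported v P" unfolding v_def
    by (rule supported_mono[OF glue_supported]) (use CP in blast)
  define Q where "Q = (\<Union>j. ?q j)"
  have vq: "v ` ?q j = a j ` ?q j" for j
  proof (rule image_cong)
    fix x assume "x \<in> ?q j"
    then show "v x = a j x" unfolding v_def
      by (subst glue_in[OF Cd, of _ j]) (auto simp: C_def swap_in)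
  qed simp
  have vQ: "v ` Q = (\<Union>j. a j ` ?q j)" unfolding Q_def image_UN using vq by simp
  have Qd: "Q \<inter> v ` Q = {}"
  proof -
    have "?q i \<inter> a j ` ?q j = {}" for i j
    proof (cases "i = j")
      case False
      then have "C i \<inter> C j = {}" using Cd by (auto simp: disjoint_family_on_def)
      then show ?thesis by (auto simp: C_def)
    qed (use qd in auto)
    then show ?thesis unfolding vQ by (subst Q_def) blast
  qed
  have rest: "P - (Q \<union> v ` Q) = (\<Inter>j. B j)"
  proof -
    have "B j = P - (\<Union>i<j. C i)" for j
    proof (induction j)
      case (Suc j)
      have "B (Suc j) = B j - C j" by (simp add: BS C_def)
      then show ?case using Suc by (auto simp: lessThan_Suc)
    qed (simp add: B0)
    then have "(\<Inter>j. B j) = P - (\<Union>i. C i)" by auto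
    then show ?thesis unfolding vQ by (subst Q_def) (auto simp: C_def)
  qed
  have "(\<Inter>j. B j) \<in> null_sets M"
  proof (rule null_transversal[OF _ _ inf])
    show "(\<Inter>j. B j) \<in> sets M" using Bs by (intro sets.countable_INT) auto
    fix x y assume x: "x \<in> (\<Inter>j. B j)" and y: "y \<in> (\<Inter>j. B j)" and r: "rel x y"
    show "x = y"
    proof (rule ccontr)
      assume ne: "x \<noteq> y"
      obtain n where n: "y = act n x" using r by (auto simp: rel_def)
      have "x \<in> space M" "y \<in> space M" using x y B0 P sets.sets_into_space by blast+
      then obtain k where k: "x \<in> sep k" "y \<notin> sep k" using sep_ex ne by blast
      \<comment> \<open>Both points are still unmatched at this stage and \<open>act n\<close> moves
        \<open>x\<close> across \<open>sep k\<close> to \<open>y\<close>, so the greedy rule removes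
        them here.\<close>
      let ?j = "prod_encode (n, k)"
      have "x \<in> q ?j (B ?j)" using x y n k by (auto simp: q_def a_def V_def)
      then have "x \<notin> B (Suc ?j)" by (simp add: BS)
      then show False using x by blast
    qed
  qed
  moreover have "Q \<in> sets M" unfolding Q_def using qs Bs by auto
  moreover have "Q \<subseteq> P" unfolding Q_def using CP by (auto simp: C_def)
  ultimately show ?thesis using vF vv vsup Qd rest by metis
qed

end

section \<open>Dyadic coordinates\<close>

text \<open>\<open>S x\<close> is the set of positions of the digits 1 of \<open>x\<close>, and \<open>u F\<close> changes the digits at the
  positions in \<open>F\<close>; this is the orbit structure of \<open>\<Oplus>\<^sub>\<nat> \<int>/2\<close> acting on binary sequences.\<close>

definition (in pmp_action) dyadic :: "'a set \<Rightarrow> ('a \<Rightarrow> nat set) \<Rightarrow> (nat set \<Rightarrow> 'a \<Rightarrow> 'a) \<Rightarrow> bool" where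
  "dyadic \<Omega> S u \<longleftrightarrow> \<Omega> \<in> sets M \<and> space M - \<Omega> \<in> null_sets M \<and> (\<forall>x y. rel x y \<longrightarrow> x \<in> \<Omega> \<longrightarrow> y \<in> \<Omega>) \<and>
    (\<forall>i. {x \<in> \<Omega>. i \<in> S x} \<in> sets M) \<and>
    (\<forall>F. finite F \<longrightarrow> u F \<in> FG \<and> (\<forall>x. x \<notin> \<Omega> \<longrightarrow> u F x = x) \<and> (\<forall>x\<in>\<Omega>. S (u F x) = sym_diff (S x) F)) \<and>
    (\<forall>F G x. finite F \<longrightarrow> finite G \<longrightarrow> u F (u G x) = u (sym_diff F G) x) \<and> u {} = id"

context pmp_action begin

text \<open>Only the chosen half is halved again: \<open>v n\<close> exchanges
  \<open>B (Suc n)\<close> with the other half of \<open>B n\<close>. Folding a point successively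
  into \<open>B 1\<close>, \<open>B 2\<close>, and so on produces its digits, digit \<open>n\<close>
  recording whether \<open>v n\<close> was applied. Changing finitely many digits means folding far
  enough and unfolding along the new digits.\<close>

lemma dyadic_exists:
  assumes inf: "AE x in M. infinite {y. rel x y}"
  shows "\<exists>\<Omega> S u. dyadic \<Omega> S u"
proof -
  define half where "half P Q v \<longleftrightarrow> Q \<in> sets M \<and> Q \<subseteq> P \<and> v \<in> FG \<and> v \<circ> v = id \<and> supported v P
    \<and> Q \<inter> v ` Q = {} \<and> P - (Q \<union> v ` Q) \<in> null_sets M" for P Q v
  define hQ where "hQ P = (SOME Q. \<exists>v. half P Q v)" for P
  define hv where "hv P = (SOME v. half P (hQ P) v)" for P
  have "half P (hQ P) (hv P)" if "P \<in> sets M" for P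
  proof -
    have "\<exists>Q v. half P Q v" unfolding half_def by (rule halving[OF that inf])
    then have "\<exists>v. half P (hQ P) v" unfolding hQ_def by (rule someI_ex)
    then show ?thesis unfolding hv_def by (rule someI_ex)
  qed
  note h = this[unfolded half_def]
  define B where "B = rec_nat (space M) (\<lambda>n. hQ)"
  have B0: "B 0 = space M" and BSuc: "B (Suc n) = hQ (B n)" for n by (simp_all add: B_def)
  have Bs: "B n \<in> sets M" for n by (induction n) (simp_all add: B0 BSuc h)
  define v where "v n = hv (B n)" for n
  have vF: "v n \<in> FG" and vv: "v n \<circ> v n = id" and vs: "supported (v n) (B n)"
    and BS: "B (Suc n) \<subseteq> B n" and vd: "B (Suc n) \<inter> v n ` B (Suc n) = {}"
    and N0: "B n - (B (Suc n) \<union> v n ` B (Suc n)) \<in> null_sets M" for n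
    using h[OF Bs[of n]] by (simp_all add: v_def BSuc)
  define N where "N n = B n - (B (Suc n) \<union> v n ` B (Suc n))" for n
  \<comment> \<open>Entire orbits meeting a null remainder \<open>N n\<close> are discarded, so that
    the good set is invariant and folding never gets stuck on it.\<close>
  define \<Omega> where "\<Omega> = {x \<in> space M. \<forall>m n. act m x \<notin> N n}"
  have NN: "N n \<in> null_sets M" for n using N0 by (simp add: N_def)
  have \<Omega>c: "\<Omega> = space M - (\<Union>m n. act m -` N n)" by (auto simp: \<Omega>_def)
  have \<Omega>s: "\<Omega> \<in> sets M"
  proof -
    have "act m -` N n \<in> sets M" for m n using FG_vimage[OF FG_act] NN by blast
    then show ?thesis unfolding \<Omega>c by (intro sets.Diff sets.countable_UN) auto
  qed
  have "AE x in M. x \<in> \<Omega>"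
  proof -
    have "AE x in M. act m x \<notin> N n" for m n
      using FG_AE[OF FG_act AE_not_in[OF NN]] .
    then have "AE x in M. \<forall>m n. act m x \<notin> N n" by (simp add: AE_all_countable)
    with AE_space show ?thesis by eventually_elim (simp add: \<Omega>_def)
  qed
  then have \<Omega>0: "space M - \<Omega> \<in> null_sets M"
    using \<Omega>s by (subst AE_iff_null_sets) (auto elim: eventually_mono)
  have \<Omega>r: "y \<in> \<Omega>" if "rel x y" "x \<in> \<Omega>" for x y
  proof -
    have "\<exists>k. act m y = act k x" for m
      using rel_trans[OF that(1), of "act m y"] by (auto simp: rel_def)
    then show ?thesis using that rel_space[OF that(1)] unfolding \<Omega>_def by (auto, metis)
  qed
  have F\<Omega>: "T x \<in> \<Omega>" if "T \<in> FG" "x \<in> \<Omega>" for T x using \<Omega>r[OF FG_rel] that by blast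
  have split: "z \<in> B (Suc n) \<or> v n z \<in> B (Suc n)" if "z \<in> B n" "z \<in> \<Omega>" for z n
  proof -
    obtain k where "act k = id" using act_id by blast
    then have "z \<notin> N n" using that(2) by (auto simp: \<Omega>_def) (metis id_apply)
    then show ?thesis using that(1) involution_app[OF vv] by (auto simp: N_def)
  qed
  have vB: "v n z \<notin> B (Suc n)" if "z \<in> B (Suc n)" for n z using vd that by blast
  have vB': "v n z \<in> B n" if "z \<in> B n" for n z
    using supported_mem[OF FG_bij[OF vF] vs] that by blast
  \<comment> \<open>\<open>r n x\<close> is the point of \<open>B n\<close> to which
    \<open>x\<close> is folded after \<open>n\<close> steps.\<close>
  define r where "r = rec_nat id (\<lambda>n f x. if f x \<in> B (Suc n) then f x else v n (f x))"
  have r0: "r 0 = id" and rS: "r (Suc n) x = (if r n x \<in> B (Suc n) then r n x else v n (r n x))" for n x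
    by (simp_all add: r_def)
  have rm: "r n \<in> M \<rightarrow>\<^sub>M M" for n
  proof (induction n)
    case (Suc n)
    have "{x \<in> space M. r n x \<in> B (Suc n)} = r n -` B (Suc n) \<inter> space M" by auto
    then have "(\<lambda>x. if r n x \<in> B (Suc n) then r n x else v n (r n x)) \<in> M \<rightarrow>\<^sub>M M"
      using measurable_sets[OF Suc Bs]
      by (intro measurable_If[OF Suc measurable_compose[OF Suc FG_meas[OF vF]]]) simp
    moreover have "r (Suc n) = (\<lambda>x. if r n x \<in> B (Suc n) then r n x else v n (r n x))"
      by (rule ext) (rule rS)
    ultimately show ?case by simp
  qed (simp add: r0)
  have rr: "rel x (r n x)" for n x
    by (induction n) (auto simp: r0 rS rel_refl intro: rel_trans FG_rel[OF vF])
  have rB: "r n x \<in> B n \<and> r n x \<in> \<Omega>" if "x \<in> \<Omega>" for n x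
  proof (induction n)
    case 0 then show ?case using that \<Omega>_def by (auto simp: r0 B0)
  next
    case (Suc n) then show ?case using split[of "r n x" n] F\<Omega>[OF vF] by (auto simp: rS)
  qed
  define S where "S x = {n. r n x \<notin> B (Suc n)}" for x
  \<comment> \<open>The first \<open>n\<close> folding moves as prescribed by a digit set instead of
    by the point; for fixed digits this is an element of \<open>FG\<close>, which makes it
    invertible and measurable.\<close>
  define a where "a = rec_nat (\<lambda>F. id) (\<lambda>n f F. (if n \<in> F then v n else id) \<circ> f F)"
  have a0: "a 0 F = id" and aS: "a (Suc n) F = (if n \<in> F then v n else id) \<circ> a n F" for n and F :: "nat set"
    by (simp_all add: a_def)
  have aF: "a n F \<in> FG" for n F
  proof (induction n)
    case 0 then show ?case unfolding a0 by (rule FG_id)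
  next
    case (Suc n)
    have "(if n \<in> F then v n else id) \<in> FG" using vF[of n] FG_id by presburger
    then show ?case unfolding aS by (rule FG_comp[OF _ Suc])
  qed
  have acong: "a n F = a n G" if "\<And>i. i < n \<Longrightarrow> i \<in> F \<longleftrightarrow> i \<in> G" for n F G
    using that
  proof (induction n)
    case (Suc n)
    have "n \<in> F \<longleftrightarrow> n \<in> G" using Suc.prems by simp
    then show ?case using Suc by (simp only: aS less_SucI)
  qed (simp only: a0)
  have ra: "r n x = a n (S x) x" for n x
    by (induction n) (auto simp: r0 a0 rS aS S_def)
  \<comment> \<open>Unfolding is possible along any prescribed digits: every point of
    \<open>B n\<close> in the good set is reached from exactly the point that unfolding
    produces.\<close>
  have ai: "finv (a n F) z \<in> \<Omega> \<and> r n (finv (a n F) z) = z \<and> (\<forall>i<n. i \<in> S (finv (a n F) z) \<longleftrightarrow> i \<in> F)"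
    if "z \<in> B n" "z \<in> \<Omega>" for n F z
    using that
  proof (induction n arbitrary: z)
    case 0 then show ?case by (simp add: a0 r0)
  next
    case (Suc n)
    define z' where "z' = (if n \<in> F then v n z else z)"
    have "finv (a (Suc n) F) z = finv (a n F) z'"
      unfolding aS z'_def using FG_bij[OF aF] FG_bij[OF vF] involution_inv[OF vv]
      by (auto simp: o_inv_distrib)
    moreover have "z' \<in> B n" "z' \<in> \<Omega>" unfolding z'_def using Suc.prems BS vB' F\<Omega>[OF vF] by auto
    moreover have "z' \<in> B (Suc n) \<longleftrightarrow> n \<notin> F" using Suc.prems vB by (auto simp: z'_def)
    moreover have "(if z' \<in> B (Suc n) then z' else v n z') = z"
      using Suc.prems vB involution_app[OF vv] by (auto simp: z'_def)
    ultimately show ?case using Suc.IH[of z'] by (auto simp: rS S_def less_Suc_eq)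
  qed
  define L where "L F = (LEAST n. F \<subseteq> {..<n})" for F :: "nat set"
  have L: "F \<subseteq> {..<L F}" if "finite F" for F
    unfolding L_def using that finite_nat_iff_bounded LeastI_ex[of "\<lambda>n. F \<subseteq> {..<n}"] by blast
  \<comment> \<open>\<open>L F\<close> bounds the positions in \<open>F\<close>, so all changes take
    place before this folding depth and later digits depend on \<open>r (L F) x\<close>
    alone.\<close>
  define u where "u F x = (if x \<in> \<Omega> then finv (a (L F) (sym_diff (S x) F)) (r (L F) x) else x)" for F x
  have later: "r n y = r n x \<and> (n \<in> S y \<longleftrightarrow> n \<in> S x)" if "r m y = r m x" "m \<le> n" for m n x y
    using that(2)
  proof (induction n rule: dec_induct)
    case base then show ?case using that by (simp add: S_def)
  next
    case (step n) then show ?case by (simp add: rS S_def)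
  qed
  have u\<Omega>: "u F x \<in> \<Omega>" and uS: "S (u F x) = sym_diff (S x) F" and ur: "r (L F) (u F x) = r (L F) x"
    if "finite F" "x \<in> \<Omega>" for F x
  proof -
    note * = ai[OF conjunct1[OF rB[OF that(2)]] conjunct2[OF rB[OF that(2)]], of "L F" "sym_diff (S x) F"]
    show "u F x \<in> \<Omega>" and r: "r (L F) (u F x) = r (L F) x" using * that by (auto simp: u_def)
    have b: "\<forall>i<L F. i \<in> S (u F x) \<longleftrightarrow> i \<in> sym_diff (S x) F" using * that by (auto simp: u_def)
    have "i \<in> S (u F x) \<longleftrightarrow> i \<in> sym_diff (S x) F" for i
    proof (cases "i < L F")
      case False
      then have "i \<in> S (u F x) \<longleftrightarrow> i \<in> S x" using later[OF r, of i] by simp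
      moreover have "i \<notin> F" using False L[OF that(1)] by auto
      ultimately show ?thesis by auto
    qed (use b in auto)
    then show "S (u F x) = sym_diff (S x) F" by blast
  qed
  \<comment> \<open>Digits together with one folded point determine the point, since
    \<open>r n x\<close> is the value at \<open>x\<close> of the injective map
    \<open>a n (S x)\<close>.\<close>
  have uniq: "x = y" if "S x = S y" "r n x = r n y" for x y n
    using that ra[of n x] ra[of n y] FG_bij[OF aF] by (metis bij_inv_eq_iff)
  have uu: "u F (u G x) = u (sym_diff F G) x" if "finite F" "finite G" for F G x
  proof (cases "x \<in> \<Omega>")
    case True
    let ?H = "sym_diff F G" and ?n = "max (L F) (max (L G) (L (sym_diff F G)))"
    have fH: "finite ?H" using that by auto
    have "r ?n (u F (u G x)) = r ?n (u G x)"
      using later[OF ur[OF that(1) u\<Omega>[OF that(2) True]], of ?n] by simp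
    also have "\<dots> = r ?n x" using later[OF ur[OF that(2) True], of ?n] by simp
    also have "\<dots> = r ?n (u ?H x)" using later[OF ur[OF fH True], of ?n] by simp
    finally have "r ?n (u F (u G x)) = r ?n (u ?H x)" .
    moreover have "S (u F (u G x)) = S (u ?H x)"
      using uS[OF that(1) u\<Omega>[OF that(2) True]] uS[OF that(2) True] uS[OF fH True] by auto
    ultimately show ?thesis using uniq by blast
  qed (simp add: u_def)
  have u0: "u {} = id"
  proof
    show "u {} x = id x" for x
    proof (cases "x \<in> \<Omega>")
      case True
      have "S (u {} x) = S x" using uS[of "{}" x] True by simp
      then have "u {} x = x" using uniq ur[of "{}" x] True by blast
      then show ?thesis by simp
    qed (simp add: u_def)
  qed
  have Ss: "{x \<in> space M. i \<in> S x} \<in> sets M" for i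
  proof -
    have "{x \<in> space M. i \<in> S x} = space M - (r i -` B (Suc i) \<inter> space M)" by (auto simp: S_def)
    then show ?thesis using measurable_sets[OF rm Bs] by auto
  qed
  have uF: "u F \<in> FG" if f: "finite F" for F
  proof (rule FG_involutionI)
    have "sym_diff F F = {}" by auto
    then show "u F \<circ> u F = id" using uu[OF f f] u0 by (auto simp: fun_eq_iff)
    show "rel x (u F x)" for x
    proof (cases "x \<in> \<Omega>")
      case True
      have "rel x (r (L F) x)" by (rule rr)
      moreover have "rel (r (L F) x) (finv (a (L F) (sym_diff (S x) F)) (r (L F) x))"
        by (rule FG_rel[OF FG_inv[OF aF]])
      ultimately show ?thesis using True rel_trans by (simp add: u_def)
    qed (simp add: u_def rel_refl)
    \<comment> \<open>Only digits below \<open>L F\<close> influence \<open>u F\<close>, so it is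
      measurable as a choice among finitely many measurable maps.\<close>
    let ?s = "\<lambda>x. S x \<inter> {..<L F}"
    have sm: "?s \<in> M \<rightarrow>\<^sub>M count_space (Pow {..<L F})"
    proof (subst measurable_count_space_eq2)
      show "?s \<in> space M \<rightarrow> Pow {..<L F} \<and> (\<forall>A\<in>Pow {..<L F}. ?s -` {A} \<inter> space M \<in> sets M)"
      proof (intro conjI ballI)
        fix A assume "A \<in> Pow {..<L F}"
        then have "?s -` {A} \<inter> space M = {x \<in> space M. \<forall>i\<in>{..<L F}. x \<in> {x \<in> space M. i \<in> S x} \<longleftrightarrow> i \<in> A}"
          by auto
        also have "\<dots> \<in> sets M" using Ss by measurable
        finally show "?s -` {A} \<inter> space M \<in> sets M" .
      qed auto
    qed simp
    have "(\<lambda>x. (\<lambda>\<sigma> x. finv (a (L F) (sym_diff \<sigma> F)) (r (L F) x)) (?s x) x) \<in> M \<rightarrow>\<^sub>M M"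
    proof (rule measurable_compose_countable'[OF _ sm])
      show "(\<lambda>x. finv (a (L F) (sym_diff \<sigma> F)) (r (L F) x)) \<in> M \<rightarrow>\<^sub>M M" for \<sigma>
        using measurable_compose[OF rm FG_meas_inv[OF aF]] .
    qed (simp add: countable_finite)
    moreover have "a (L F) (sym_diff (?s x) F) = a (L F) (sym_diff (S x) F)" for x
      by (rule acong) auto
    ultimately have "(\<lambda>x. finv (a (L F) (sym_diff (S x) F)) (r (L F) x)) \<in> M \<rightarrow>\<^sub>M M" by simp
    then show "u F \<in> M \<rightarrow>\<^sub>M M" unfolding u_def using \<Omega>s by measurable
  qed
  have "{x \<in> \<Omega>. i \<in> S x} \<in> sets M" for i
  proof -
    have "{x \<in> \<Omega>. i \<in> S x} = \<Omega> \<inter> {x \<in> space M. i \<in> S x}" by (auto simp: \<Omega>_def)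
    then show ?thesis using \<Omega>s Ss by auto
  qed
  then have "dyadic \<Omega> S u"
    unfolding dyadic_def using \<Omega>s \<Omega>0 \<Omega>r uF uS uu u0 u_def by simp
  then show ?thesis by blast
qed

end

section \<open>Homomorphisms that are trivial on involutions\<close>

lemma glue_mono:
  assumes "disjoint_family P" "disjoint_family R" "\<And>n. supported (T n) (P n)" "\<And>n. P n \<subseteq> R n"
  shows "glue P T = glue R T"
proof
  fix x
  show "glue P T x = glue R T x"
  proof (cases "\<exists>n. x \<in> R n")
    case True
    then obtain n where n: "x \<in> R n" by blast
    show ?thesis
    proof (cases "x \<in> P n")
      case True
      then show ?thesis using n assms by (simp add: glue_in)
    next
      case False
      have "x \<notin> P m" for m
        using n False assms(2,4) unfolding disjoint_family_on_def by (cases "m = n") blast+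
      then have "glue P T x = x" by (rule glue_out)
      moreover have "glue R T x = T n x" using n assms(2) by (rule glue_in[rotated])
      ultimately show ?thesis using supportedD[OF assms(3) False] by simp
    qed
  next
    case False
    then have "x \<notin> P n" for n using assms(4) by blast
    then show ?thesis using False by (simp add: glue_out)
  qed
qed

lemma supported_conj: "bij g \<Longrightarrow> supported T P \<Longrightarrow> supported (g \<circ> T \<circ> finv g) (g ` P)"
  unfolding supported_def by (metis bij_inv_eq_iff comp_apply image_eqI)

lemma involution_comp3: "g \<circ> g = id \<Longrightarrow> k \<circ> k = id \<Longrightarrow> (g \<circ> k \<circ> g) \<circ> (g \<circ> k \<circ> g) = id"
  by (auto simp: fun_eq_iff)

context pmp_action begin

text \<open>Greedy choice over the separating sets: a point that \<open>T\<close> moves out of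
  \<open>sep k\<close> is added at stage \<open>k\<close> unless a neighbour on its
  \<open>T\<close>-orbit was taken earlier. The resulting set is displaced by \<open>T\<close>, and
  every moved point is in it or next to it.\<close>

lemma exists_section:
  assumes T: "T \<in> FG"
  shows "\<exists>A\<in>sets M. A \<inter> T ` A = {} \<and> (\<forall>x. T x \<noteq> x \<longrightarrow> x \<in> A \<union> T ` A \<union> finv T ` A)"
proof -
  have TiT: "T (finv T x) = x" "finv T (T x) = x" for x
    using FG_bij[OF T] by (auto simp: bij_is_surj bij_is_inj surj_f_inv_f)
  define D where "D k = sep k - T -` sep k" for k
  define Z where "Z k A = D k - T ` A - finv T ` A" for k A
  define A where "A = rec_nat {} (\<lambda>k A. A \<union> Z k A)"
  have A0: "A 0 = {}" and AS: "A (Suc k) = A k \<union> Z k (A k)" for k by (simp_all add: A_def)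
  have As: "A k \<in> sets M" for k
  proof (induction k)
    case (Suc k)
    have "T ` A k \<in> sets M" "finv T ` A k \<in> sets M" "T -` sep k \<in> sets M"
      using Suc FG_image[OF T] FG_image[OF FG_inv[OF T]] FG_vimage[OF T sep_sets] by auto
    then show ?case using Suc sep_sets[of k] by (simp only: AS Z_def D_def sets.Un sets.Diff)
  qed (simp add: A0)
  have Ad: "x \<in> A k \<Longrightarrow> T x \<notin> A k" for x k
  proof (induction k arbitrary: x)
    case (Suc k)
    have "T x \<notin> A k" if "x \<in> Z k (A k)" using that TiT(2)[of x] unfolding Z_def by (metis DiffD2 image_eqI)
    moreover have "T x \<notin> Z k (A k)" if "x \<in> Z k (A k)" using that by (auto simp: Z_def D_def)
    moreover have "T x \<notin> Z k (A k)" if "x \<in> A k" using that by (auto simp: Z_def)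
    ultimately show ?case using Suc by (auto simp: AS)
  qed (simp add: A0)
  have Am: "A k \<subseteq> A l" if "k \<le> l" for k l
    using that by (rule lift_Suc_mono_le[rotated]) (auto simp: AS)
  let ?A = "\<Union>k. A k"
  have "x \<in> ?A \<Longrightarrow> T x \<notin> ?A" for x
  proof
    assume "x \<in> ?A" "T x \<in> ?A"
    then obtain k l where "x \<in> A k" "T x \<in> A l" by blast
    then have "x \<in> A (max k l)" "T x \<in> A (max k l)" using Am[of k "max k l"] Am[of l "max k l"] by auto
    then show False using Ad by blast
  qed
  then have "?A \<inter> T ` ?A = {}" by blast
  moreover have "x \<in> ?A \<union> T ` ?A \<union> finv T ` ?A" if "T x \<noteq> x" for x
  proof -
    have sp: "x \<in> space M" "T x \<in> space M" using that FG_off[OF T] FG_space[OF T] by metis+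
    have "\<exists>k. x \<in> sep k \<and> T x \<notin> sep k" by (rule sep_ex[OF sp that[symmetric]])
    then obtain k where "x \<in> sep k" "T x \<notin> sep k" by blast
    then have "x \<in> D k" by (simp add: D_def)
    then have "x \<in> A (Suc k) \<union> T ` A k \<union> finv T ` A k" by (auto simp: AS Z_def)
    then show ?thesis by blast
  qed
  moreover have "?A \<in> sets M" using As by auto
  ultimately show ?thesis by blast
qed

text \<open>Multiplying by \<open>swap T A\<close> makes \<open>T\<close> fix the image of
  \<open>A\<close>. The points outside \<open>A\<close> that still move form \<open>Q\<close>; the
  corrected map sends them into \<open>A\<close>, and their preimages under it also lie in
  \<open>A\<close> by the covering property. Exchanging \<open>Q\<close> with these preimages
  repairs them, so up to two involutions \<open>T\<close> lives on the displaced set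
  \<open>A\<close>.\<close>

lemma shrink_support:
  assumes T: "T \<in> FG" and s: "supported T P"
  shows "\<exists>A J. A \<in> sets M \<and> A \<subseteq> P \<and> A \<inter> T ` A = {} \<and> J \<in> FG \<and> J \<circ> J = id \<and> supported J P \<and>
    supported (T \<circ> swap T A \<circ> J) A"
proof -
  obtain A where A: "A \<in> sets M" "A \<inter> T ` A = {}"
    and cov: "\<And>x. T x \<noteq> x \<Longrightarrow> x \<in> A \<union> T ` A \<union> finv T ` A"
    using exists_section[OF T] by blast
  have b: "bij T" using FG_bij[OF T] .
  have inj: "T x = T y \<longleftrightarrow> x = y" for x y using b by (simp add: bij_is_inj inj_eq)
  have TiT: "T (finv T x) = x" "finv T (T x) = x" for x
    using b by (auto simp: bij_is_surj bij_is_inj surj_f_inv_f)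
  have AP: "A \<subseteq> P" using A(2) s by (force simp: supported_def)
  define I where "I = swap T A"
  have IF: "I \<in> FG" unfolding I_def using FG_swap[OF T A] .
  define T' where "T' = T \<circ> I"
  have T'F: "T' \<in> FG" unfolding T'_def using FG_comp[OF T IF] .
  have T'b: "bij T'" using FG_bij[OF T'F] .
  have T'A: "T' a = T (T a)" if "a \<in> A" for a using that by (simp add: T'_def I_def swap_in)
  have T'TA: "T' (T a) = T a" if "a \<in> A" for a using that swap_in'[OF b A(2)] by (simp add: T'_def I_def)
  have T'o: "T' x = T x" if "x \<notin> A" "x \<notin> T ` A" for x using that by (simp add: T'_def I_def swap_out)
  define Q where "Q = finv T ` A - (A \<union> T ` A)"
  have Qs: "Q \<in> sets M" unfolding Q_def
    using A(1) FG_image[OF T] FG_image[OF FG_inv[OF T]] by (intro sets.Diff sets.Un) auto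
  have QA: "finv T' y \<in> A" if y: "y \<in> Q" for y
  proof -
    have Ty: "T y \<in> A" "y \<notin> A" "y \<notin> T ` A" using y TiT by (auto simp: Q_def)
    define z where "z = finv T y"
    have z: "T z = y" using TiT by (simp add: z_def)
    have "y \<noteq> T y" using Ty by metis
    then have "T z \<noteq> z" using z inj by metis
    then have "z \<in> A \<union> T ` A \<union> finv T ` A" using cov by blast
    moreover have "z \<notin> A" using Ty(3) z by blast
    moreover have "z \<notin> finv T ` A" using Ty(2) z TiT by auto
    ultimately obtain a where a: "a \<in> A" "z = T a" by blast
    then have "T' a = y" using T'A z by simp
    then show ?thesis using a T'b by (metis bij_inv_eq_iff)
  qed
  define J where "J = swap (finv T') Q"
  have Qd: "Q \<inter> finv T' ` Q = {}" using QA by (auto simp: Q_def)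
  have JF: "J \<in> FG" unfolding J_def using FG_swap[OF FG_inv[OF T'F] Qs Qd] .
  have JJ: "J \<circ> J = id" unfolding J_def using swap_swap[OF bij_imp_bij_inv[OF T'b] Qd] .
  have QP: "Q \<subseteq> P" 
  proof
    fix y assume y: "y \<in> Q"
    then have "T y \<in> P" using AP TiT by (auto simp: Q_def)
    then show "y \<in> P" using supported_mem[OF b s] by blast
  qed
  have JP: "supported J P" unfolding J_def
    by (rule supported_mono[OF swap_supported]) (use QP QA AP in auto)
  have "supported (T' \<circ> J) A"
    unfolding supported_def
  proof (intro allI impI)
    fix x assume x: "x \<notin> A"
    show "(T' \<circ> J) x = x"
    proof (cases "x \<in> Q")
      case True
      then show ?thesis using T'b by (simp add: J_def swap_in bij_is_surj surj_f_inv_f)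
    next
      case False
      then have "J x = x" using x QA by (auto simp: J_def intro!: swap_out)
      moreover have "T' x = x"
      proof (cases "x \<in> T ` A")
        case True then show ?thesis using T'TA by blast
      next
        case F2: False
        then have "x \<notin> finv T ` A" using False x by (auto simp: Q_def)
        then show ?thesis using cov[of x] x F2 T'o by auto
      qed
      ultimately show ?thesis by simp
    qed
  qed
  then show ?thesis using A AP JF JJ JP unfolding T'_def I_def by blast
qed

end

text \<open>A morphism from the full group is carried as a function on representatives;
  \<open>pi_AE\<close> says that it factors through the classes modulo null sets.\<close>

locale fg_hom = pmp_action M act sep + H: group H
  for M :: "'a measure" and act sep and H :: "('h, 'k) monoid_scheme" (structure) +
  fixes \<pi> :: "('a \<Rightarrow> 'a) \<Rightarrow> 'h"
  assumes pi_closed: "T \<in> FG \<Longrightarrow> \<pi> T \<in> carrier H"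
    and pi_comp: "S \<in> FG \<Longrightarrow> T \<in> FG \<Longrightarrow> \<pi> (S \<circ> T) = \<pi> S \<otimes> \<pi> T"
    and pi_AE: "S \<in> FG \<Longrightarrow> T \<in> FG \<Longrightarrow> AE x in M. S x = T x \<Longrightarrow> \<pi> S = \<pi> T"
begin

lemma pi_id: "\<pi> id = \<one>"
  using pi_comp[OF FG_id FG_id] pi_closed[OF FG_id] by (metis H.l_cancel_one comp_id)

lemma pi_involution_sq: "S \<in> FG \<Longrightarrow> S \<circ> S = id \<Longrightarrow> \<pi> S \<otimes> \<pi> S = \<one>"
  using pi_comp[of S S] pi_id by simp

lemma pi_inv: "S \<in> FG \<Longrightarrow> \<pi> (finv S) = inv (\<pi> S)"
proof -
  assume S: "S \<in> FG"
  have "finv S \<circ> S = id" using FG_bij[OF S] by (simp add: bij_is_inj)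
  then have "\<pi> (finv S) \<otimes> \<pi> S = \<one>" using pi_comp[OF FG_inv[OF S] S] pi_id by metis
  then show ?thesis using pi_closed[OF S] pi_closed[OF FG_inv[OF S]] H.inv_equality by metis
qed

lemma pi_intertwine:
  assumes "D \<in> FG" "S \<in> FG" "T \<in> FG" "D \<circ> S = T \<circ> D"
  shows "\<pi> T = \<pi> D \<otimes> \<pi> S \<otimes> inv (\<pi> D)"
proof -
  have "\<pi> T \<otimes> \<pi> D = \<pi> D \<otimes> \<pi> S" using assms pi_comp by metis
  then show ?thesis using pi_closed assms by (metis H.inv_solve_right H.m_closed)
qed

lemma pi_intertwine_one:
  assumes "D \<in> FG" "S \<in> FG" "T \<in> FG" "D \<circ> S = T \<circ> D" "\<pi> S = \<one>"
  shows "\<pi> T = \<one>"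
  using pi_intertwine[OF assms(1-4)] assms pi_closed by simp

lemma pi_intertwine_eq:
  assumes "D \<in> FG" "S \<in> FG" "T \<in> FG" "D \<circ> S = T \<circ> D" "\<pi> D = \<one>"
  shows "\<pi> T = \<pi> S"
  using pi_intertwine[OF assms(1-4)] assms pi_closed by simp

end

context fg_hom begin

text \<open>An Eilenberg swindle modulo involutions. Shrinking the support again and again writes \<open>T\<close> as an
  involution product times \<open>T\<^sub>n\<close> with support \<open>A\<^sub>n\<close>; conjugates \<open>Y\<^sub>n\<close> of the \<open>T\<^sub>n\<close> have disjoint
  supports, and modulo involutions their infinite product does not change when the index is shifted.\<close>

lemma pi_trivial_if_involutions_trivial:
  assumes invol: "\<And>S. S \<in> FG \<Longrightarrow> S \<circ> S = id \<Longrightarrow> \<pi> S = \<one>" and T: "T \<in> FG"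
  shows "\<pi> T = \<one>"
proof -
  define good where "good n x \<longleftrightarrow> fst x \<in> FG \<and> snd x \<in> sets M \<and> supported (fst x) (snd x) \<and> (n = (0::nat) \<longrightarrow> fst x = T)"
    for n and x :: "('a \<Rightarrow> 'a) \<times> 'a set"
  define step where "step x y \<longleftrightarrow> snd y \<subseteq> snd x \<and> snd y \<inter> fst x ` snd y = {} \<and>
      (\<exists>J. J \<in> FG \<and> J \<circ> J = id \<and> supported J (snd x) \<and> fst y = fst x \<circ> swap (fst x) (snd y) \<circ> J)"
    for x y :: "('a \<Rightarrow> 'a) \<times> 'a set"
  have "\<exists>f. \<forall>n. good n (f n) \<and> step (f n) (f (Suc n))"
  proof (rule dependent_nat_choice[where P=good and Q="\<lambda>_. step"])
    have "supported T (space M)" using FG_off[OF T] by (auto simp: supported_def)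
    then show "\<exists>x. good 0 x" using T unfolding good_def by (intro exI[of _ "(T, space M)"]) auto
    fix x n assume x: "good n x"
    then have xF: "fst x \<in> FG" and xs: "supported (fst x) (snd x)" by (simp_all add: good_def)
    obtain A J where A: "A \<in> sets M" "A \<subseteq> snd x" "A \<inter> fst x ` A = {}" "J \<in> FG" "J \<circ> J = id"
      "supported J (snd x)" "supported (fst x \<circ> swap (fst x) A \<circ> J) A"
      using shrink_support[OF xF xs] by (elim exE conjE)
    have "swap (fst x) A \<in> FG" by (rule FG_swap[OF xF A(1,3)])
    then have "fst x \<circ> swap (fst x) A \<circ> J \<in> FG" by (intro FG_comp xF A(4))
    then have "good (Suc n) (fst x \<circ> swap (fst x) A \<circ> J, A)" unfolding good_def fst_conv snd_conv using A(1,7) by simp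
    moreover have "step x (fst x \<circ> swap (fst x) A \<circ> J, A)" unfolding step_def fst_conv snd_conv using A by blast
    ultimately show "\<exists>y. good (Suc n) y \<and> step x y" by blast
  qed
  then obtain f where f: "\<And>n. good n (f n)" "\<And>n. step (f n) (f (Suc n))" by blast
  define t where "t n = fst (f n)" for n
  define A where "A n = snd (f n)" for n
  have tF: "t n \<in> FG" and As: "A n \<in> sets M" and ts: "supported (t n) (A n)" and t0: "t 0 = T" for n
    using f(1)[of n] f(1)[of 0] by (auto simp: good_def t_def A_def)
  have AS: "A (Suc n) \<subseteq> A n" and Ad: "A (Suc n) \<inter> t n ` A (Suc n) = {}" for n
    using f(2)[of n] by (auto simp: step_def t_def A_def)
  have "\<forall>n. \<exists>J. J \<in> FG \<and> J \<circ> J = id \<and> supported J (A n) \<and> t (Suc n) = t n \<circ> swap (t n) (A (Suc n)) \<circ> J"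
    using f(2) by (auto simp: step_def t_def A_def)
  then obtain J where J: "\<And>n. J n \<in> FG \<and> J n \<circ> J n = id \<and> supported (J n) (A n) \<and> t (Suc n) = t n \<circ> swap (t n) (A (Suc n)) \<circ> J n"
    by metis
  have JF: "J n \<in> FG" and JJ: "J n \<circ> J n = id" and Js: "supported (J n) (A n)" for n using J by auto
  define I where "I n = swap (t n) (A (Suc n))" for n
  have tS: "t (Suc n) = t n \<circ> I n \<circ> J n" for n using J by (simp add: I_def)
  have IF: "I n \<in> FG" for n unfolding I_def by (rule FG_swap[OF tF As Ad])
  have II: "I n \<circ> I n = id" for n unfolding I_def by (rule swap_swap[OF FG_bij[OF tF] Ad])
  note IIa = involution_app[OF II] and JJa = involution_app[OF JJ]
  have Ib: "bij (I n)" for n using FG_bij[OF IF] .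
  have Iinv: "finv (I n) = I n" for n using involution_inv[OF II] .
  \<comment> \<open>The sets \<open>A n\<close> are nested and therefore useless for gluing. Their
    displaced copies \<open>C n\<close> are disjoint, because \<open>C n\<close> lies in
    \<open>A n\<close> and misses \<open>A (Suc n)\<close>.\<close>
  define C where "C n = t n ` A (Suc n)" for n
  have Cs: "C n \<in> sets M" for n unfolding C_def by (rule FG_image[OF tF As])
  have CA: "C n \<subseteq> A n" for n
    unfolding C_def using supported_image[OF FG_bij[OF tF] ts] AS by blast
  have CA': "C n \<inter> A (Suc n) = {}" for n unfolding C_def using Ad by blast
  have Ale: "A n \<subseteq> A m" if "m \<le> n" for m n using that by (rule lift_Suc_antimono_le[rotated]) (rule AS)
  have Cd: "C m \<inter> C n = {}" if "m \<noteq> n" for m n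
  proof -
    have "C m \<inter> C n = {}" if "m < n" for m n
      using CA[of n] CA'[of m] Ale[of "Suc m" n] that by auto
    then show ?thesis using that by (metis inf_commute linorder_neqE_nat)
  qed
  have CdS: "C n \<inter> C (Suc n) = {}" "C 0 \<inter> C (Suc n) = {}" for n by (rule Cd, simp)+
  have Cdj: "disjoint_family C" using Cd by (auto simp: disjoint_family_on_def)
  have Cdj': "disjoint_family (\<lambda>n. C (Suc n))" using Cd by (auto simp: disjoint_family_on_def)
  have IA: "I n ` A (Suc n) = C n" for n
    unfolding C_def by (rule image_cong) (simp_all add: I_def swap_in)
  have conj: "supported (I n \<circ> S \<circ> I n) (C n)" if "supported S (A (Suc n))" for S n
    using supported_conj[OF Ib that, of n] by (simp only: IA Iinv)
  \<comment> \<open>\<open>I n\<close> transports \<open>A (Suc n)\<close> to \<open>C n\<close>.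
    Both \<open>t (Suc n)\<close> and its successor are transported to the same slot; they differ
    there by the involutions \<open>K n\<close> and \<open>L n\<close>.\<close>
  define Y where "Y n = I n \<circ> t (Suc n) \<circ> I n" for n
  define X where "X n = I n \<circ> t (Suc (Suc n)) \<circ> I n" for n
  define K where "K n = I n \<circ> J (Suc n) \<circ> I n" for n
  define L where "L n = I n \<circ> I (Suc n) \<circ> I n" for n
  have ts': "supported (t (Suc (Suc n))) (A (Suc n))" for n by (rule supported_mono[OF ts AS])
  have Isup: "supported (I n) (A n)" for n unfolding I_def 
    by (rule supported_mono[OF swap_supported]) (use CA AS in \<open>auto simp: C_def\<close>)
  have sY: "supported (Y n) (C n)" and sX: "supported (X n) (C n)" and sK: "supported (K n) (C n)"
    and sL: "supported (L n) (C n)" for n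
    unfolding Y_def X_def K_def L_def by (rule conj[OF ts] conj[OF ts'] conj[OF Js] conj[OF Isup])+
  have YF: "Y n \<in> FG" and XF: "X n \<in> FG" and KF: "K n \<in> FG" and LF: "L n \<in> FG" for n
    unfolding Y_def X_def K_def L_def by (intro FG_comp IF tF JF)+
  have KK: "K n \<circ> K n = id" and LL: "L n \<circ> L n = id" for n
    unfolding K_def L_def by (rule involution_comp3[OF II JJ] involution_comp3[OF II II])+
  have YX: "Y n = X n \<circ> K n \<circ> L n" for n
    unfolding Y_def X_def K_def L_def fun_eq_iff comp_apply tS[of "Suc n"] by (simp only: IIa JJa comp_apply) simp
  note g = FG_glue[OF _ _ Cs Cdj]
  have U: "glue C Y = glue C X \<circ> glue C K \<circ> glue C L"
  proof -
    have "glue C X \<circ> glue C K = glue C (\<lambda>n. X n \<circ> K n)"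
      by (rule glue_comp[OF Cdj FG_bij[OF KF] sK])
    then have "glue C X \<circ> glue C K \<circ> glue C L = glue C (\<lambda>n. X n \<circ> K n \<circ> L n)"
      using glue_comp[OF Cdj FG_bij[OF LF] sL] by simp
    then show ?thesis using YX by (metis (no_types, lifting) ext)
  qed
  have gg: "glue C V \<circ> glue C V = id" if "\<And>n. V n \<circ> V n = id" "\<And>n. supported (V n) (C n)" for V
    using glue_comp[OF Cdj _ that(2), of V] involution_bij[OF that(1)] by (simp add: that(1) glue_id)
  have "\<pi> (glue C K) = \<one>" "\<pi> (glue C L) = \<one>"
    by (intro invol g KF sK LF sL gg KK LL)+
  then have UX: "\<pi> (glue C Y) = \<pi> (glue C X)"
    unfolding U using pi_comp[OF FG_comp[OF g[OF XF sX] g[OF KF sK]] g[OF LF sL]]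
      pi_comp[OF g[OF XF sX] g[OF KF sK]] pi_closed[OF g[OF XF sX]] by simp
  \<comment> \<open>\<open>X n\<close> sits on the copy of \<open>A (Suc (Suc n))\<close> in slot
    \<open>n\<close>, while \<open>Y (Suc n)\<close> is the same map in slot \<open>Suc n\<close>;
    \<open>D n\<close> exchanges the two copies and conjugates one into the other.\<close>
  define E where "E n = I n ` A (Suc (Suc n))" for n
  have EC: "E n \<subseteq> C n" for n unfolding E_def using IA AS by blast
  have Es: "E n \<in> sets M" for n unfolding E_def by (rule FG_image[OF IF As])
  have sXE: "supported (X n) (E n)" for n unfolding X_def E_def
    using supported_conj[OF Ib ts, of n "Suc (Suc n)"] Iinv by simp
  let ?h = "\<lambda>n. I (Suc n) \<circ> I n"
  have hE: "?h n ` E n = C (Suc n)" for n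
    unfolding E_def IA[symmetric] image_comp[symmetric] by (simp add: image_image IIa)
  define D where "D n = swap (?h n) (E n)" for n
  have hF: "?h n \<in> FG" for n by (rule FG_comp[OF IF IF])
  have Ed: "E n \<inter> ?h n ` E n = {}" for n unfolding hE using EC CdS(1)[of n] by blast
  have DF: "D n \<in> FG" and DD: "D n \<circ> D n = id" for n
    unfolding D_def by (rule FG_swap[OF hF Es Ed] swap_swap[OF FG_bij[OF hF] Ed])+
  have Dsup: "supported (D n) (C n \<union> C (Suc n))" for n
    unfolding D_def by (rule supported_mono[OF swap_supported]) (use EC hE in blast)
  have DX: "D n \<circ> X n = Y (Suc n) \<circ> D n" for n
  proof
    fix x
    consider "x \<in> E n" | e where "e \<in> E n" "x = ?h n e" | "x \<notin> E n" "x \<notin> C (Suc n)" using hE[of n] by blast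
    then show "(D n \<circ> X n) x = (Y (Suc n) \<circ> D n) x"
    proof cases
      case 1
      then have "X n x \<in> E n" using supported_mem[OF FG_bij[OF XF] sXE] by blast
      then show ?thesis using 1 by (simp add: D_def swap_in X_def Y_def IIa)
    next
      case 2
      then have xC: "x \<in> C (Suc n)" using hE by blast
      then have "x \<notin> C n" "e \<notin> C (Suc n)" using CdS(1)[of n] 2 EC by blast+
      moreover have "D n x = e" unfolding D_def 2(2) by (rule swap_in'[OF FG_bij[OF hF] Ed 2(1)])
      ultimately show ?thesis using supportedD[OF sX] supportedD[OF sY] by simp
    next
      case 3
      then have "x \<notin> ?h n ` E n" unfolding hE by simp
      then have "D n x = x" unfolding D_def by (rule swap_out[OF 3(1)])
      then show ?thesis using 3 supportedD[OF sXE] supportedD[OF sY] by simp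
    qed
  qed
  \<comment> \<open>Neighbouring \<open>D n\<close> have overlapping supports and cannot be glued at
    once. For indices of one parity the supports are disjoint, so the shift of the product is done
    separately for even and odd indices.\<close>
  define R where "R b n = (if even n = b then C n \<union> C (Suc n) else {})" for b n
  have Rs: "R b n \<in> sets M" for b n using Cs by (simp add: R_def)
  have Rd: "disjoint_family (R b)" for b
    unfolding disjoint_family_on_def
  proof (intro ballI impI)
    fix m n :: nat assume "m \<noteq> n"
    show "R b m \<inter> R b n = {}"
    proof (cases "even m = b \<and> even n = b")
      case True
      then have "m \<noteq> Suc n" "n \<noteq> Suc m" by auto
      then show ?thesis using True \<open>m \<noteq> n\<close> Cd[of m n] Cd[of m "Suc n"] Cd[of "Suc m" n] Cd[of "Suc m" "Suc n"]
        by (auto simp: R_def)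
    qed (auto simp: R_def)
  qed
  define par where "par b V n = (if even n = b then V n else id)" for b and V :: "nat \<Rightarrow> 'a \<Rightarrow> 'a" and n
  have parF: "par b V n \<in> FG" if "\<And>n. V n \<in> FG" for b V n using that FG_id by (simp only: par_def split: if_split) simp
  have par_sup: "supported (par b V n) (if even n = b then P n else {})" if "\<And>n. supported (V n) (P n)" for b V P n
    using that by (simp add: par_def supported_def)
  have par_glue: "glue P (par b V) = glue (R b) (par b V)"
    if "\<And>n. supported (V n) (P n)" "disjoint_family P" "\<And>n. P n \<subseteq> C n \<union> C (Suc n)" for b V P
  proof -
    let ?P = "\<lambda>n. if even n = b then P n else {}"
    have d: "disjoint_family ?P" using that(2) by (simp add: disjoint_family_on_def)
    have "glue ?P (par b V) = glue P (par b V)"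
    proof (rule glue_mono[OF d that(2)])
      show "supported (par b V n) (?P n)" for n by (rule par_sup[OF that(1)])
    qed auto
    moreover have "glue ?P (par b V) = glue (R b) (par b V)"
    proof (rule glue_mono[OF d Rd])
      show "supported (par b V n) (?P n)" for n by (rule par_sup[OF that(1)])
    qed (use that(3) in \<open>auto simp: R_def\<close>)
    ultimately show ?thesis by simp
  qed
  have par_merge: "glue P (par True V) \<circ> glue P (par False V) = glue P V"
    if "\<And>n. V n \<in> FG" "\<And>n. supported (V n) (P n)" "disjoint_family P" for V P
  proof -
    have "supported (par False V n) (P n)" for n
      by (rule supported_mono[OF par_sup[of _ P, OF that(2)]]) auto
    then have "glue P (par True V) \<circ> glue P (par False V) = glue P (\<lambda>n. par True V n \<circ> par False V n)"
      by (rule glue_comp[OF that(3) FG_bij[OF parF[OF that(1)]]])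
    moreover have "(\<lambda>n. par True V n \<circ> par False V n) = V" by (rule ext) (simp add: par_def)
    ultimately show ?thesis by simp
  qed
  let ?Y = "\<lambda>n. Y (Suc n)" and ?C = "\<lambda>n. C (Suc n)"
  have parR: "supported (par b V n) (R b n)" if "\<And>n. supported (V n) (C n \<union> C (Suc n))" for b V n
    using par_sup[of V "\<lambda>n. C n \<union> C (Suc n)" b n, OF that] by (simp add: R_def)
  have sX2: "supported (X n) (C n \<union> C (Suc n))" and sY2: "supported (?Y n) (C n \<union> C (Suc n))" for n
    by (rule supported_mono[OF sX] supported_mono[OF sY], blast)+
  note gR = FG_glue[OF _ _ Rs Rd]
  have XY: "\<pi> (glue ?C (par b ?Y)) = \<pi> (glue C (par b X))" for b
  proof -
    let ?D = "glue (R b) (par b D)"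
    have D1: "?D \<in> FG" by (intro gR parF parR DF Dsup)
    have pD: "par b D n \<circ> par b D n = id" for n by (simp add: par_def DD)
    have "?D \<circ> ?D = id"
      using glue_comp[OF Rd FG_bij[OF parF[OF DF]] parR[OF Dsup], of b "par b D"] by (simp add: pD glue_id)
    then have D2: "\<pi> ?D = \<one>" using invol D1 by blast
    have "?D \<circ> glue (R b) (par b X) = glue (R b) (\<lambda>n. par b D n \<circ> par b X n)"
      by (rule glue_comp[OF Rd FG_bij[OF parF[OF XF]] parR[OF sX2]])
    also have "(\<lambda>n. par b D n \<circ> par b X n) = (\<lambda>n. par b ?Y n \<circ> par b D n)"
      by (rule ext) (simp add: par_def DX)
    also have "glue (R b) \<dots> = glue (R b) (par b ?Y) \<circ> ?D"
      by (rule glue_comp[OF Rd FG_bij[OF parF[OF DF]] parR[OF Dsup], symmetric])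
    finally have "\<pi> (glue (R b) (par b ?Y)) = \<pi> (glue (R b) (par b X))"
      by (intro pi_intertwine_eq[OF D1 _ _ _ D2] gR parF parR XF YF sX2 sY2)
    moreover have "glue C (par b X) = glue (R b) (par b X)" by (rule par_glue[OF sX Cdj]) blast
    moreover have "glue ?C (par b ?Y) = glue (R b) (par b ?Y)" by (rule par_glue[OF sY Cdj']) blast
    ultimately show ?thesis by simp
  qed
  have parC: "supported (par b V n) (P n)" if "\<And>n. supported (V n) (P n)" for b V P n
    by (rule supported_mono[OF par_sup[of _ P, OF that]]) auto
  have GX: "glue C (par b X) \<in> FG" for b by (intro g parF parC XF sX)
  have GY: "glue ?C (par b ?Y) \<in> FG" for b by (intro FG_glue parF parC YF sY Cs Cdj')
  have GY': "glue ?C ?Y \<in> FG" by (intro FG_glue YF sY Cs Cdj')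
  have "\<pi> (glue ?C ?Y) = \<pi> (glue ?C (par True ?Y)) \<otimes> \<pi> (glue ?C (par False ?Y))"
    using par_merge[OF YF sY Cdj'] pi_comp[OF GY GY] by metis
  also have "\<dots> = \<pi> (glue C (par True X)) \<otimes> \<pi> (glue C (par False X))" by (simp only: XY)
  also have "\<dots> = \<pi> (glue C X)" using par_merge[OF XF sX Cdj] pi_comp[OF GX GX] by metis
  also have "\<dots> = \<pi> (glue C Y)" using UX by simp
  \<comment> \<open>The swindle closes here: the product equals its own shift in the target, so the
    one factor lost by shifting must be trivial.\<close>
  also have "glue C Y = Y 0 \<circ> glue ?C ?Y"
  proof
    fix x
    consider "x \<in> C 0" | n where "x \<in> C (Suc n)" | "\<And>n. x \<notin> C n" by (metis not0_implies_Suc)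
    then show "glue C Y x = (Y 0 \<circ> glue ?C ?Y) x"
    proof cases
      case 1
      then have "x \<notin> ?C n" for n using CdS(2)[of n] by blast
      then have "glue ?C ?Y x = x" by (intro glue_out)
      then show ?thesis using 1 by (simp add: glue_in[OF Cdj])
    next
      case 2
      then have "Y (Suc n) x \<in> C (Suc n)" using supported_mem[OF FG_bij[OF YF] sY] by blast
      then have "Y (Suc n) x \<notin> C 0" using CdS(2)[of n] by blast
      then have "Y 0 (Y (Suc n) x) = Y (Suc n) x" using supportedD[OF sY] by blast
      moreover have "glue ?C ?Y x = Y (Suc n) x" using 2 by (intro glue_in[OF Cdj'])
      ultimately show ?thesis using 2 by (simp add: glue_in[OF Cdj])
    next
      case 3
      then show ?thesis using supportedD[OF sY] by (simp add: glue_out)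
    qed
  qed
  also have "\<pi> \<dots> = \<pi> (Y 0) \<otimes> \<pi> (glue ?C ?Y)" by (rule pi_comp[OF YF GY'])
  finally have "\<pi> (Y 0) = \<one>" using pi_closed[OF YF] pi_closed[OF GY'] by (metis H.r_cancel_one)
  moreover have "I 0 \<circ> Y 0 = t (Suc 0) \<circ> I 0"
    unfolding Y_def fun_eq_iff comp_apply by (simp only: IIa) simp
  ultimately have "\<pi> (t (Suc 0)) = \<one>" using pi_intertwine_one[OF IF YF tF] by blast
  moreover have "\<pi> (t (Suc 0)) = \<pi> (t 0) \<otimes> \<pi> (I 0) \<otimes> \<pi> (J 0)"
    unfolding tS using pi_comp[OF FG_comp[OF tF IF] JF] pi_comp[OF tF IF] by simp
  ultimately show ?thesis
    using invol[OF IF II] invol[OF JF JJ] pi_closed[OF T] t0 by simp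
qed

end

section \<open>Homomorphisms and small involutions\<close>

locale dyadic_action = pmp_action M act sep for M :: "'a measure" and act sep +
  fixes \<Omega> :: "'a set" and S :: "'a \<Rightarrow> nat set" and u :: "nat set \<Rightarrow> 'a \<Rightarrow> 'a"
  assumes dyadic: "dyadic \<Omega> S u"
begin

lemma Om_sets: "\<Omega> \<in> sets M"
  and Om_null: "space M - \<Omega> \<in> null_sets M"
  and Om_rel: "rel x y \<Longrightarrow> x \<in> \<Omega> \<Longrightarrow> y \<in> \<Omega>"
  and bit_sets: "{x \<in> \<Omega>. i \<in> S x} \<in> sets M"
  and u_FG: "finite F \<Longrightarrow> u F \<in> FG"
  and S_u: "finite F \<Longrightarrow> x \<in> \<Omega> \<Longrightarrow> S (u F x) = sym_diff (S x) F"
  and u_u: "finite F \<Longrightarrow> finite G \<Longrightarrow> u F (u G x) = u (sym_diff F G) x"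
  and u_empty: "u {} = id"
proof -
  note d = dyadic[unfolded dyadic_def]
  show "\<Omega> \<in> sets M" "space M - \<Omega> \<in> null_sets M" using d by auto
  show "rel x y \<Longrightarrow> x \<in> \<Omega> \<Longrightarrow> y \<in> \<Omega>" using d by auto
  show "{x \<in> \<Omega>. i \<in> S x} \<in> sets M" using d by auto
  show "finite F \<Longrightarrow> u F \<in> FG"
    "finite F \<Longrightarrow> x \<in> \<Omega> \<Longrightarrow> S (u F x) = sym_diff (S x) F" using d by auto
  show "finite F \<Longrightarrow> finite G \<Longrightarrow> u F (u G x) = u (sym_diff F G) x" using d by auto
  show "u {} = id" using d by auto
qed

lemma u_u_same: "finite F \<Longrightarrow> u F (u F x) = x"
  using u_u[of F F x] by (simp add: u_empty)

lemma u_invol: "finite F \<Longrightarrow> u F \<circ> u F = id"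
  by (auto simp: fun_eq_iff u_u_same)

lemma u_commute: "finite F \<Longrightarrow> finite G \<Longrightarrow> u F (u G x) = u G (u F x)"
  using u_u[of F G x] u_u[of G F x] by (simp add: Un_commute)

lemma FG_Om: "T \<in> FG \<Longrightarrow> T x \<in> \<Omega> \<longleftrightarrow> x \<in> \<Omega>"
  using Om_rel FG_rel rel_sym by blast

lemma u_Om: "finite F \<Longrightarrow> u F x \<in> \<Omega> \<longleftrightarrow> x \<in> \<Omega>"
  using FG_Om u_FG by blast

lemma S_sets: "{x \<in> \<Omega>. Q (S x \<inter> {..<N})} \<in> sets M"
proof -
  have 1: "{x \<in> \<Omega>. S x \<inter> {..<N} = \<tau>} \<in> sets M" if "\<tau> \<subseteq> {..<N}" for \<tau>
  proof -
    have "{x \<in> \<Omega>. S x \<inter> {..<N} = \<tau>} = \<Omega> - (\<Union>i\<in>{..<N}. if i \<in> \<tau> then \<Omega> - {x \<in> \<Omega>. i \<in> S x} else {x \<in> \<Omega>. i \<in> S x})"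
      using that by (fastforce split: if_splits)
    moreover have "(if i \<in> \<tau> then \<Omega> - {x \<in> \<Omega>. i \<in> S x} else {x \<in> \<Omega>. i \<in> S x}) \<in> sets M" for i
      using Om_sets bit_sets by (simp add: sets.Diff)
    ultimately show ?thesis using Om_sets by (simp only: sets.Diff sets.finite_UN finite_lessThan)
  qed
  have "{x \<in> \<Omega>. Q (S x \<inter> {..<N})} = (\<Union>\<tau>\<in>{\<tau> \<in> Pow {..<N}. Q \<tau>}. {x \<in> \<Omega>. S x \<inter> {..<N} = \<tau>})"
    by auto
  moreover have "(\<Union>\<tau>\<in>{\<tau> \<in> Pow {..<N}. Q \<tau>}. {x \<in> \<Omega>. S x \<inter> {..<N} = \<tau>}) \<in> sets M"
    by (rule sets.finite_UN) (use 1 in auto)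
  ultimately show ?thesis by simp
qed

lemma S_sets': "(\<And>x. x \<in> A \<longleftrightarrow> x \<in> \<Omega> \<and> Q (S x \<inter> {..<N})) \<Longrightarrow> A \<in> sets M"
proof -
  assume "\<And>x. x \<in> A \<longleftrightarrow> x \<in> \<Omega> \<and> Q (S x \<inter> {..<N})"
  then have "A = {x \<in> \<Omega>. Q (S x \<inter> {..<N})}" by blast
  then show ?thesis using S_sets by simp
qed

abbreviation "\<theta> \<equiv> u {0}"
abbreviation "\<kappa> \<equiv> u {1}"

definition X0 :: "'a set" where "X0 = {x \<in> \<Omega>. 0 \<notin> S x}"

text \<open>Digit 0 must vanish for \<open>flip\<close>, digit 1 for the doubling by
  \<open>\<kappa>\<close>, and digit 2 keeps these sets away from the destinations used later, all
  of which have digit 2 equal to 1.\<close>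

definition X3 :: "'a set" where "X3 = {x \<in> \<Omega>. 0 \<notin> S x \<and> 1 \<notin> S x \<and> 2 \<notin> S x}"

text \<open>On subsets of \<open>X0\<close> this turns symmetric difference into composition, so it
  embeds the Boolean group of measurable sets into the full group.\<close>

definition flip :: "'a set \<Rightarrow> 'a \<Rightarrow> 'a" where "flip E = rst \<theta> (E \<union> \<theta> ` E)"

lemma theta_image: "x \<in> \<theta> ` E \<longleftrightarrow> \<theta> x \<in> E"
  using u_u_same[of "{0}"] by (auto simp: image_iff) (metis finite.emptyI finite_insert)

lemma flip_app: "flip E x = (if x \<in> E \<or> \<theta> x \<in> E then \<theta> x else x)"
  by (auto simp: flip_def rst_def theta_image)

lemma theta_X0: "x \<in> X0 \<Longrightarrow> \<theta> x \<notin> X0"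
  by (auto simp: X0_def S_u)

lemma flip_comp:
  assumes "E \<subseteq> X0" "E' \<subseteq> X0"
  shows "flip E \<circ> flip E' = flip (sym_diff E E')"
proof
  fix x
  have "x \<in> E \<union> E' \<Longrightarrow> \<theta> x \<notin> E \<union> E'" using assms theta_X0 by blast
  then show "(flip E \<circ> flip E') x = flip (sym_diff E E') x"
    by (auto simp: flip_app u_u_same)
qed

lemma flip_empty: "flip {} = id"
  by (auto simp: flip_app)

lemma flip_invol: "E \<subseteq> X0 \<Longrightarrow> flip E \<circ> flip E = id"
  using flip_comp[of E E] by (simp add: flip_empty)

lemma flip_FG: "E \<in> sets M \<Longrightarrow> flip E \<in> FG"
proof -
  assume E: "E \<in> sets M"
  have "\<theta> ` (E \<union> \<theta> ` E) = E \<union> \<theta> ` E" by (auto simp: theta_image u_u_same image_Un image_image)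
  then show ?thesis unfolding flip_def
    using E u_FG[of "{0}"] FG_image[OF u_FG, of "{0}" E] by (intro FG_rst) auto
qed

lemma flip_conj:
  assumes "\<And>x. t (\<theta> x) = \<theta> (t x)" "bij t"
  shows "t \<circ> flip E = flip (t ` E) \<circ> t"
proof
  fix x
  have "t x \<in> t ` E \<longleftrightarrow> x \<in> E" "\<theta> (t x) \<in> t ` E \<longleftrightarrow> \<theta> x \<in> E"
    using assms by (metis bij_is_inj inj_image_mem_iff)+
  then show "(t \<circ> flip E) x = (flip (t ` E) \<circ> t) x" using assms(1) by (auto simp: flip_app)
qed

text \<open>\<open>flip E\<close> is the identity off the \<open>\<theta>\<close>-invariant set
  \<open>A\<close>, so conjugation sees only the values of \<open>w\<close> on \<open>A\<close>.
  This is what lets an element of small image stand in for \<open>t\<close>.\<close>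

lemma flip_conj_local:
  assumes tc: "\<And>x. t (\<theta> x) = \<theta> (t x)" and t: "bij t" and w: "bij w" and ts: "supported t A"
    and wt: "\<And>x. x \<in> A \<Longrightarrow> w x = t x" and A: "\<And>x. x \<in> A \<Longrightarrow> \<theta> x \<in> A" and E: "E \<subseteq> A"
  shows "w \<circ> flip E = flip (t ` E) \<circ> w"
proof
  fix x
  show "(w \<circ> flip E) x = (flip (t ` E) \<circ> w) x"
  proof (cases "x \<in> A")
    case True
    then have "flip E x \<in> A" using A by (simp add: flip_app)
    then show ?thesis using wt True flip_conj[OF tc t, of E] by (metis comp_apply)
  next
    case False
    have tA: "t ` A = A" by (rule supported_image[OF t ts])
    then have wA: "w ` A = A" using wt by (simp cong: image_cong)
    then have wx: "w x \<notin> A" using False w by (metis bij_is_inj inj_image_mem_iff)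
    have tE: "t ` E \<subseteq> A" using tA E by blast
    have n: "y \<notin> A \<Longrightarrow> flip E' y = y" if "E' \<subseteq> A" for E' y
      using that A[of "\<theta> y"] u_u_same[of "{0}" y] by (auto simp: flip_app)
    show ?thesis using n[OF E False] n[OF tE wx] by simp
  qed
qed

lemma swap_commute:
  assumes h: "bij h" "\<And>x. h (\<theta> x) = \<theta> (h x)" and P: "\<And>x. x \<in> P \<Longrightarrow> \<theta> x \<in> P"
  shows "swap h P (\<theta> x) = \<theta> (swap h P x)"
proof -
  have 1: "\<theta> x \<in> P \<longleftrightarrow> x \<in> P" for x using P u_u_same[of "{0}" x] by (metis finite.emptyI finite_insert)
  have hi: "finv h (\<theta> x) = \<theta> (finv h x)" for x using h by (metis bij_inv_eq_iff)
  have hP: "x \<in> h ` P \<longleftrightarrow> finv h x \<in> P" for x using h(1) by (metis bij_inv_eq_iff image_iff)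
  show ?thesis by (simp add: swap_def 1 hi hP h(2))
qed

text \<open>Changing the digits in \<open>J\<close> in all possible ways gives
  \<open>2 ^ card J\<close> disjoint copies of \<open>A\<close> with equal measure in a probability
  space.\<close>

lemma cylinder_small:
  assumes "A \<in> sets M" "A \<subseteq> \<Omega>" "\<And>x. x \<in> A \<Longrightarrow> S x \<inter> J = \<sigma>" "finite J"
  shows "measure M A \<le> (1/2) ^ card J"
proof -
  have d: "disjoint_family_on (\<lambda>F. u F ` A) (Pow J)"
    unfolding disjoint_family_on_def
  proof (intro ballI impI)
    fix F G assume F: "F \<in> Pow J" "G \<in> Pow J" "F \<noteq> G"
    show "u F ` A \<inter> u G ` A = {}"
    proof (rule ccontr)
      assume "u F ` A \<inter> u G ` A \<noteq> {}"
      then obtain x y where xy: "x \<in> A" "y \<in> A" "u F x = u G y" by blast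
      have f: "finite F" "finite G" using F assms(4) finite_subset by auto
      have "sym_diff (S x) F = sym_diff (S y) G" using S_u f xy assms(2) by (metis subsetD)
      moreover have "S x \<inter> J = S y \<inter> J" using xy assms(3) by simp
      ultimately show False using F by blast
    qed
  qed
  have fin: "finite F" if "F \<in> Pow J" for F using that assms(4) finite_subset by auto
  have "(\<Sum>F\<in>Pow J. measure M (u F ` A)) = measure M (\<Union>F\<in>Pow J. u F ` A)"
    using assms d FG_image[OF u_FG[OF fin]] by (intro finite_measure_finite_Union[symmetric]) auto
  also have "\<dots> \<le> 1" by simp
  also have "(\<Sum>F\<in>Pow J. measure M (u F ` A)) = (\<Sum>F\<in>Pow J. measure M A)"
    using FG_image_emeasure[OF u_FG[OF fin] assms(1)] by (intro sum.cong) (auto simp: measure_def)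
  finally show ?thesis using assms(4) by (simp add: card_Pow power_divide field_simps)
qed

end

section \<open>Targets covered by countably many translates\<close>

context fg_hom begin

text \<open>This is what separability gives for an open symmetric neighbourhood of the identity;
  stated without topology, it suffices for the diagonal and counting arguments.\<close>

definition covering :: "'h set \<Rightarrow> bool" where
  "covering V \<longleftrightarrow> V \<subseteq> carrier H \<and> (\<forall>v\<in>V. inv v \<in> V) \<and>
    (\<exists>d::nat \<Rightarrow> 'h. range d \<subseteq> carrier H \<and> (\<forall>h\<in>carrier H. \<exists>n. \<exists>v\<in>V. h = d n \<otimes> v))"

lemma coveringD:
  assumes "covering V"
  shows "V \<subseteq> carrier H" "\<forall>v\<in>V. inv v \<in> V"
  using assms by (simp_all add: covering_def)

lemma covering_ex:
  assumes "covering V"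
  shows "\<exists>d. \<forall>n::nat. d n \<in> carrier H \<and> (\<forall>h\<in>carrier H. \<exists>n. \<exists>v\<in>V. h = d n \<otimes> v)"
  using assms unfolding covering_def image_subset_iff by blast

text \<open>The common translating factor \<open>d\<close> cancels, and symmetry of \<open>V\<close>
  absorbs the inverse.\<close>

lemma covering_quotient:
  assumes "V \<subseteq> carrier H" "\<forall>v\<in>V. inv v \<in> V" "S \<in> FG" "T \<in> FG" "d \<in> carrier H" "v \<in> V" "w \<in> V"
    "\<pi> S = d \<otimes> v" "\<pi> T = d \<otimes> w"
  shows "\<exists>a\<in>V. \<exists>b\<in>V. \<pi> (finv S \<circ> T) = a \<otimes> b"
proof -
  have c: "v \<in> carrier H" "w \<in> carrier H" using assms by auto
  have "\<pi> (finv S \<circ> T) = inv (d \<otimes> v) \<otimes> (d \<otimes> w)"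
    using assms pi_comp[OF FG_inv] pi_inv by simp
  also have "\<dots> = inv v \<otimes> (inv d \<otimes> (d \<otimes> w))" using c assms(5) by (simp add: H.inv_mult_group H.m_assoc)
  also have "inv d \<otimes> (d \<otimes> w) = w" using c assms(5) by (simp add: H.m_assoc[symmetric])
  finally show ?thesis using assms by blast
qed

text \<open>Otherwise each piece \<open>A k\<close> carries some \<open>t k\<close> not matched
  there by any element with image in the \<open>k\<close>-th translate. The \<open>t k\<close> glue
  to one element, whose image lies in some translate, and this contradicts the choice for that
  index.\<close>

lemma covering_full_piece:
  assumes V: "covering V" and A: "\<And>k. A k \<in> sets M" "disjoint_family A"
  shows "\<exists>k::nat. \<forall>t\<in>FG. supported t (A k) \<longrightarrow> (\<exists>w\<in>FG. (\<exists>a\<in>V. \<exists>b\<in>V. \<pi> w = a \<otimes> b) \<and> (\<forall>x\<in>A k. w x = t x))"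
proof (rule ccontr)
  assume neg: "\<not> ?thesis"
  note V' = coveringD[OF V]
  obtain d where d: "\<And>n::nat. d n \<in> carrier H" "\<And>h. h \<in> carrier H \<Longrightarrow> \<exists>n. \<exists>v\<in>V. h = d n \<otimes> v"
    using covering_ex[OF V] by metis
  have "\<exists>t. t \<in> FG \<and> supported t (A k) \<and> (\<forall>w\<in>FG. (\<exists>v\<in>V. \<pi> w = d k \<otimes> v) \<longrightarrow> (\<exists>x\<in>A k. w x \<noteq> t x))" for k
  proof (rule ccontr)
    assume n: "\<nexists>t. t \<in> FG \<and> supported t (A k) \<and> (\<forall>w\<in>FG. (\<exists>v\<in>V. \<pi> w = d k \<otimes> v) \<longrightarrow> (\<exists>x\<in>A k. w x \<noteq> t x))"
    then have ex: "\<exists>w\<in>FG. (\<exists>v\<in>V. \<pi> w = d k \<otimes> v) \<and> (\<forall>x\<in>A k. w x = t x)" if "t \<in> FG" "supported t (A k)" for t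
      using that by blast
    \<comment> \<open>A translate that realises everything on \<open>A k\<close> also realises the
      identity there; dividing by that element replaces the translate by the product of
      \<open>V\<close> with itself and keeps the values on \<open>A k\<close>.\<close>
    have "supported id (A k)" by (simp add: supported_def)
    then obtain w0 v0 where w0: "w0 \<in> FG" "v0 \<in> V" "\<pi> w0 = d k \<otimes> v0" "\<And>x. x \<in> A k \<Longrightarrow> w0 x = x"
      using ex[OF FG_id] by auto
    have "\<exists>w\<in>FG. (\<exists>a\<in>V. \<exists>b\<in>V. \<pi> w = a \<otimes> b) \<and> (\<forall>x\<in>A k. w x = t x)" if t: "t \<in> FG" "supported t (A k)" for t
    proof -
      obtain w v where w: "w \<in> FG" "v \<in> V" "\<pi> w = d k \<otimes> v" "\<And>x. x \<in> A k \<Longrightarrow> w x = t x"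
        using ex[OF t] by blast
      have "\<exists>a\<in>V. \<exists>b\<in>V. \<pi> (finv w0 \<circ> w) = a \<otimes> b"
        using covering_quotient[OF V' w0(1) w(1) d(1) w0(2) w(2) w0(3) w(3)] .
      moreover have "(finv w0 \<circ> w) x = t x" if "x \<in> A k" for x
      proof -
        have "t x \<in> A k" using supported_mem[OF FG_bij[OF t(1)] t(2)] that by blast
        then show ?thesis using w0(4)[of "t x"] w(4)[OF that] FG_bij[OF w0(1)] by (metis comp_apply bij_inv_eq_iff)
      qed
      ultimately show ?thesis using FG_comp[OF FG_inv[OF w0(1)] w(1)] by blast
    qed
    then show False using neg by blast
  qed
  then obtain t where t: "\<And>k. t k \<in> FG" "\<And>k. supported (t k) (A k)"
    "\<And>k w. w \<in> FG \<Longrightarrow> (\<exists>v\<in>V. \<pi> w = d k \<otimes> v) \<Longrightarrow> (\<exists>x\<in>A k. w x \<noteq> t k x)" by metis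
  have g: "glue A t \<in> FG" by (rule FG_glue[OF t(1,2) A])
  then obtain k v where "v \<in> V" "\<pi> (glue A t) = d k \<otimes> v" using d(2) pi_closed by blast
  then obtain x where "x \<in> A k" "glue A t x \<noteq> t k x" using t(3)[OF g] by blast
  then show False using glue_in[OF A(2)] by metis
qed

text \<open>There are uncountably many indices and countably many translates, so two of the images
  share a translate.\<close>

lemma covering_pigeonhole:
  assumes V: "covering V" and h: "\<And>\<alpha>::nat set. h \<alpha> \<in> FG"
  shows "\<exists>\<alpha> \<beta>. \<alpha> \<noteq> \<beta> \<and> (\<exists>a\<in>V. \<exists>b\<in>V. \<pi> (finv (h \<alpha>) \<circ> h \<beta>) = a \<otimes> b)"
proof -
  note V' = coveringD[OF V]
  obtain d where d: "\<And>n::nat. d n \<in> carrier H" "\<And>h. h \<in> carrier H \<Longrightarrow> \<exists>n. \<exists>v\<in>V. h = d n \<otimes> v"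
    using covering_ex[OF V] by metis
  have "\<forall>\<alpha>. \<exists>n. \<exists>v\<in>V. \<pi> (h \<alpha>) = d n \<otimes> v" by (intro allI d(2) pi_closed h)
  then obtain j where j: "\<And>\<alpha>. \<exists>v\<in>V. \<pi> (h \<alpha>) = d (j \<alpha>) \<otimes> v" by metis
  have "\<not> inj j"
  proof
    assume "inj j"
    then have "surj (finv j)" by (rule inj_imp_surj_inv)
    then show False using Cantors_theorem[of "UNIV :: nat set"] by auto
  qed
  then obtain \<alpha> \<beta> where ab: "\<alpha> \<noteq> \<beta>" "j \<alpha> = j \<beta>" by (auto simp: inj_def)
  obtain v where v: "v \<in> V" "\<pi> (h \<alpha>) = d (j \<alpha>) \<otimes> v" using j[of \<alpha>] by blast
  obtain w where w: "w \<in> V" "\<pi> (h \<beta>) = d (j \<alpha>) \<otimes> w" using j[of \<beta>] unfolding ab(2) by blast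
  have "\<exists>a\<in>V. \<exists>b\<in>V. \<pi> (finv (h \<alpha>) \<circ> h \<beta>) = a \<otimes> b"
    by (rule covering_quotient[OF V' h h d(1) v(1) w(1) v(2) w(2)])
  then show ?thesis using ab by blast
qed

end

locale dyadic_hom = fg_hom M act sep H \<pi> + dyadic_action M act sep \<Omega> S u
  for M :: "'a measure" and act sep and H :: "('h, 'k) monoid_scheme" (structure) and \<pi> \<Omega> S u
begin

text \<open>Repeated square roots of a neighbourhood, indexed upwards so that smallness is lost by
  raising the index.\<close>

definition chain :: "(nat \<Rightarrow> 'h set) \<Rightarrow> bool" where
  "chain V \<longleftrightarrow> (\<forall>i. V i \<subseteq> carrier H \<and> \<one> \<in> V i \<and> (\<forall>v\<in>V i. inv v \<in> V i) \<and> (\<forall>a\<in>V i. \<forall>b\<in>V i. a \<otimes> b \<in> V (Suc i)))"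

lemma chain_mult: "chain V \<Longrightarrow> a \<in> V i \<Longrightarrow> b \<in> V i \<Longrightarrow> a \<otimes> b \<in> V (Suc i)"
  and chain_inv: "chain V \<Longrightarrow> a \<in> V i \<Longrightarrow> inv a \<in> V i"
  and chain_carrier: "chain V \<Longrightarrow> a \<in> V i \<Longrightarrow> a \<in> carrier H"
  and chain_one: "chain V \<Longrightarrow> \<one> \<in> V i"
  by (auto simp: chain_def)

lemma chain_mono: "chain V \<Longrightarrow> i \<le> j \<Longrightarrow> a \<in> V i \<Longrightarrow> a \<in> V j"
proof (induction j)
  case (Suc j)
  have "a \<in> V j \<Longrightarrow> a \<in> V (Suc j)"
    using chain_mult[OF Suc.prems(1), of a j \<one>] chain_one[OF Suc.prems(1)] chain_carrier[OF Suc.prems(1)] by simp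
  then show ?case using Suc by (auto simp: le_Suc_eq)
qed simp

lemma chain_conj: "chain V \<Longrightarrow> a \<in> V i \<Longrightarrow> b \<in> V i \<Longrightarrow> a \<otimes> b \<otimes> inv a \<in> V (Suc (Suc i))"
  using chain_mult[of V "a \<otimes> b" "Suc i" "inv a"] chain_mult[of V a i b] chain_inv[of V a i]
    chain_mono[of V i "Suc i" "inv a"] by simp

text \<open>Conjugation of \<open>flip E\<close> by an element supported on \<open>A\<close> can be replaced by conjugation by an
  element with small image. Two such conjugates that agree except on copies of \<open>B\<close> and \<open>\<kappa> ` B\<close>
  multiply to \<open>flip (B \<union> \<kappa> ` B)\<close>; this is why doubled sets are used.\<close>

lemma absorb_one:
  assumes V: "chain V" and A: "\<And>x. x \<in> A \<Longrightarrow> \<theta> x \<in> A"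
    and full: "\<And>t. t \<in> FG \<Longrightarrow> supported t A \<Longrightarrow> \<exists>w\<in>FG. \<pi> w \<in> V 1 \<and> (\<forall>x\<in>A. w x = t x)"
    and E: "E \<in> sets M" "E \<subseteq> X0" "E \<subseteq> A" "\<pi> (flip E) \<in> V 1"
    and E2: "E2 \<in> sets M" "E2 \<subseteq> E"
    and h: "h \<in> FG" "\<And>x. h (\<theta> x) = \<theta> (h x)" "h ` E2 \<subseteq> A" "h ` E2 \<subseteq> X0" "h ` E2 \<inter> E = {}"
  shows "\<pi> (flip ((E - E2) \<union> h ` E2)) \<in> V 3"
proof -
  \<comment> \<open>Adding the \<open>\<theta>\<close>-image makes the exchange of \<open>E2\<close>
    with its copy commute with \<open>\<theta>\<close>, as conjugating a flip requires.\<close>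
  define Q where "Q = E2 \<union> \<theta> ` E2"
  have tF: "\<theta> \<in> FG" using u_FG by simp
  have Qs: "Q \<in> sets M" unfolding Q_def using E2(1) FG_image[OF tF E2(1)] by blast
  have hQ: "h ` Q = h ` E2 \<union> \<theta> ` h ` E2" unfolding Q_def by (simp add: image_Un image_image h(2))
  have n0: "\<theta> x \<notin> X0" if "x \<in> X0" for x using theta_X0 that .
  have ti: "\<theta> x = \<theta> y \<longleftrightarrow> x = y" for x y using u_u_same[of "{0}"] by (metis finite.emptyI finite_insert)
  have dis: "x \<noteq> h y \<and> x \<noteq> \<theta> (h y) \<and> \<theta> x \<noteq> h y" if "x \<in> E" "y \<in> E2" for x y
  proof -
    have "x \<in> X0" "h y \<in> X0" "x \<noteq> h y" using that E(2) h(4,5) by auto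
    then show ?thesis using n0 by metis
  qed
  have Qd: "Q \<inter> h ` Q = {}"
    unfolding hQ unfolding Q_def using dis E2(2) ti by fastforce
  define t where "t = swap h Q"
  have tFG: "t \<in> FG" unfolding t_def by (rule FG_swap[OF h(1) Qs Qd])
  have QA: "Q \<union> h ` Q \<subseteq> A" unfolding hQ unfolding Q_def using E2(2) E(3) h(3) A by blast
  have ts: "supported t A" unfolding t_def by (rule supported_mono[OF swap_supported QA])
  obtain w where w: "w \<in> FG" "\<pi> w \<in> V 1" "\<And>x. x \<in> A \<Longrightarrow> w x = t x" using full[OF tFG ts] by blast
  have Qt: "\<theta> x \<in> Q" if "x \<in> Q" for x
    using that u_u_same[of "{0}"] unfolding Q_def by (auto simp: theta_image)
  have tc: "t (\<theta> x) = \<theta> (t x)" for x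
    unfolding t_def by (rule swap_commute[OF FG_bij[OF h(1)] h(2) Qt])
  have te: "t e = (if e \<in> E2 then h e else e)" if e: "e \<in> E" for e
  proof (cases "e \<in> E2")
    case True then show ?thesis by (simp add: t_def Q_def swap_in)
  next
    case False
    have "e \<notin> \<theta> ` E2" using e n0 E(2) E2(2) by blast
    moreover have "e \<notin> h ` Q" unfolding hQ using dis e by blast
    ultimately show ?thesis using False by (simp add: t_def Q_def swap_out)
  qed
  have tE: "t ` E = (E - E2) \<union> h ` E2"
  proof -
    have "t ` E = t ` (E - E2) \<union> t ` E2" using E2(2) by blast
    also have "t ` (E - E2) = E - E2" using te by simp
    also have "t ` E2 = h ` E2" using te E2(2) by (intro image_cong) auto
    finally show ?thesis .
  qed
  have im: "(E - E2) \<union> h ` E2 \<in> sets M" using E E2 FG_image[OF h(1) E2(1)] by blast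
  have "w \<circ> flip E = flip ((E - E2) \<union> h ` E2) \<circ> w"
    using flip_conj_local[OF tc FG_bij[OF tFG] FG_bij[OF w(1)] ts w(3) A E(3)] tE by simp
  then have "\<pi> (flip ((E - E2) \<union> h ` E2)) = \<pi> w \<otimes> \<pi> (flip E) \<otimes> inv (\<pi> w)"
    by (rule pi_intertwine[OF w(1) flip_FG[OF E(1)] flip_FG[OF im]])
  then show ?thesis using chain_conj[OF V w(2) E(4)] by (simp add: eval_nat_numeral)
qed

text \<open>\<open>g\<close> copies \<open>B\<close> into \<open>E\<close>.
  \<open>absorb_one\<close> replaces this copy once by the image of \<open>B\<close> under
  \<open>w\<close> and once by the \<open>\<kappa>\<close>-image of that, each at level 3. In the
  product the rest of \<open>E\<close> cancels and a doubled copy of \<open>B\<close> remains, at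
  level 4. Since \<open>w\<close> commutes with \<open>\<theta>\<close> and \<open>\<kappa>\<close>,
  conjugating back by its small inverse gives level 6.\<close>

lemma absorb:
  assumes V: "chain V" and A: "\<And>x. x \<in> A \<Longrightarrow> \<theta> x \<in> A"
    and full: "\<And>t. t \<in> FG \<Longrightarrow> supported t A \<Longrightarrow> \<exists>w\<in>FG. \<pi> w \<in> V 1 \<and> (\<forall>x\<in>A. w x = t x)"
    and E: "E \<in> sets M" "E \<subseteq> X0" "E \<subseteq> A" "\<pi> (flip E) \<in> V 1"
    and B: "B \<in> sets M"
    and g: "g \<in> FG" "\<And>x. g (\<theta> x) = \<theta> (g x)" "g \<circ> g = id" "g ` B \<subseteq> E"
    and w: "w \<in> FG" "\<And>x. w (\<theta> x) = \<theta> (w x)" "\<And>x. w (\<kappa> x) = \<kappa> (w x)" "\<pi> w \<in> V 1"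
    and D: "w ` B \<subseteq> A" "\<kappa> ` w ` B \<subseteq> A" "w ` B \<subseteq> X0" "\<kappa> ` w ` B \<subseteq> X0"
      "w ` B \<inter> E = {}" "\<kappa> ` w ` B \<inter> E = {}" "w ` B \<inter> \<kappa> ` w ` B = {}"
  shows "\<pi> (flip (B \<union> \<kappa> ` B)) \<in> V 6"
proof -
  have kF: "\<kappa> \<in> FG" by (rule u_FG) simp
  let ?E2 = "g ` B" and ?h = "w \<circ> g"
  have E2: "?E2 \<in> sets M" by (rule FG_image[OF g(1) B])
  have hE: "?h ` ?E2 = w ` B" by (simp add: image_image involution_app[OF g(3)])
  have hE': "(\<kappa> \<circ> ?h) ` ?E2 = \<kappa> ` w ` B" by (simp add: image_image involution_app[OF g(3)])
  have hF: "?h \<in> FG" and hF': "\<kappa> \<circ> ?h \<in> FG" by (intro FG_comp kF w(1) g(1))+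
  have c1: "?h (\<theta> x) = \<theta> (?h x)" and c2: "(\<kappa> \<circ> ?h) (\<theta> x) = \<theta> ((\<kappa> \<circ> ?h) x)" for x
    using u_commute[of "{1}" "{0}"] by (simp_all add: g(2) w(2))
  have 1: "\<pi> (flip ((E - ?E2) \<union> w ` B)) \<in> V 3"
    using absorb_one[OF V A full E E2 g(4) hF c1] D unfolding hE by blast
  have 2: "\<pi> (flip ((E - ?E2) \<union> \<kappa> ` w ` B)) \<in> V 3"
    using absorb_one[OF V A full E E2 g(4) hF' c2] D unfolding hE' by blast
  have wB: "w ` B \<in> sets M" by (rule FG_image[OF w(1) B])
  have kwB: "\<kappa> ` w ` B \<in> sets M" by (rule FG_image[OF kF wB])
  have s1: "(E - ?E2) \<union> w ` B \<in> sets M" "(E - ?E2) \<union> \<kappa> ` w ` B \<in> sets M" using E(1) E2 wB kwB by blast+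
  have "sym_diff ((E - ?E2) \<union> w ` B) ((E - ?E2) \<union> \<kappa> ` w ` B) = w ` B \<union> \<kappa> ` w ` B"
    using D(5-7) by blast
  moreover have "(E - ?E2) \<union> w ` B \<subseteq> X0" "(E - ?E2) \<union> \<kappa> ` w ` B \<subseteq> X0" using E(2) D(3,4) by blast+
  note flip_comp[OF this]
  ultimately have "flip ((E - ?E2) \<union> w ` B) \<circ> flip ((E - ?E2) \<union> \<kappa> ` w ` B) = flip (w ` B \<union> \<kappa> ` w ` B)"
    by (simp only:)
  then have "\<pi> (flip (w ` B \<union> \<kappa> ` w ` B)) = \<pi> (flip ((E - ?E2) \<union> w ` B)) \<otimes> \<pi> (flip ((E - ?E2) \<union> \<kappa> ` w ` B))"
    using pi_comp[OF flip_FG[OF s1(1)] flip_FG[OF s1(2)]] by simp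
  then have 3: "\<pi> (flip (w ` B \<union> \<kappa> ` w ` B)) \<in> V 4"
    using chain_mult[OF V 1 2] by (simp add: eval_nat_numeral)
  have kB: "B \<union> \<kappa> ` B \<in> sets M" using B FG_image[OF kF B] by blast
  have wk: "w ` (B \<union> \<kappa> ` B) = w ` B \<union> \<kappa> ` w ` B" by (simp only: image_Un image_image w(3))
  have wi: "finv w (\<theta> x) = \<theta> (finv w x)" for x using w(2) FG_bij[OF w(1)] by (metis bij_inv_eq_iff)
  have iw: "finv w ` (w ` B \<union> \<kappa> ` w ` B) = B \<union> \<kappa> ` B"
    unfolding wk[symmetric] using FG_bij[OF w(1)] by (simp add: bij_is_inj)
  have "finv w \<circ> flip (w ` B \<union> \<kappa> ` w ` B) = flip (B \<union> \<kappa> ` B) \<circ> finv w"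
    using flip_conj[OF wi bij_imp_bij_inv[OF FG_bij[OF w(1)]]] unfolding iw[symmetric] by simp
  then have "\<pi> (flip (B \<union> \<kappa> ` B)) = \<pi> (finv w) \<otimes> \<pi> (flip (w ` B \<union> \<kappa> ` w ` B)) \<otimes> inv (\<pi> (finv w))"
    using wB kwB by (intro pi_intertwine FG_inv w(1) flip_FG kB) auto
  moreover have "\<pi> (finv w) \<in> V 4"
    using chain_mono[OF V, of 1 4] chain_inv[OF V w(4)] pi_inv[OF w(1)] by simp
  ultimately show ?thesis using chain_conj[OF V _ 3] by (simp add: eval_nat_numeral)
qed

text \<open>For a set \<open>\<alpha>\<close> of naturals, \<open>g \<alpha>\<close> exchanges the \<open>m\<close>-th cylinder with the copy of it coded by
  \<open>\<alpha> \<inter> {..<m}\<close>. If \<open>\<alpha> \<noteq> \<beta>\<close>, these codes differ for all large \<open>m\<close>, hence \<open>g \<alpha> \<circ> g \<beta>\<close> carries the late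
  cylinders to their copies, and uncountably many \<open>\<alpha>\<close> compete for countably many translates of \<open>V\<close>.\<close>

lemma mover:
  fixes N :: "nat \<Rightarrow> nat" and \<sigma> :: "nat \<Rightarrow> nat set" and \<tau> :: "nat \<Rightarrow> nat set \<Rightarrow> nat set"
  defines "Cy \<equiv> \<lambda>m. {x \<in> \<Omega>. S x \<inter> {2..<N m} = \<sigma> m}"
    and "Ct \<equiv> \<lambda>m \<rho>. {x \<in> \<Omega>. S x \<inter> {2..<N m} = \<tau> m \<rho>}"
  assumes V: "covering V" and N: "\<And>m. N m \<ge> m + 2"
    and \<sigma>: "\<And>m. \<sigma> m \<subseteq> {2..<N m}" "\<And>m. 2 \<notin> \<sigma> m"
    and \<tau>: "\<And>m \<rho>. \<rho> \<subseteq> {..<m} \<Longrightarrow> \<tau> m \<rho> \<subseteq> {2..<N m}" "\<And>m \<rho>. \<rho> \<subseteq> {..<m} \<Longrightarrow> 2 \<in> \<tau> m \<rho>"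
    and Ct: "\<And>m \<rho> m' \<rho>' x. \<rho> \<subseteq> {..<m} \<Longrightarrow> \<rho>' \<subseteq> {..<m'} \<Longrightarrow> x \<in> Ct m \<rho> \<Longrightarrow> x \<in> Ct m' \<rho>' \<Longrightarrow> m = m' \<and> \<rho> = \<rho>'"
  shows "\<exists>m w Z. w \<in> FG \<and> (\<exists>a\<in>V. \<exists>b\<in>V. \<pi> w = a \<otimes> b) \<and> (\<forall>x. w (\<theta> x) = \<theta> (w x)) \<and> (\<forall>x. w (\<kappa> x) = \<kappa> (w x)) \<and>
    Z \<in> null_sets M \<and> (\<forall>x\<in>Cy m - Z. \<exists>j \<rho>. \<rho> \<subseteq> {..<j} \<and> w x \<in> Ct j \<rho> \<and> (\<forall>i<2. i \<in> S (w x) \<longleftrightarrow> i \<in> S x))"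
proof -
  have fin: "finite (\<sigma> m)" "\<rho> \<subseteq> {..<m} \<Longrightarrow> finite (\<tau> m \<rho>)" for m \<rho>
    by (rule finite_subset[OF \<sigma>(1) finite_atLeastLessThan]) (rule finite_subset[OF \<tau>(1) finite_atLeastLessThan])
  have Cys: "Cy m \<in> sets M" for m
  proof -
    have "{..<N m} \<inter> {2..<N m} = {2..<N m}" by auto
    then show ?thesis unfolding Cy_def
      by (intro S_sets'[where N="N m" and Q="\<lambda>\<tau>. \<tau> \<inter> {2..<N m} = \<sigma> m"]) (simp add: Int_assoc)
  qed
  have small: "measure M (Cy m) \<le> (1/2) ^ m" for m
  proof -
    have "measure M (Cy m) \<le> (1/2) ^ card {2..<N m}"
      by (rule cylinder_small[OF Cys, where \<sigma>="\<sigma> m"]) (auto simp: Cy_def)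
    also have "\<dots> \<le> (1/2) ^ m" using N[of m] by (intro power_decreasing) auto
    finally show ?thesis .
  qed
  have "summable (\<lambda>m. measure M (Cy m))"
    by (rule summable_comparison_test'[OF summable_geometric[of "1/2::real"], of 0]) (use small in auto)
  \<comment> \<open>The lower bound on \<open>N m\<close> makes the measures of the cylinders at
    most \<open>(1/2) ^ m\<close>, so almost no point lies in infinitely many.\<close>
  then have Z: "limsup Cy \<in> null_sets M"
    using Cys by (intro borel_cantelli_limsup1) (auto simp: emeasure_eq_measure)
  \<comment> \<open>The given cylinders may overlap, so each point is assigned to the last one
    containing it.\<close>
  define Et where "Et m = Cy m - (\<Union>j\<in>{m<..}. Cy j)" for m
  have Ets: "Et m \<in> sets M" for m unfolding Et_def using Cys by (intro sets.Diff sets.countable_UN') auto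
  have Etd: "m = m'" if "x \<in> Et m" "x \<in> Et m'" for x m m'
    using that unfolding Et_def by (metis DiffD1 DiffD2 UN_I greaterThan_iff linorder_neqE_nat)
  have last: "\<exists>j\<ge>m. x \<in> Et j" if x: "x \<in> Cy m" "x \<notin> limsup Cy" for x m
  proof -
    obtain n where n: "\<And>j. j \<ge> n \<Longrightarrow> x \<notin> Cy j"
      using x(2) unfolding limsup_INF_SUP by auto
    define J where "J = {j. j \<ge> m \<and> x \<in> Cy j}"
    have "J \<subseteq> {..<n}" using n unfolding J_def by (auto simp: not_le[symmetric])
    then have fJ: "finite J" using finite_subset by blast
    have "m \<in> J" using x by (simp add: J_def)
    define k where "k = Max J"
    have "k \<in> J" unfolding k_def using fJ \<open>m \<in> J\<close> by (intro Max_in) auto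
    then have k: "m \<le> k" "x \<in> Cy k" unfolding J_def by auto
    have "x \<notin> Cy j" if "j > k" for j
    proof
      assume "x \<in> Cy j"
      then have "j \<in> J" using k that unfolding J_def by simp
      then have "j \<le> k" unfolding k_def by (rule Max_ge[OF fJ])
      then show False using that by simp
    qed
    then have "x \<in> Et k" using k(2) unfolding Et_def by simp
    then show ?thesis using k(1) by blast
  qed
  \<comment> \<open>The digit change from the source pattern to the coded destination pattern; it
    touches only positions from 2 on, hence commutes with and preserves the two switches.\<close>
  define F where "F m \<rho> = sym_diff (\<sigma> m) (\<tau> m \<rho>)" for m \<rho>
  have Ffin: "finite (F m \<rho>)" if "\<rho> \<subseteq> {..<m}" for m \<rho> unfolding F_def using fin that by simp
  have F2: "F m \<rho> \<subseteq> {2..<N m}" if "\<rho> \<subseteq> {..<m}" for m \<rho> unfolding F_def using \<sigma>(1)[of m] \<tau>(1)[OF that] by blast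
  have uCt: "u (F m \<rho>) x \<in> Ct m \<rho>" if "\<rho> \<subseteq> {..<m}" "x \<in> Cy m" for m \<rho> x
  proof -
    have x: "x \<in> \<Omega>" "S x \<inter> {2..<N m} = \<sigma> m" using that(2) by (auto simp: Cy_def)
    have "S (u (F m \<rho>) x) \<inter> {2..<N m} = sym_diff (S x \<inter> {2..<N m}) (F m \<rho>)"
      unfolding S_u[OF Ffin[OF that(1)] x(1)] using F2[OF that(1)] by auto
    also have "\<dots> = \<tau> m \<rho>" unfolding x(2) F_def by auto
    finally show ?thesis using x(1) u_Om[OF Ffin[OF that(1)]] by (simp add: Ct_def)
  qed
  define r where "r \<alpha> m = \<alpha> \<inter> {..<m}" for \<alpha> :: "nat set" and m
  have r: "r \<alpha> m \<subseteq> {..<m}" for \<alpha> m by (auto simp: r_def)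
  define f where "f \<alpha> m = u (F m (r \<alpha> m))" for \<alpha> m
  define P where "P \<alpha> m = Et m \<union> f \<alpha> m ` Et m" for \<alpha> m
  have fF: "f \<alpha> m \<in> FG" for \<alpha> m unfolding f_def by (rule u_FG[OF Ffin[OF r]])
  have ff: "f \<alpha> m \<circ> f \<alpha> m = id" for \<alpha> m unfolding f_def by (rule u_invol[OF Ffin[OF r]])
  have fE: "f \<alpha> m x \<in> Ct m (r \<alpha> m)" if "x \<in> Et m" for \<alpha> m x
    unfolding f_def using uCt[OF r] that by (auto simp: Et_def)
  \<comment> \<open>Digit 2 is 1 on every destination and 0 on every source.\<close>
  have CtEt: "x \<notin> Et m'" if "x \<in> Ct m (r \<alpha> m)" for x m m' \<alpha>
  proof -
    have "2 \<in> S x" using that \<tau>(2)[OF r] unfolding Ct_def by blast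
    moreover have "2 \<in> {2..<N m'}" if "x \<in> Et m'" for x 
      using \<tau>(1)[OF r[of \<alpha> m']] \<tau>(2)[OF r[of \<alpha> m']] by blast
    ultimately show ?thesis using \<sigma>(2)[of m'] unfolding Et_def Cy_def by blast
  qed
  have PEC: "x \<in> Et m \<or> x \<in> Ct m (r \<alpha> m)" if "x \<in> P \<alpha> m" for x \<alpha> m
    using that fE unfolding P_def by blast
  have Pd: "m = m'" if "x \<in> P \<alpha> m" "x \<in> P \<alpha> m'" for x \<alpha> m m'
    using PEC[OF that(1)] PEC[OF that(2)] CtEt Etd Ct[OF r r] by metis
  have Pdj: "disjoint_family (P \<alpha>)" for \<alpha> unfolding disjoint_family_on_def using Pd by blast
  have Ps: "P \<alpha> m \<in> sets M" for \<alpha> m unfolding P_def using Ets FG_image[OF fF Ets] by blast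
  have fP: "f \<alpha> m ` P \<alpha> m = P \<alpha> m" for \<alpha> m
    unfolding P_def by (auto simp: image_Un image_image involution_app[OF ff])
  define g where "g \<alpha> = glue (P \<alpha>) (\<lambda>m. rst (f \<alpha> m) (P \<alpha> m))" for \<alpha>
  have rF: "rst (f \<alpha> m) (P \<alpha> m) \<in> FG" for \<alpha> m by (rule FG_rst[OF fF Ps fP])
  have gF: "g \<alpha> \<in> FG" for \<alpha> unfolding g_def by (rule FG_glue[OF rF rst_supported Ps Pdj])
  have g_in: "g \<alpha> x = f \<alpha> m x" if "x \<in> P \<alpha> m" for \<alpha> m x
    unfolding g_def using glue_in[OF Pdj that] that by (simp add: rst_def)
  have g_out: "g \<alpha> x = x" if "\<And>m. x \<notin> P \<alpha> m" for \<alpha> x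
    unfolding g_def using that by (rule glue_out)
  have gg: "g \<alpha> \<circ> g \<alpha> = id" for \<alpha>
  proof
    fix x show "(g \<alpha> \<circ> g \<alpha>) x = id x"
    proof (cases "\<exists>m. x \<in> P \<alpha> m")
      case True
      then obtain m where m: "x \<in> P \<alpha> m" by blast
      then have "f \<alpha> m x \<in> P \<alpha> m" using fP by blast
      then show ?thesis using m g_in involution_app[OF ff] by simp
    qed (simp add: g_out)
  qed
  have comm: "g \<alpha> (u {i} x) = u {i} (g \<alpha> x)" if i: "i < 2" for i \<alpha> x
  proof -
    have uc: "f \<alpha> m (u {i} x) = u {i} (f \<alpha> m x)" for m x
      unfolding f_def by (rule u_commute[OF Ffin[OF r]]) simp
    have uu: "u {i} (u {i} x) = x" for x using u_u_same[of "{i}"] by simp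
    have Cyi: "u {i} x \<in> Cy m" if "x \<in> Cy m" for x m
    proof -
      have x: "x \<in> \<Omega>" using that by (simp add: Cy_def)
      have "S (u {i} x) = sym_diff (S x) {i}" by (rule S_u) (simp_all add: x)
      moreover have "i \<notin> {2..<N m}" using i by simp
      ultimately have "S (u {i} x) \<inter> {2..<N m} = S x \<inter> {2..<N m}" by blast
      then show ?thesis using that u_Om[of "{i}" x] by (simp add: Cy_def)
    qed
    have Eti: "u {i} x \<in> Et m" if "x \<in> Et m" for x m
    proof -
      have "u {i} x \<notin> Cy j" if "j > m" for j
        using Cyi[of "u {i} x" j] uu[of x] \<open>x \<in> Et m\<close> that unfolding Et_def by auto
      moreover have "u {i} x \<in> Cy m" using Cyi that unfolding Et_def by blast
      ultimately show ?thesis unfolding Et_def by simp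
    qed
    have Pi: "u {i} x \<in> P \<alpha> m" if xP: "x \<in> P \<alpha> m" for x m
    proof -
      consider "x \<in> Et m" | y where "y \<in> Et m" "x = f \<alpha> m y" using xP unfolding P_def by blast
      then show ?thesis
      proof cases
        case 1 then show ?thesis using Eti unfolding P_def by blast
      next
        case 2
        have "u {i} x = f \<alpha> m (u {i} y)" unfolding 2(2) uc ..
        then show ?thesis using Eti[OF 2(1)] unfolding P_def by blast
      qed
    qed
    show ?thesis
    proof (cases "\<exists>m. x \<in> P \<alpha> m")
      case True
      then obtain m where m: "x \<in> P \<alpha> m" by blast
      show ?thesis using g_in[OF m] g_in[OF Pi[OF m]] uc by simp
    next
      case False
      then have "u {i} x \<notin> P \<alpha> m" for m using Pi[of "u {i} x" m] uu[of x] by auto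
      then have "g \<alpha> (u {i} x) = u {i} x" by (rule g_out)
      moreover have "g \<alpha> x = x" by (rule g_out) (use False in blast)
      ultimately show ?thesis by simp
    qed
  qed
  obtain \<alpha> \<beta> where ab: "\<alpha> \<noteq> \<beta>" "\<exists>a\<in>V. \<exists>b\<in>V. \<pi> (finv (g \<alpha>) \<circ> g \<beta>) = a \<otimes> b"
    using covering_pigeonhole[OF V, of g] gF by blast
  define w where "w = g \<alpha> \<circ> g \<beta>"
  have "\<exists>i. (i \<in> \<alpha>) \<noteq> (i \<in> \<beta>)" using ab(1) by blast
  then obtain i where i: "(i \<in> \<alpha>) \<noteq> (i \<in> \<beta>)" by blast
  have rne: "r \<alpha> m \<noteq> r \<beta> m" if "m > i" for m using i that unfolding r_def by blast
  \<comment> \<open>For \<open>j\<close> beyond a difference of \<open>\<alpha>\<close> and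
    \<open>\<beta>\<close>, \<open>g \<beta>\<close> sends the piece to a destination with a code
    that \<open>g \<alpha>\<close> never uses, so \<open>g \<alpha>\<close> leaves it there.\<close>
  have wE: "w x \<in> Ct j (r \<beta> j) \<and> w x = f \<beta> j x" if x: "x \<in> Et j" and j: "j > i" for x j
  proof -
    have gx: "g \<beta> x = f \<beta> j x" by (rule g_in) (use x in \<open>simp add: P_def\<close>)
    have c: "f \<beta> j x \<in> Ct j (r \<beta> j)" by (rule fE[OF x])
    have "f \<beta> j x \<notin> P \<alpha> m" for m
    proof
      assume "f \<beta> j x \<in> P \<alpha> m"
      from PEC[OF this] show False
      proof
        assume "f \<beta> j x \<in> Et m" then show ?thesis using CtEt[OF c] by blast
      next
        assume "f \<beta> j x \<in> Ct m (r \<alpha> m)" then show ?thesis using Ct[OF r r c] rne[OF j] by metis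
      qed
    qed
    then have "g \<alpha> (f \<beta> j x) = f \<beta> j x" by (rule g_out)
    then show ?thesis using gx c by (simp add: w_def)
  qed
  have "w \<in> FG" unfolding w_def by (rule FG_comp[OF gF gF])
  moreover have "\<exists>a\<in>V. \<exists>b\<in>V. \<pi> w = a \<otimes> b" using ab(2) involution_inv[OF gg] by (simp add: w_def)
  moreover have "w (\<theta> x) = \<theta> (w x)" "w (\<kappa> x) = \<kappa> (w x)" for x
    unfolding w_def using comm[of 0] comm[of 1] by simp_all
  \<comment> \<open>The cylinder with index \<open>Suc i\<close> is taken because its points are
    assigned to some \<open>j\<close> above \<open>i\<close>, where the codes differ.\<close>
  moreover have "\<exists>j \<rho>. \<rho> \<subseteq> {..<j} \<and> w x \<in> Ct j \<rho> \<and> (\<forall>i<2. i \<in> S (w x) \<longleftrightarrow> i \<in> S x)"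
    if x: "x \<in> Cy (Suc i) - limsup Cy" for x
  proof -
    obtain j where j: "j \<ge> Suc i" "x \<in> Et j" using last x by blast
    have xO: "x \<in> \<Omega>" using x by (simp add: Cy_def)
    have w: "w x \<in> Ct j (r \<beta> j)" "w x = f \<beta> j x" using wE[OF j(2)] j(1) by auto
    have "l \<in> S (w x) \<longleftrightarrow> l \<in> S x" if "l < 2" for l
      unfolding w(2) f_def using S_u[OF Ffin[OF r] xO] F2[OF r] that by fastforce
    then show ?thesis using w(1) r by blast
  qed
  ultimately show ?thesis using Z by blast
qed

end

text \<open>Both hypotheses locate the least element of \<open>X\<close> from \<open>a\<close> on.
  Numbers are thus coded in digits by the position of the first 1, which makes the corresponding
  cylinders disjoint.\<close>

lemma first_in_interval:
  fixes a k l :: nat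
  assumes "X \<inter> {a..a+k} = {a+k}" "X \<inter> {a..a+l} = {a+l}"
  shows "k = l"
proof -
  have "l' \<le> k'" if "X \<inter> {a..a+k'} = {a+k'}" "X \<inter> {a..a+l'} = {a+l'}" for k' l' :: nat
  proof (rule ccontr)
    assume "\<not> l' \<le> k'"
    then have "a + k' \<in> X \<inter> {a..a+l'}" using that(1) by auto
    then show False using that(2) \<open>\<not> l' \<le> k'\<close> by simp
  qed
  then show ?thesis using assms by (metis le_antisym)
qed

section \<open>Doubled flips on fine cylinders\<close>

context dyadic_hom begin

definition flip2 :: "'a set \<Rightarrow> 'a \<Rightarrow> 'a" where "flip2 B = flip (B \<union> \<kappa> ` B)"

lemma kappa_image: "x \<in> \<kappa> ` B \<longleftrightarrow> \<kappa> x \<in> B"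
  using u_u_same[of "{1}"] by (auto simp: image_iff) (metis finite.emptyI finite_insert)

lemma S_theta: "x \<in> \<Omega> \<Longrightarrow> i \<noteq> 0 \<Longrightarrow> i \<in> S (\<theta> x) \<longleftrightarrow> i \<in> S x"
  using S_u[of "{0}" x] by simp

lemma S_kappa: "x \<in> \<Omega> \<Longrightarrow> i \<noteq> 1 \<Longrightarrow> i \<in> S (\<kappa> x) \<longleftrightarrow> i \<in> S x"
  using S_u[of "{1}" x] by simp

lemma S_kappa1: "x \<in> \<Omega> \<Longrightarrow> 1 \<in> S (\<kappa> x) \<longleftrightarrow> 1 \<notin> S x"
  using S_u[of "{1}" x] by simp

lemma theta_Om: "\<theta> x \<in> \<Omega> \<longleftrightarrow> x \<in> \<Omega>" and kappa_Om: "\<kappa> x \<in> \<Omega> \<longleftrightarrow> x \<in> \<Omega>"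
  using u_Om[of "{0}"] u_Om[of "{1}"] by simp_all

lemma flip2_dom:
  assumes "B \<subseteq> X3"
  shows "B \<union> \<kappa> ` B \<subseteq> X0"
  using assms S_kappa kappa_Om by (auto simp: X3_def X0_def)

lemma flip2_sets: "B \<in> sets M \<Longrightarrow> B \<union> \<kappa> ` B \<in> sets M"
  using FG_image[OF u_FG, of "{1}" B] by blast

lemma flip2_FG: "B \<in> sets M \<Longrightarrow> flip2 B \<in> FG"
  unfolding flip2_def by (rule flip_FG[OF flip2_sets])

lemma flip2_empty: "flip2 {} = id"
  by (simp add: flip2_def flip_empty)

lemma flip2_comp:
  assumes "B \<subseteq> X3" "C \<subseteq> X3" "B \<inter> C = {}"
  shows "flip2 B \<circ> flip2 C = flip2 (B \<union> C)"
proof -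
  have k: "\<kappa> x \<notin> X3" if "x \<in> X3" for x using that S_kappa1[of x] by (auto simp: X3_def)
  have "x \<in> \<kappa> ` B \<Longrightarrow> x \<notin> \<kappa> ` C" for x using assms(3) unfolding kappa_image by blast
  moreover have "x \<in> \<kappa> ` B \<Longrightarrow> x \<notin> C" "x \<in> \<kappa> ` C \<Longrightarrow> x \<notin> B" for x
    unfolding kappa_image using k assms(1,2) by blast+
  ultimately have "sym_diff (B \<union> \<kappa> ` B) (C \<union> \<kappa> ` C) = (B \<union> C) \<union> \<kappa> ` (B \<union> C)"
    unfolding image_Un using assms(3) by blast
  then show ?thesis unfolding flip2_def using flip_comp[OF flip2_dom[OF assms(1)] flip2_dom[OF assms(2)]] by simp
qed

lemma flip2_null:
  assumes "B \<in> sets M" "Z \<in> null_sets M"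
  shows "\<pi> (flip2 B) = \<pi> (flip2 (B - Z))"
proof (rule pi_AE)
  have BZ: "B - Z \<in> sets M" using assms by auto
  show "flip2 B \<in> FG" "flip2 (B - Z) \<in> FG" by (rule flip2_FG[OF assms(1)], rule flip2_FG[OF BZ])
  have tF: "\<theta> \<in> FG" and kF: "\<kappa> \<in> FG" by (rule u_FG, simp)+
  have 1: "AE x in M. x \<notin> Z" by (rule AE_not_in[OF assms(2)])
  have 2: "AE x in M. \<kappa> x \<notin> Z" by (rule FG_AE[OF kF 1])
  have 3: "AE x in M. \<theta> x \<notin> Z" by (rule FG_AE[OF tF 1])
  have 4: "AE x in M. \<kappa> (\<theta> x) \<notin> Z" by (rule FG_AE[OF tF 2])
  show "AE x in M. flip2 B x = flip2 (B - Z) x"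
    using 1 2 3 4 by eventually_elim (simp add: flip2_def flip_app kappa_image del: One_nat_def)
qed

text \<open>Neighbourhoods of the identity contain the images of all sufficiently fine \<open>flip2 B\<close>: otherwise
  there are exceptional \<open>B\<^sub>m\<close> inside arbitrarily fine cylinders, and some element whose image is small
  moves one of them into the piece on which the small elements already realise everything.\<close>

lemma small_cylinders:
  assumes cov: "covering (V 0)" and V: "chain V"
  shows "\<exists>N. \<forall>B \<sigma>. B \<in> sets M \<longrightarrow> B \<subseteq> X3 \<longrightarrow> (\<forall>x\<in>B. S x \<inter> {..<N} = \<sigma>) \<longrightarrow> \<pi> (flip2 B) \<in> V 6"
proof (rule ccontr)
  assume neg: "\<not> ?thesis"
  have VV: "\<pi> w \<in> V 1" if "\<exists>a\<in>V 0. \<exists>b\<in>V 0. \<pi> w = a \<otimes> b" for w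
    using that chain_mult[OF V, of _ 0] by auto
  \<comment> \<open>Digit 2 marks destinations, and the first 1 from position 3 on encodes
    \<open>k\<close>.\<close>
  define A where "A k = {x \<in> \<Omega>. 2 \<in> S x \<and> S x \<inter> {3..3+k} = {3+k}}" for k
  have sub: "S x \<inter> {..<N} \<inter> J = S x \<inter> J" if "J \<subseteq> {..<N}" for x N and J :: "nat set" using that by blast
  have As: "A k \<in> sets M" for k
  proof (rule S_sets'[where N="4+k" and Q="\<lambda>\<tau>. 2 \<in> \<tau> \<and> \<tau> \<inter> {3..3+k} = {3+k}"])
    have "{3..3+k} \<subseteq> {..<4+k}" by auto
    then show "x \<in> A k \<longleftrightarrow> x \<in> \<Omega> \<and> 2 \<in> S x \<inter> {..<4+k} \<and> S x \<inter> {..<4+k} \<inter> {3..3+k} = {3+k}" for x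
      unfolding A_def by (simp add: sub)
  qed
  have Ad: "disjoint_family A"
    unfolding disjoint_family_on_def A_def using first_in_interval by blast
  obtain k where k: "\<And>t. t \<in> FG \<Longrightarrow> supported t (A k) \<Longrightarrow>
      \<exists>w\<in>FG. (\<exists>a\<in>V 0. \<exists>b\<in>V 0. \<pi> w = a \<otimes> b) \<and> (\<forall>x\<in>A k. w x = t x)"
    using covering_full_piece[OF cov As Ad] by blast
  have full: "\<exists>w\<in>FG. \<pi> w \<in> V 1 \<and> (\<forall>x\<in>A k. w x = t x)" if "t \<in> FG" "supported t (A k)" for t
    using k[OF that] VV by blast
  have At: "\<theta> x \<in> A k" if "x \<in> A k" for x
  proof -
    have x: "x \<in> \<Omega>" using that by (simp add: A_def)
    have "S (\<theta> x) \<inter> {3..3+k} = S x \<inter> {3..3+k}" using S_theta[OF x] by auto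
    then show ?thesis using that S_theta[OF x, of 2] theta_Om by (simp add: A_def)
  qed
  \<comment> \<open>Inside the piece \<open>A k\<close>, digit \<open>4+k\<close> marks the part
    reserved for the flip and the next block encodes \<open>n\<close>; the movers' destinations will
    have this digit 0.\<close>
  define E where "E n = {x \<in> A k. 0 \<notin> S x \<and> 1 \<notin> S x \<and> 4+k \<in> S x \<and> S x \<inter> {5+k..5+k+n} = {5+k+n}}" for n
  have Es: "E n \<in> sets M" for n
  proof -
    have "{5+k..5+k+n} \<subseteq> {..<6+k+n}" by auto
    then have "{x \<in> \<Omega>. 0 \<notin> S x \<and> 1 \<notin> S x \<and> 4+k \<in> S x \<and> S x \<inter> {5+k..5+k+n} = {5+k+n}} \<in> sets M"
      by (intro S_sets'[where N="6+k+n" and Q="\<lambda>\<tau>. 0 \<notin> \<tau> \<and> 1 \<notin> \<tau> \<and> 4+k \<in> \<tau> \<and> \<tau> \<inter> {5+k..5+k+n} = {5+k+n}"])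
        (simp add: sub)
    moreover have "E n = A k \<inter> {x \<in> \<Omega>. 0 \<notin> S x \<and> 1 \<notin> S x \<and> 4+k \<in> S x \<and> S x \<inter> {5+k..5+k+n} = {5+k+n}}"
      unfolding E_def A_def by blast
    ultimately show ?thesis using As by simp
  qed
  have Ed: "n = n'" if "x \<in> E n" "x \<in> E n'" for x n n'
    using that first_in_interval[of "S x" "5+k" n n'] unfolding E_def by simp
  define UE where "UE \<alpha> = (\<Union>n\<in>\<alpha>. E n)" for \<alpha>
  have UEs: "UE \<alpha> \<in> sets M" for \<alpha> unfolding UE_def using Es by (intro sets.countable_UN') auto
  have UEX: "UE \<alpha> \<subseteq> X0" "UE \<alpha> \<subseteq> A k" for \<alpha> unfolding UE_def E_def X0_def A_def by auto
  have UE4: "4+k \<in> S x" if "x \<in> UE \<alpha>" for x \<alpha> using that by (auto simp: UE_def E_def)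
  \<comment> \<open>Competing unions of the \<open>E n\<close> give a flip of small image on a
    symmetric difference, and this difference contains an entire cylinder set \<open>E n\<close> as
    room for a copy of the bad set.\<close>
  obtain \<alpha> \<beta> where ab: "\<alpha> \<noteq> \<beta>" "\<exists>a\<in>V 0. \<exists>b\<in>V 0. \<pi> (finv (flip (UE \<alpha>)) \<circ> flip (UE \<beta>)) = a \<otimes> b"
    using covering_pigeonhole[OF cov, of "\<lambda>\<alpha>. flip (UE \<alpha>)"] flip_FG[OF UEs] by blast
  define E' where "E' = sym_diff (UE \<alpha>) (UE \<beta>)"
  have E's: "E' \<in> sets M" "E' \<subseteq> X0" "E' \<subseteq> A k" unfolding E'_def using UEs UEX by blast+
  have E'4: "4+k \<in> S x" if "x \<in> E'" for x using that UE4 unfolding E'_def by blast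
  have E'V: "\<pi> (flip E') \<in> V 1"
    using VV[OF ab(2)] involution_inv[OF flip_invol[OF UEX(1)]] flip_comp[OF UEX(1) UEX(1)] unfolding E'_def by simp
  obtain n where n: "n \<in> sym_diff \<alpha> \<beta>" using ab(1) by blast
  have EE': "E n \<subseteq> E'"
  proof
    fix x assume x: "x \<in> E n"
    have *: "x \<in> UE \<gamma> \<longleftrightarrow> n \<in> \<gamma>" for \<gamma>
    proof
      assume "x \<in> UE \<gamma>"
      then obtain n' where "n' \<in> \<gamma>" "x \<in> E n'" by (auto simp: UE_def)
      then show "n \<in> \<gamma>" using Ed[OF x] by blast
    qed (use x in \<open>auto simp: UE_def\<close>)
    show "x \<in> E'" using n *[of \<alpha>] *[of \<beta>] unfolding E'_def by auto
  qed
  \<comment> \<open>Long enough to hold the pattern of \<open>E n\<close> (last position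
    \<open>5+k+n\<close>) and every code for \<open>m\<close> (last position
    \<open>5+k+2*m\<close>).\<close>
  define N where "N m = 7 + k + n + 2 * m" for m
  define exc where "exc m B \<sigma> \<longleftrightarrow> B \<in> sets M \<and> B \<subseteq> X3 \<and> (\<forall>x\<in>B. S x \<inter> {..<N m} = \<sigma>) \<and> \<pi> (flip2 B) \<notin> V 6" for m B \<sigma>
  have "\<exists>B \<sigma>. exc m B \<sigma>" for m
  proof (rule ccontr)
    assume n: "\<nexists>B \<sigma>. exc m B \<sigma>"
    have "\<pi> (flip2 B) \<in> V 6" if "B \<in> sets M" "B \<subseteq> X3" "\<forall>x\<in>B. S x \<inter> {..<N m} = \<sigma>" for B \<sigma>
    proof (rule ccontr)
      assume "\<pi> (flip2 B) \<notin> V 6"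
      then have "exc m B \<sigma>" unfolding exc_def by (intro conjI that)
      then show False using n by blast
    qed
    then have "\<exists>N. \<forall>B \<sigma>. B \<in> sets M \<longrightarrow> B \<subseteq> X3 \<longrightarrow> (\<forall>x\<in>B. S x \<inter> {..<N} = \<sigma>) \<longrightarrow> \<pi> (flip2 B) \<in> V 6"
      by (intro exI[of _ "N m"] allI impI)
    then show False by (rule notE[OF neg])
  qed
  then obtain B s where "\<And>m. exc m (B m) (s m)" by metis
  then have Bs: "B m \<in> sets M" and BX: "B m \<subseteq> X3"
    and Bc: "x \<in> B m \<Longrightarrow> S x \<inter> {..<N m} = s m" and bad: "\<pi> (flip2 (B m)) \<notin> V 6" for m x
    unfolding exc_def by blast+
  \<comment> \<open>An empty set has trivial flip, so an exceptional one has a point, and this point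
    lies in \<open>X3\<close>.\<close>
  have B2: "2 \<notin> s m" for m
  proof -
    have "B m \<noteq> {}" using bad[of m] flip2_empty pi_id chain_one[OF V] by metis
    then obtain x where "x \<in> B m" by blast
    then show ?thesis using Bc[of x m] BX[of m] by (auto simp: X3_def)
  qed
  define \<sigma> where "\<sigma> m = s m \<inter> {2..<N m}" for m
  \<comment> \<open>Positions 2 and \<open>3+k\<close> put the destination into \<open>A k\<close>,
    the gap at \<open>4+k\<close> keeps it off \<open>E'\<close>, \<open>5+k+m\<close> encodes
    \<open>m\<close>, and the last \<open>m\<close> positions store \<open>\<rho>\<close>
    verbatim.\<close>
  define \<tau> where "\<tau> m \<rho> = {2, 3+k, 5+k+m} \<union> (\<lambda>i. 6+k+m+i) ` \<rho>" for m and \<rho> :: "nat set"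
  have Ct: "2 \<in> S x \<and> S x \<inter> {3..3+k} = {3+k} \<and> 4+k \<notin> S x \<and> S x \<inter> {5+k..5+k+m} = {5+k+m}
      \<and> \<rho> = {i. i < m \<and> 6+k+m+i \<in> S x}"
    if \<rho>: "\<rho> \<subseteq> {..<m}" and x: "S x \<inter> {2..<N m} = \<tau> m \<rho>" for m \<rho> x
  proof -
    have mem: "j \<in> S x \<longleftrightarrow> j = 2 \<or> j = 3+k \<or> j = 5+k+m \<or> (\<exists>i\<in>\<rho>. j = 6+k+m+i)" if "2 \<le> j" "j < N m" for j
    proof -
      have "j \<in> S x \<inter> {2..<N m} \<longleftrightarrow> j \<in> \<tau> m \<rho>" unfolding x ..
      then have "j \<in> S x \<longleftrightarrow> j \<in> \<tau> m \<rho>" using that by simp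
      then show ?thesis unfolding \<tau>_def by auto
    qed
    have "S x \<inter> {3..3+k} = {3+k}" using mem by (auto simp: N_def)
    moreover have "S x \<inter> {5+k..5+k+m} = {5+k+m}" using mem by (auto simp: N_def)
    moreover have "2 \<in> S x" "4+k \<notin> S x" using mem[of 2] mem[of "4+k"] by (auto simp: N_def)
    moreover have "i \<in> \<rho> \<longleftrightarrow> i < m \<and> 6+k+m+i \<in> S x" for i
    proof (cases "i < m")
      case True then show ?thesis using mem[of "6+k+m+i"] by (auto simp: N_def)
    qed (use \<rho> in auto)
    ultimately show ?thesis by blast
  qed
  have "\<exists>m w Z. w \<in> FG \<and> (\<exists>a\<in>V 0. \<exists>b\<in>V 0. \<pi> w = a \<otimes> b) \<and> (\<forall>x. w (\<theta> x) = \<theta> (w x)) \<and> (\<forall>x. w (\<kappa> x) = \<kappa> (w x)) \<and>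
    Z \<in> null_sets M \<and> (\<forall>x\<in>{x \<in> \<Omega>. S x \<inter> {2..<N m} = \<sigma> m} - Z. \<exists>j \<rho>. \<rho> \<subseteq> {..<j} \<and>
      w x \<in> {x \<in> \<Omega>. S x \<inter> {2..<N j} = \<tau> j \<rho>} \<and> (\<forall>i<2. i \<in> S (w x) \<longleftrightarrow> i \<in> S x))"
  proof (rule mover[OF cov])
    show "m + 2 \<le> N m" for m by (simp add: N_def)
    show "\<sigma> m \<subseteq> {2..<N m}" "2 \<notin> \<sigma> m" for m using B2 by (auto simp: \<sigma>_def)
    show "\<tau> m \<rho> \<subseteq> {2..<N m}" "2 \<in> \<tau> m \<rho>" if "\<rho> \<subseteq> {..<m}" for m \<rho>
      using that by (force simp: \<tau>_def N_def)+
    fix m m' \<rho> \<rho>' x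
    assume a: "\<rho> \<subseteq> {..<m}" "\<rho>' \<subseteq> {..<m'}" "x \<in> {x \<in> \<Omega>. S x \<inter> {2..<N m} = \<tau> m \<rho>}"
      "x \<in> {x \<in> \<Omega>. S x \<inter> {2..<N m'} = \<tau> m' \<rho>'}"
    have c: "S x \<inter> {5+k..5+k+m} = {5+k+m}" "\<rho> = {i. i < m \<and> 6+k+m+i \<in> S x}"
      using Ct[OF a(1)] a(3) by blast+
    have c': "S x \<inter> {5+k..5+k+m'} = {5+k+m'}" "\<rho>' = {i. i < m' \<and> 6+k+m'+i \<in> S x}"
      using Ct[OF a(2)] a(4) by blast+
    have "m = m'" by (rule first_in_interval[OF c(1) c'(1)])
    then show "m = m' \<and> \<rho> = \<rho>'" using c(2) c'(2) by simp
  qed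
  then obtain m w Z where w: "w \<in> FG" "\<exists>a\<in>V 0. \<exists>b\<in>V 0. \<pi> w = a \<otimes> b" "\<forall>x. w (\<theta> x) = \<theta> (w x)" "\<forall>x. w (\<kappa> x) = \<kappa> (w x)"
    and Z: "Z \<in> null_sets M" and mv': "\<forall>x\<in>{x \<in> \<Omega>. S x \<inter> {2..<N m} = \<sigma> m} - Z. \<exists>j \<rho>. \<rho> \<subseteq> {..<j} \<and>
      w x \<in> {x \<in> \<Omega>. S x \<inter> {2..<N j} = \<tau> j \<rho>} \<and> (\<forall>i<2. i \<in> S (w x) \<longleftrightarrow> i \<in> S x)"
    by (elim exE conjE)
  have mv: "\<exists>j \<rho>. \<rho> \<subseteq> {..<j} \<and> w x \<in> \<Omega> \<and> S (w x) \<inter> {2..<N j} = \<tau> j \<rho> \<and> (\<forall>i<2. i \<in> S (w x) \<longleftrightarrow> i \<in> S x)"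
    if "x \<in> \<Omega>" "S x \<inter> {2..<N m} = \<sigma> m" "x \<notin> Z" for x
    using bspec[OF mv', of x] that by simp
  define C where "C = B m - Z"
  have Cs: "C \<in> sets M" unfolding C_def using Bs Z by auto
  have Cx: "x \<in> \<Omega>" "0 \<notin> S x" "1 \<notin> S x" "S x \<inter> {2..<N m} = \<sigma> m" "x \<notin> Z" if "x \<in> C" for x
  proof -
    have x: "x \<in> B m" "x \<notin> Z" using that by (auto simp: C_def)
    then have "x \<in> X3" using BX by blast
    then show "x \<in> \<Omega>" "0 \<notin> S x" "1 \<notin> S x" by (simp_all add: X3_def)
    show "S x \<inter> {2..<N m} = \<sigma> m" unfolding \<sigma>_def Bc[OF x(1), symmetric] by auto
    show "x \<notin> Z" by fact
  qed
  have wx: "w x \<in> A k \<and> 0 \<notin> S (w x) \<and> 1 \<notin> S (w x) \<and> 4+k \<notin> S (w x)" if x: "x \<in> C" for x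
  proof -
    obtain j \<rho> where j: "\<rho> \<subseteq> {..<j}" "w x \<in> \<Omega>" "S (w x) \<inter> {2..<N j} = \<tau> j \<rho>" "\<forall>i<2. i \<in> S (w x) \<longleftrightarrow> i \<in> S x"
      using mv[OF Cx(1)[OF x] Cx(4)[OF x] Cx(5)[OF x]] by blast
    have "0 \<notin> S (w x)" "1 \<notin> S (w x)" using j(4) Cx(2,3)[OF x] by auto
    then show ?thesis using Ct[OF j(1,3)] j(2) unfolding A_def by blast
  qed
  have kwx: "\<kappa> (w x) \<in> A k \<and> 0 \<notin> S (\<kappa> (w x)) \<and> 1 \<in> S (\<kappa> (w x)) \<and> 4+k \<notin> S (\<kappa> (w x))" if x: "x \<in> C" for x
  proof -
    have o: "w x \<in> \<Omega>" using wx[OF x] by (simp add: A_def)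
    have "S (\<kappa> (w x)) \<inter> {3..3+k} = S (w x) \<inter> {3..3+k}" using S_kappa[OF o] by auto
    then have "\<kappa> (w x) \<in> A k" using wx[OF x] S_kappa[OF o, of 2] kappa_Om by (simp add: A_def)
    moreover have "0 \<notin> S (\<kappa> (w x))" "4+k \<notin> S (\<kappa> (w x))" using wx[OF x] S_kappa[OF o] by auto
    moreover have "1 \<in> S (\<kappa> (w x))" using wx[OF x] S_kappa1[OF o] by blast
    ultimately show ?thesis by blast
  qed
  \<comment> \<open>The digit pattern of \<open>E n\<close>; \<open>u G\<close> writes it over the
    pattern of the bad set and so copies that set into \<open>E'\<close>.\<close>
  define \<tau>E where "\<tau>E = {2, 3+k, 4+k, 5+k+n}"
  define G where "G = sym_diff (\<sigma> m) \<tau>E"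
  have Gf: "finite G" unfolding G_def \<sigma>_def \<tau>E_def by simp
  have G2: "G \<subseteq> {2..<N m}" unfolding G_def \<sigma>_def \<tau>E_def by (auto simp: N_def)
  have uE: "u G x \<in> E'" if x: "x \<in> C" for x
  proof -
    note c = Cx[OF x]
    have Su: "S (u G x) = sym_diff (S x) G" by (rule S_u[OF Gf c(1)])
    have "S (u G x) \<inter> {2..<N m} = sym_diff (S x \<inter> {2..<N m}) G" unfolding Su using G2 by auto
    also have "\<dots> = \<tau>E" unfolding c(4) G_def by auto
    finally have Sm: "S (u G x) \<inter> {2..<N m} = \<tau>E" .
    have mem: "j \<in> S (u G x) \<longleftrightarrow> j = 2 \<or> j = 3+k \<or> j = 4+k \<or> j = 5+k+n" if "2 \<le> j" "j < N m" for j
    proof -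
      have "j \<in> S (u G x) \<inter> {2..<N m} \<longleftrightarrow> j \<in> \<tau>E" unfolding Sm ..
      then have "j \<in> S (u G x) \<longleftrightarrow> j \<in> \<tau>E" using that by simp
      then show ?thesis by (simp add: \<tau>E_def)
    qed
    have "S (u G x) \<inter> {3..3+k} = {3+k}" using mem by (auto simp: N_def)
    moreover have "S (u G x) \<inter> {5+k..5+k+n} = {5+k+n}" using mem by (auto simp: N_def)
    moreover have "2 \<in> S (u G x)" "4+k \<in> S (u G x)" using mem[of 2] mem[of "4+k"] by (auto simp: N_def)
    moreover have "0 \<notin> S (u G x)" "1 \<notin> S (u G x)" unfolding Su using c(2,3) G2 by auto
    moreover have "u G x \<in> \<Omega>" using u_Om[OF Gf] c(1) by blast
    ultimately have "u G x \<in> E n" unfolding E_def A_def by blast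
    then show ?thesis using EE' by blast
  qed
  have "\<pi> (flip (C \<union> \<kappa> ` C)) \<in> V 6"
  proof (rule absorb[OF V At full E's E'V Cs, of "u G" w])
    show "u G \<in> FG" "u G \<circ> u G = id" by (rule u_FG[OF Gf], rule u_invol[OF Gf])
    show "u G (\<theta> x) = \<theta> (u G x)" for x by (rule u_commute[OF Gf]) simp
    show "u G ` C \<subseteq> E'" using uE by blast
    show "w \<in> FG" "w (\<theta> x) = \<theta> (w x)" "w (\<kappa> x) = \<kappa> (w x)" "\<pi> w \<in> V 1" for x using w VV by blast+
    show "w ` C \<subseteq> A k" "\<kappa> ` w ` C \<subseteq> A k" using wx kwx by blast+
    show "w ` C \<subseteq> X0" "\<kappa> ` w ` C \<subseteq> X0" using wx kwx unfolding X0_def A_def by blast+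
    show "w ` C \<inter> E' = {}" "\<kappa> ` w ` C \<inter> E' = {}" using wx kwx E'4 by blast+
    show "w ` C \<inter> \<kappa> ` w ` C = {}"
    proof -
      have "y \<notin> \<kappa> ` w ` C" if "1 \<notin> S y" for y using kwx that by blast
      then show ?thesis using wx by blast
    qed
  qed
  then have "\<pi> (flip2 C) \<in> V 6" by (simp only: flip2_def)
  then show False using bad[of m] flip2_null[OF Bs Z, of m] unfolding C_def by simp
qed

end

section \<open>Totally disconnected target groups\<close>

lemma topological_group_left_mult_open:
  fixes H (structure)
  assumes "topological_group H T" "a \<in> carrier H" "openin T U"
  shows "openin T {h \<in> carrier H. a \<otimes> h \<in> U}"
proof -
  have m: "continuous_map (prod_topology T T) T (\<lambda>(x, y). x \<otimes> y)" and t: "topspace T = carrier H"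
    using assms(1) by (simp_all add: topological_group_def)
  have "continuous_map T (prod_topology T T) (\<lambda>h. (a, h))"
    using assms(2) t by (intro continuous_map_pairedI) auto
  then have "continuous_map T T ((\<lambda>(x, y). x \<otimes> y) \<circ> (\<lambda>h. (a, h)))" by (rule continuous_map_compose[OF _ m])
  then have "continuous_map T T (\<lambda>h. a \<otimes> h)" by (simp add: comp_def)
  then show ?thesis using assms(3) t by (auto simp: continuous_map_def)
qed

lemma topological_group_square_nbhd:
  fixes H (structure)
  assumes H: "topological_group H T" and U: "openin T U" "\<one> \<in> U"
  shows "\<exists>V. openin T V \<and> \<one> \<in> V \<and> (\<forall>v\<in>V. inv v \<in> V) \<and> (\<forall>a\<in>V. \<forall>b\<in>V. a \<otimes> b \<in> U)"
proof -
  have m: "continuous_map (prod_topology T T) T (\<lambda>(x, y). x \<otimes> y)" and t: "topspace T = carrier H"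
    and i: "continuous_map T T (\<lambda>x. inv x)" and g: "group H"
    using H by (simp_all add: topological_group_def)
  interpret group H by (rule g)
  let ?W = "{z \<in> topspace (prod_topology T T). (\<lambda>(x, y). x \<otimes> y) z \<in> U}"
  have "openin (prod_topology T T) ?W" using m U(1) unfolding continuous_map_def by blast
  moreover have "(\<one>, \<one>) \<in> ?W" using U(2) t by simp
  ultimately obtain U1 U2 where U12: "openin T U1" "openin T U2" "\<one> \<in> U1" "\<one> \<in> U2" "U1 \<times> U2 \<subseteq> ?W"
    unfolding openin_prod_topology_alt by meson
  let ?V = "U1 \<inter> U2"
  have V: "openin T ?V" using U12 by (simp add: openin_Int)
  let ?I = "{h \<in> carrier H. inv h \<in> ?V}"
  have "openin T ?I" using i V t by (auto simp: continuous_map_def)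
  then have "openin T (?V \<inter> ?I)" using V openin_Int by blast
  moreover have "\<one> \<in> ?V \<inter> ?I" using U12 by simp
  moreover have "inv v \<in> ?V \<inter> ?I" if "v \<in> ?V \<inter> ?I" for v using that by simp
  moreover have "a \<otimes> b \<in> U" if "a \<in> ?V \<inter> ?I" "b \<in> ?V \<inter> ?I" for a b
  proof -
    have "(a, b) \<in> U1 \<times> U2" using that by blast
    then have "(a, b) \<in> ?W" using U12(5) by blast
    then show ?thesis by simp
  qed
  ultimately show ?thesis by blast
qed

section \<open>From open neighbourhoods to a continuous path\<close>

context dyadic_hom begin

text \<open>The open translate of \<open>V\<close> by \<open>h\<close> meets the countable dense set
  in some \<open>c\<close>, and symmetry of \<open>V\<close> turns this into \<open>h\<close> lying
  in the translate by \<open>c\<close>.\<close>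

lemma covering_open:
  assumes H: "topological_group H T" and T: "separable_space T"
    and V: "openin T V" "\<one> \<in> V" "\<forall>v\<in>V. inv v \<in> V"
  shows "covering V"
proof -
  have t: "topspace T = carrier H" using H by (simp add: topological_group_def)
  have Vc: "V \<subseteq> carrier H" using openin_subset[OF V(1)] t by simp
  obtain C where C: "countable C" "C \<subseteq> carrier H" "T closure_of C = carrier H"
    using T unfolding separable_space_def t by blast
  have hit: "\<exists>c\<in>C. \<exists>v\<in>V. h = c \<otimes> v" if h: "h \<in> carrier H" for h
  proof -
    let ?O = "{x \<in> carrier H. inv h \<otimes> x \<in> V}"
    have "openin T ?O" by (rule topological_group_left_mult_open[OF H _ V(1)]) (use h in simp)
    moreover have "h \<in> ?O" using h V(2) by simp
    moreover have "h \<in> T closure_of C" using C(3) h by simp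
    then have "\<forall>W. h \<in> W \<and> openin T W \<longrightarrow> (\<exists>y. y \<in> C \<and> y \<in> W)" by (simp add: in_closure_of)
    note this[THEN spec[of _ ?O]]
    ultimately obtain c where c: "c \<in> C" "c \<in> ?O" by blast
    have cH: "c \<in> carrier H" using c(1) C(2) by blast
    have "inv (inv h \<otimes> c) \<in> V" using c(2) V(3) by blast
    moreover have "h = c \<otimes> inv (inv h \<otimes> c)" using cH h by (simp add: H.inv_mult_group H.m_assoc[symmetric])
    ultimately show ?thesis using c(1) by blast
  qed
  have "C \<noteq> {}" using hit[OF H.one_closed] by auto
  then have r: "range (from_nat_into C) = C" by (rule range_from_nat_into[OF _ C(1)])
  have "\<exists>n. \<exists>v\<in>V. h = from_nat_into C n \<otimes> v" if hH: "h \<in> carrier H" for h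
  proof -
    obtain c v where c: "c \<in> C" "v \<in> V" "h = c \<otimes> v" using hit[OF hH] by blast
    have "c \<in> range (from_nat_into C)" unfolding r by (rule c(1))
    then obtain n where "c = from_nat_into C n" by (rule rangeE)
    then show ?thesis using c by blast
  qed
  then show ?thesis unfolding covering_def using Vc V(3) r C(2) by blast
qed

text \<open>Square roots are extracted downwards from \<open>U\<close>. One more is taken than the
  six steps need, because an interval of positions will split into two cylinder parts.\<close>

lemma chain_exists:
  assumes H: "topological_group H T" and T: "separable_space T" and U: "openin T U" "\<one> \<in> U"
  shows "\<exists>V. chain V \<and> covering (V 0) \<and> (\<forall>a\<in>V 6. \<forall>b\<in>V 6. a \<otimes> b \<in> U)"
proof -
  define P where "P X \<longleftrightarrow> openin T X \<and> \<one> \<in> X \<and> (\<forall>v\<in>X. inv v \<in> X)" for X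
  define Q where "Q X Y \<longleftrightarrow> (\<forall>a\<in>Y. \<forall>b\<in>Y. a \<otimes> b \<in> X)" for X Y
  have ex: "\<exists>Y. P Y \<and> Q X Y" if "openin T X" "\<one> \<in> X" for X
    using topological_group_square_nbhd[OF H that] unfolding P_def Q_def by blast
  obtain X where X: "P X" "Q U X" using ex[OF U] by blast
  have "\<exists>f. \<forall>n. (P (f n) \<and> (n = 0 \<longrightarrow> f n = X)) \<and> Q (f n) (f (Suc n))"
  proof (rule dependent_nat_choice[where P="\<lambda>n Y. P Y \<and> (n = 0 \<longrightarrow> Y = X)" and Q="\<lambda>_. Q"])
    show "\<exists>x. P x \<and> (0 = 0 \<longrightarrow> x = X)" using X(1) by blast
    show "\<exists>y. (P y \<and> (Suc n = 0 \<longrightarrow> y = X)) \<and> Q Y y" if "P Y \<and> (n = 0 \<longrightarrow> Y = X)" for n Y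
      using ex[of Y] that unfolding P_def by blast
  qed
  then obtain f where f: "\<And>n. P (f n)" "\<And>n. Q (f n) (f (Suc n))" "f 0 = X" by blast
  \<comment> \<open>The descending sequence is read backwards from 6, and beyond 6 the whole group
    fills the chain.\<close>
  define V where "V i = (if i \<le> 6 then f (6 - i) else carrier H)" for i :: nat
  have fc: "f n \<subseteq> carrier H" for n
    using f(1)[of n] H openin_subset unfolding P_def topological_group_def by blast
  have "a \<otimes> b \<in> V (Suc i)" if ab: "a \<in> V i" "b \<in> V i" for a b i
  proof (cases "i < 6")
    case True
    then have "6 - i = Suc (6 - Suc i)" by simp
    then have "a \<in> f (Suc (6 - Suc i))" "b \<in> f (Suc (6 - Suc i))" using ab True by (simp_all add: V_def)
    then have "a \<otimes> b \<in> f (6 - Suc i)" using f(2) unfolding Q_def by blast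
    then show ?thesis using True by (simp add: V_def)
  next
    case False
    have "a \<in> carrier H" "b \<in> carrier H" using ab fc by (auto simp: V_def split: if_splits)
    then show ?thesis using False by (simp add: V_def)
  qed
  moreover have "V i \<subseteq> carrier H \<and> \<one> \<in> V i \<and> (\<forall>v\<in>V i. inv v \<in> V i)" for i
    using f(1)[of "6 - i"] fc unfolding V_def P_def by simp
  ultimately have "chain V" unfolding chain_def by blast
  moreover have "covering (V 0)" using f(1)[of 6] covering_open[OF H T] by (simp add: V_def P_def)
  moreover have "V 6 = X" using f(3) by (simp add: V_def)
  ultimately show ?thesis using X(2) unfolding Q_def by blast
qed

text \<open>A set \<open>{x. s \<le> pos x < t}\<close> with \<open>t - s\<close> small meets at most two cylinders.\<close>

definition pos :: "'a \<Rightarrow> real" where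
  "pos x = (\<Sum>i. if x \<in> {x \<in> \<Omega>. i \<in> S x} then (1/2) ^ Suc i else 0)"

lemma summable_pos: "summable (\<lambda>i. if x \<in> {x \<in> \<Omega>. i \<in> S x} then (1/2) ^ Suc i else (0::real))"
  by (rule summable_comparison_test'[OF summable_mult[OF summable_geometric[of "1/2::real"], of "1/2"], of 0]) auto

lemma pos_measurable: "pos \<in> borel_measurable M"
  unfolding pos_def
proof (rule borel_measurable_suminf)
  fix i
  show "(\<lambda>x. if x \<in> {x \<in> \<Omega>. i \<in> S x} then (1/2) ^ Suc i else (0::real)) \<in> borel_measurable M"
    by (rule measurable_If_set) (use bit_sets[of i] in \<open>auto simp: sets.Int_space_eq2\<close>)
qed

definition head :: "nat \<Rightarrow> 'a \<Rightarrow> real" where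
  "head N x = (\<Sum>i<N. if x \<in> {x \<in> \<Omega>. i \<in> S x} then (1/2) ^ Suc i else 0)"

lemma pos_head: "head N x \<le> pos x" "pos x \<le> head N x + (1/2) ^ N"
proof -
  let ?f = "\<lambda>i. if x \<in> {x \<in> \<Omega>. i \<in> S x} then (1/2) ^ Suc i else (0::real)"
  have s: "pos x = (\<Sum>i. ?f (i + N)) + head N x"
    unfolding pos_def head_def by (rule suminf_split_initial_segment[OF summable_pos])
  have sf: "summable (\<lambda>i. ?f (i + N))" using summable_pos by (subst summable_iff_shift)
  have "0 \<le> (\<Sum>i. ?f (i + N))" by (rule suminf_nonneg[OF sf]) auto
  then show "head N x \<le> pos x" using s by simp
  have "(\<lambda>i. (1/2::real) ^ i) sums 2" using geometric_sums[of "1/2::real"] by simp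
  then have g: "(\<lambda>i. (1/2::real) ^ i * ((1/2) ^ Suc N)) sums (2 * (1/2) ^ Suc N)"
    by (rule sums_mult2)
  have "(\<Sum>i. ?f (i + N)) \<le> (\<Sum>i. (1/2::real) ^ i * ((1/2) ^ Suc N))"
    by (rule suminf_le[OF _ sf sums_summable[OF g]]) (auto simp: power_add)
  also have "\<dots> = (1/2) ^ N" using sums_unique[OF g] by simp
  finally show "pos x \<le> head N x + (1/2) ^ N" using s by simp
qed

lemma head_Suc: "x \<in> \<Omega> \<Longrightarrow> head (Suc N) x = head N x + (if N \<in> S x then (1/2) ^ Suc N else 0)"
  by (simp add: head_def)

lemma head_int: "\<exists>k::int. head N x = of_int k * (1/2) ^ N"
proof (induction N)
  case (Suc N)
  then obtain k where k: "head N x = of_int k * (1/2) ^ N" by blast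
  have "head (Suc N) x = of_int (2 * k + (if x \<in> {x \<in> \<Omega>. N \<in> S x} then 1 else 0)) * (1/2) ^ Suc N"
    using k by (simp add: head_def field_simps)
  then show ?case by blast
qed (simp add: head_def)

text \<open>Scaled by \<open>2 ^ N\<close>, \<open>head N\<close> is an integer whose binary digits
  are those of the point, and parity recovers the last one.\<close>

lemma head_inj:
  assumes "x \<in> \<Omega>" "y \<in> \<Omega>" "head N x = head N y"
  shows "S x \<inter> {..<N} = S y \<inter> {..<N}"
  using assms(3)
proof (induction N)
  case (Suc N)
  obtain k l :: int where k: "head N x = of_int k * (1/2) ^ N" and l: "head N y = of_int l * (1/2) ^ N"
    using head_int by metis
  define a :: int where "a = (if N \<in> S x then 1 else 0)"
  define b :: int where "b = (if N \<in> S y then 1 else 0)"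
  have "head (Suc N) x = (2 * of_int k + of_int a) * (1/2) ^ Suc N"
    "head (Suc N) y = (2 * of_int l + of_int b) * (1/2) ^ Suc N"
    using head_Suc[OF assms(1)] head_Suc[OF assms(2)] k l by (simp_all add: a_def b_def field_simps)
  then have "of_int (2 * k + a) = (of_int (2 * l + b) :: real)" using Suc.prems by simp
  then have e: "2 * k + a = 2 * l + b" by linarith
  have "a = 0 \<or> a = 1" "b = 0 \<or> b = 1" by (auto simp: a_def b_def)
  then have "a = b" "k = l" using e by presburger+
  then have "S x \<inter> {..<N} = S y \<inter> {..<N}" "N \<in> S x \<longleftrightarrow> N \<in> S y"
    using Suc.IH k l by (auto simp: a_def b_def split: if_splits)
  then show ?case by (auto simp: lessThan_Suc)
qed simp

text \<open>Scaled heads of points in a short interval are integers differing by at most 1, so the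
  interval lies in two cylinders of length \<open>N\<close>. Each part has image in
  \<open>V 6\<close>, and \<open>U\<close> contains the products of two such elements.\<close>

lemma small_intervals:
  assumes H: "topological_group H T" "separable_space T" and U: "openin T U" "\<one> \<in> U"
    and B: "B \<in> sets M" "B \<subseteq> X3"
  shows "\<exists>e>0. \<forall>s t. t - s < e \<longrightarrow> \<pi> (flip2 {x \<in> B. s \<le> pos x \<and> pos x < t}) \<in> U"
proof -
  obtain V where V: "chain V" "covering (V 0)" and VU: "\<forall>a\<in>V 6. \<forall>b\<in>V 6. a \<otimes> b \<in> U"
    using chain_exists[OF H U] by (elim exE conjE)
  obtain N where N0: "\<forall>B \<sigma>. B \<in> sets M \<longrightarrow> B \<subseteq> X3 \<longrightarrow> (\<forall>x\<in>B. S x \<inter> {..<N} = \<sigma>) \<longrightarrow> \<pi> (flip2 B) \<in> V 6"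
    using small_cylinders[OF V(2,1)] by (elim exE)
  note N = N0[THEN spec, THEN spec, THEN mp, THEN mp, THEN mp]
  have BO: "x \<in> \<Omega>" if "x \<in> B" for x using that B(2) by (auto simp: X3_def)
  have "\<pi> (flip2 {x \<in> B. s \<le> pos x \<and> pos x < t}) \<in> U" if st: "t - s < (1/2) ^ N" for s t
  proof -
    let ?D = "{x \<in> B. s \<le> pos x \<and> pos x < t}"
    have Ds: "?D \<in> sets M"
    proof -
      have "?D = B \<inter> {x \<in> space M. s \<le> pos x} \<inter> {x \<in> space M. pos x < t}"
        using sets.sets_into_space[OF B(1)] by auto
      moreover have "{x \<in> space M. s \<le> pos x} \<in> sets M" "{x \<in> space M. pos x < t} \<in> sets M"
        using pos_measurable by simp_all
      ultimately show ?thesis using B(1) by simp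
    qed
    show ?thesis
    proof (cases "?D = {}")
      case True
      then have "\<pi> (flip2 ?D) = \<one>" by (simp only: flip2_empty pi_id)
      then show ?thesis using U(2) by simp
    next
      case False
      obtain h :: "'a \<Rightarrow> int" where h: "\<And>x. head N x = of_int (h x) * (1/2) ^ N" using head_int by metis
      \<comment> \<open>Strictness comes from \<open>t - s\<close> being less than
        \<open>(1/2) ^ N\<close>; hence the end point \<open>pos x = head N x + (1/2) ^ N\<close>
        does no harm.\<close>
      have close: "h x \<le> h y + 1" if "x \<in> ?D" "y \<in> ?D" for x y
      proof -
        have "head N x < head N y + (1/2) ^ N + (1/2) ^ N"
          using pos_head(1)[of N x] pos_head(2)[of y N] that st by simp
        then have "of_int (h x) * (1/2) ^ N < of_int (h y + 2) * (1/2::real) ^ N"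
          unfolding h by (simp add: algebra_simps)
        then have "of_int (h x) < (of_int (h y + 2) :: real)" by (rule mult_right_less_imp_less) simp
        then show ?thesis by linarith
      qed
      \<comment> \<open>No minimum over an infinite set is needed: a value below that of some
        \<open>y\<close> is already least, as \<open>y\<close> is within 1 of all values.\<close>
      obtain z where z: "z \<in> ?D" and zmin: "\<And>x. x \<in> ?D \<Longrightarrow> h z \<le> h x"
      proof -
        obtain y where y: "y \<in> ?D" using False by blast
        show ?thesis
        proof (cases "\<exists>x\<in>?D. h x < h y")
          case True
          then obtain x where x: "x \<in> ?D" "h x < h y" by blast
          have "h x \<le> h x'" if "x' \<in> ?D" for x' using close[OF y that] x(2) by linarith
          then show ?thesis by (rule that[OF x(1)])
        next
          case F: False
          then show ?thesis using that[of y] y by force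
        qed
      qed
      let ?D1 = "{x \<in> ?D. S x \<inter> {..<N} = S z \<inter> {..<N}}"
      let ?D2 = "?D - ?D1"
      have D1: "?D1 \<in> sets M"
      proof -
        have "?D1 = ?D \<inter> {x \<in> \<Omega>. S x \<inter> {..<N} = S z \<inter> {..<N}}" using BO by blast
        then show ?thesis using Ds S_sets[of "\<lambda>\<tau>. \<tau> = S z \<inter> {..<N}" N] by simp
      qed
      have D2: "?D2 \<in> sets M" using Ds D1 by blast
      have h2: "h x = h z + 1" if "x \<in> ?D2" for x
      proof -
        have x: "x \<in> ?D" using that by blast
        have "h x \<noteq> h z"
        proof
          assume "h x = h z"
          then have "head N x = head N z" by (simp add: h)
          then have "S x \<inter> {..<N} = S z \<inter> {..<N}" using head_inj BO x z by blast
          then show False using that x by blast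
        qed
        then show ?thesis using close[OF x z] zmin[OF x] by linarith
      qed
      have X: "?D1 \<subseteq> X3" "?D2 \<subseteq> X3" "?D1 \<inter> ?D2 = {}" using B(2) by blast+
      have p1: "\<pi> (flip2 ?D1) \<in> V 6" by (rule N[OF D1 X(1), of "S z \<inter> {..<N}"]) simp
      have p2: "\<pi> (flip2 ?D2) \<in> V 6"
      proof (cases "?D2 = {}")
        case True
        then show ?thesis using flip2_empty pi_id chain_one[OF V(1)] by metis
      next
        case False
        then obtain y where y: "y \<in> ?D2" by blast
        have "S x \<inter> {..<N} = S y \<inter> {..<N}" if x: "x \<in> ?D2" for x
          by (rule head_inj) (use x y BO h h2[OF x] h2[OF y] in auto)
        then show ?thesis by (intro N[OF D2 X(2), of "S y \<inter> {..<N}"] ballI)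
      qed
      have "?D1 \<union> ?D2 = ?D" by blast
      then have "\<pi> (flip2 ?D) = \<pi> (flip2 ?D1 \<circ> flip2 ?D2)" using flip2_comp[OF X] by simp
      also have "\<dots> = \<pi> (flip2 ?D1) \<otimes> \<pi> (flip2 ?D2)" by (rule pi_comp[OF flip2_FG[OF D1] flip2_FG[OF D2]])
      finally show ?thesis using bspec[OF bspec[OF VU p1] p2] by simp
    qed
  qed
  then show ?thesis by (intro exI[of _ "(1/2) ^ N"]) auto
qed

text \<open>The path flips the part of \<open>B\<close> with position below \<open>s\<close>. Its
  increments are flips over short intervals, so it is continuous, and its range is a connected set
  containing the identity and the image of \<open>flip2 B\<close>.\<close>

lemma pi_flip2_trivial:
  assumes H: "topological_group H T" "totally_disconnected T" "separable_space T"
    and B: "B \<in> sets M" "B \<subseteq> X3"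
  shows "\<pi> (flip2 B) = \<one>"
proof -
  have t: "topspace T = carrier H" using H(1) by (simp add: topological_group_def)
  define L where "L s = {x \<in> B. pos x < s}" for s
  define D where "D s r = {x \<in> B. s \<le> pos x \<and> pos x < r}" for s r
  have m: "{x \<in> space M. s \<le> pos x} \<in> sets M" "{x \<in> space M. pos x < s} \<in> sets M" for s
    using pos_measurable by simp_all
  have Ls: "L s \<in> sets M" for s
  proof -
    have "L s = B \<inter> {x \<in> space M. pos x < s}" using sets.sets_into_space[OF B(1)] by (auto simp: L_def)
    then show ?thesis using B(1) m by simp
  qed
  have Ds: "D s r \<in> sets M" for s r
  proof -
    have "D s r = L r \<inter> {x \<in> space M. s \<le> pos x}" using sets.sets_into_space[OF B(1)] by (auto simp: L_def D_def)
    then show ?thesis using Ls m by simp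
  qed
  define \<gamma> where "\<gamma> s = \<pi> (flip2 (L s))" for s
  have gc: "\<gamma> s \<in> carrier H" for s unfolding \<gamma>_def by (rule pi_closed[OF flip2_FG[OF Ls]])
  have g: "\<gamma> r = \<gamma> s \<otimes> \<pi> (flip2 (D s r))" if "s \<le> r" for s r
  proof -
    have "L s \<inter> D s r = {}" "L s \<union> D s r = L r" using that by (auto simp: L_def D_def)
    moreover have "L s \<subseteq> X3" "D s r \<subseteq> X3" using B(2) by (auto simp: L_def D_def)
    ultimately have "flip2 (L r) = flip2 (L s) \<circ> flip2 (D s r)" using flip2_comp by metis
    then show ?thesis unfolding \<gamma>_def using pi_comp[OF flip2_FG[OF Ls] flip2_FG[OF Ds]] by simp
  qed
  \<comment> \<open>Increments are involutions, so the same factor describes moving the parameter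
    forwards and backwards.\<close>
  have sq: "\<pi> (flip2 (D s r)) \<otimes> \<pi> (flip2 (D s r)) = \<one>" for s r
  proof (rule pi_involution_sq[OF flip2_FG[OF Ds]])
    have "D s r \<subseteq> X3" using B(2) by (auto simp: D_def)
    then show "flip2 (D s r) \<circ> flip2 (D s r) = id" unfolding flip2_def by (rule flip_invol[OF flip2_dom])
  qed
  have g': "\<gamma> s = \<gamma> r \<otimes> \<pi> (flip2 (D s r))" if "s \<le> r" for s r
    using g[OF that] sq[of s r] gc[of s] pi_closed[OF flip2_FG[OF Ds]] by (simp add: H.m_assoc)
  have cont: "continuous_map euclideanreal T \<gamma>"
    unfolding continuous_map_def
  proof (intro conjI allI impI)
    show "\<gamma> \<in> topspace euclideanreal \<rightarrow> topspace T" using gc t by simp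
    fix O' assume O': "openin T O'"
    have "\<exists>e>0. ball s e \<subseteq> {x. \<gamma> x \<in> O'}" if s: "\<gamma> s \<in> O'" for s
    proof -
      let ?U = "{h \<in> carrier H. \<gamma> s \<otimes> h \<in> O'}"
      have "openin T ?U" by (rule topological_group_left_mult_open[OF H(1) gc O'])
      moreover have "\<one> \<in> ?U" using s gc by simp
      ultimately have "\<exists>e>0. \<forall>a b. b - a < e \<longrightarrow> \<pi> (flip2 (D a b)) \<in> ?U"
        unfolding D_def by (rule small_intervals[OF H(1,3) _ _ B])
      then obtain e where e0: "e > 0" and e1: "\<forall>a b. b - a < e \<longrightarrow> \<pi> (flip2 (D a b)) \<in> ?U"
        by (elim exE conjE)
      note e = e0 e1[THEN spec, THEN spec, THEN mp]
      have "\<gamma> r \<in> O'" if "r \<in> ball s e" for r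
      proof (cases "s \<le> r")
        case True
        then have "\<pi> (flip2 (D s r)) \<in> ?U" using that by (intro e(2)) (simp add: dist_real_def)
        then show ?thesis using g[OF True] by simp
      next
        case False
        then have "\<pi> (flip2 (D r s)) \<in> ?U" using that by (intro e(2)) (simp add: dist_real_def)
        then show ?thesis using g'[of r s] False by simp
      qed
      then show ?thesis using e(1) by blast
    qed
    then have "open {x. \<gamma> x \<in> O'}" unfolding open_contains_ball by blast
    then show "openin euclideanreal {x \<in> topspace euclideanreal. \<gamma> x \<in> O'}" by simp
  qed
  have "connectedin euclideanreal (UNIV :: real set)" by simp
  then have c: "connectedin T (range \<gamma>)" by (rule connectedin_continuous_map_image[OF cont])
  have "0 \<le> pos x" for x using pos_head(1)[of 0 x] by (simp add: head_def)
  then have L0: "L 0 = {}" by (auto simp: L_def not_less)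
  have g0: "\<gamma> 0 = \<one>" unfolding \<gamma>_def L0 flip2_empty by (rule pi_id)
  \<comment> \<open>Positions lie in the closed unit interval, so the strict inequality with any
    parameter above 1 already captures everything.\<close>
  have "L 2 = B"
  proof -
    have "pos x < 2" for x using pos_head(2)[of x 0] by (simp add: head_def)
    then show ?thesis by (auto simp: L_def)
  qed
  then have g2: "\<gamma> 2 = \<pi> (flip2 B)" by (simp add: \<gamma>_def)
  have r: "\<one> \<in> range \<gamma>" "\<pi> (flip2 B) \<in> range \<gamma>" using rangeI[of \<gamma> 0] rangeI[of \<gamma> 2] unfolding g0 g2 .
  have "connected_component_of T \<one> (\<pi> (flip2 B))"
    unfolding connected_component_of_def by (intro exI[of _ "range \<gamma>"] conjI c r)
  then have "\<pi> (flip2 B) \<in> connected_component_of_set T \<one>" by (rule CollectI)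
  moreover have "\<one> \<in> topspace T" unfolding t by (rule H.one_closed)
  then have "connected_component_of_set T \<one> = {\<one>}" by (rule bspec[OF H(2)[unfolded totally_disconnected_def]])
  ultimately show ?thesis by simp
qed

end

section \<open>Reduction of involutions to the dyadic ones\<close>

lemma swap_union:
  assumes T: "T \<circ> T = id" and d: "(P \<union> Q) \<inter> T ` (P \<union> Q) = {}" "P \<inter> Q = {}"
  shows "swap T (P \<union> Q) = swap T P \<circ> swap T Q"
proof
  fix x
  have i: "finv T = T" by (rule involution_inv[OF T])
  have im: "x \<in> T ` X \<longleftrightarrow> T x \<in> X" for x X
    using involution_app[OF T] by (auto simp: image_iff) (metis)
  have 1: "x \<in> P \<union> Q \<Longrightarrow> T x \<notin> P \<union> Q" using d(1) im by blast
  show "swap T (P \<union> Q) x = (swap T P \<circ> swap T Q) x"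
    using 1 d(2) by (auto simp: swap_def im i involution_app[OF T])
qed

context dyadic_hom begin

lemma pi_intertwine_one':
  assumes "D \<in> FG" "R \<in> FG" "T \<in> FG" "D \<circ> R = T \<circ> D" "\<pi> T = \<one>"
  shows "\<pi> R = \<one>"
proof -
  have "\<pi> D \<otimes> \<pi> R = \<pi> T \<otimes> \<pi> D" using assms(1-4) pi_comp by metis
  then show ?thesis using assms(1,2,5) pi_closed by simp
qed

lemma flip_null:
  assumes "E \<in> sets M" "Z \<in> null_sets M"
  shows "\<pi> (flip E) = \<pi> (flip (E - Z))"
proof (rule pi_AE)
  have EZ: "E - Z \<in> sets M" using assms by auto
  show "flip E \<in> FG" "flip (E - Z) \<in> FG" by (rule flip_FG[OF assms(1)], rule flip_FG[OF EZ])
  have tF: "\<theta> \<in> FG" by (rule u_FG) simp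
  have 1: "AE x in M. x \<notin> Z" by (rule AE_not_in[OF assms(2)])
  have 2: "AE x in M. \<theta> x \<notin> Z" by (rule FG_AE[OF tF 1])
  show "AE x in M. flip E x = flip (E - Z) x"
    using 1 2 by eventually_elim (simp add: flip_app)
qed

text \<open>\<open>D\<close> is, up to a null set, one half together with its image under an orbit
  involution. Moving the second half onto the \<open>\<kappa>\<close>-copy of the first, compatibly
  with \<open>\<theta>\<close>, conjugates the flip into a doubled one.\<close>

lemma pi_flip_trivial:
  assumes inf: "AE x in M. infinite {y. rel x y}"
    and flip2: "\<And>B. B \<in> sets M \<Longrightarrow> B \<subseteq> X3 \<Longrightarrow> \<pi> (flip2 B) = \<one>"
    and D: "D \<in> sets M" "D \<subseteq> X3"
  shows "\<pi> (flip D) = \<one>"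
proof -
  obtain Q v where Q: "Q \<in> sets M" "Q \<subseteq> D" and v: "v \<in> FG" "v \<circ> v = id" "supported v D"
    and Qd: "Q \<inter> v ` Q = {}" and Z: "D - (Q \<union> v ` Q) \<in> null_sets M"
    using halving[OF D(1) inf] by (elim exE conjE)
  have tF: "\<theta> \<in> FG" and kF: "\<kappa> \<in> FG" by (rule u_FG, simp)+
  have tt: "\<theta> (\<theta> x) = x" for x by (rule u_u_same) simp
  have vv: "v (v x) = x" for x by (rule involution_app[OF v(2)])
  have vD: "v x \<in> D \<longleftrightarrow> x \<in> D" for x by (rule supported_mem[OF FG_bij[OF v(1)] v(3)])
  have vo: "v x = x" if "x \<notin> D" for x by (rule supportedD[OF v(3) that])
  have vQ: "v ` Q \<subseteq> D" using vD Q(2) by blast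
  have DX: "x \<in> X0" if "x \<in> D" for x using that D(2) by (auto simp: X3_def X0_def)
  have tD: "\<theta> x \<notin> D" if "x \<in> D" for x using theta_X0 DX that by blast
  have kD: "\<kappa> x \<notin> D" if "x \<in> D" for x
  proof -
    have "1 \<in> S (\<kappa> x)" using that D(2) S_kappa1[of x] by (auto simp: X3_def)
    then show ?thesis using D(2) by (auto simp: X3_def)
  qed
  have tkD: "\<theta> (\<kappa> x) \<notin> D" if "x \<in> D" for x
  proof -
    have x: "x \<in> \<Omega>" "1 \<notin> S x" using that D(2) by (auto simp: X3_def)
    then have "1 \<in> S (\<theta> (\<kappa> x))" using S_theta[of "\<kappa> x" 1] kappa_Om S_kappa1[of x] by simp
    then show ?thesis using D(2) by (auto simp: X3_def)
  qed
  \<comment> \<open>The matching is repeated on the \<open>\<theta>\<close>-image of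
    \<open>D\<close> so that it commutes with \<open>\<theta>\<close>.\<close>
  define v' where "v' = v \<circ> (\<theta> \<circ> v \<circ> \<theta>)"
  have v'F: "v' \<in> FG" unfolding v'_def by (intro FG_comp v(1) tF)
  have v'D: "v' x = v x" if "x \<in> D" for x using that tD vo tt by (simp add: v'_def)
  have v't: "v' (\<theta> x) = \<theta> (v' x)" for x
  proof -
    consider "x \<in> D" | "\<theta> x \<in> D" | "x \<notin> D" "\<theta> x \<notin> D" by blast
    then show ?thesis
    proof cases
      case 1
      then have "v x \<in> D" "\<theta> x \<notin> D" "\<theta> (v x) \<notin> D" using vD tD by blast+
      then show ?thesis using vo tt by (simp add: v'_def)
    next
      case 2
      then have "v (\<theta> x) \<in> D" "x \<notin> D" "\<theta> (v (\<theta> x)) \<notin> D" using vD tD[of "\<theta> x"] tD[of "v (\<theta> x)"] tt by auto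
      then show ?thesis using vo tt by (simp add: v'_def)
    next
      case 3
      then show ?thesis using vo tt by (simp add: v'_def)
    qed
  qed
  define h where "h = \<kappa> \<circ> v'"
  have hF: "h \<in> FG" unfolding h_def by (rule FG_comp[OF kF v'F])
  have ht: "h (\<theta> x) = \<theta> (h x)" for x using u_commute[of "{1}" "{0}"] v't by (simp add: h_def)
  have hv: "h (v q) = \<kappa> q" if "q \<in> Q" for q
    using v'D[of "v q"] vQ that vv by (auto simp: h_def)
  define P where "P = v ` Q \<union> \<theta> ` v ` Q"
  have Ps: "P \<in> sets M" unfolding P_def using FG_image[OF v(1) Q(1)] FG_image[OF tF] by blast
  have hP: "h ` P = \<kappa> ` Q \<union> \<theta> ` \<kappa> ` Q"
  proof -
    have "h ` v ` Q = \<kappa> ` Q" unfolding image_image by (rule image_cong[OF refl hv])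
    moreover have "h ` \<theta> ` v ` Q = \<theta> ` h ` v ` Q" unfolding image_image by (simp only: ht)
    ultimately show ?thesis unfolding P_def image_Un by (simp only:)
  qed
  have Pm: "x \<in> P \<longleftrightarrow> x \<in> v ` Q \<or> \<theta> x \<in> v ` Q" for x by (simp only: P_def Un_iff theta_image)
  have hPm: "x \<in> h ` P \<longleftrightarrow> \<kappa> x \<in> Q \<or> \<kappa> (\<theta> x) \<in> Q" for x by (simp only: hP Un_iff theta_image kappa_image)
  have comm: "\<kappa> (\<theta> x) = \<theta> (\<kappa> x)" for x by (rule u_commute) simp_all
  have Pd: "P \<inter> h ` P = {}"
  proof -
    have "x \<notin> h ` P" if "x \<in> v ` Q" for x
      unfolding hPm comm using that vQ Q(2) kD tkD by blast
    moreover have "x \<notin> h ` P" if "\<theta> x \<in> v ` Q" for x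
    proof -
      have "\<theta> x \<in> D" using that vQ by blast
      then have "\<kappa> (\<theta> x) \<notin> D" "\<theta> (\<kappa> (\<theta> x)) \<notin> D" using kD tkD by blast+
      moreover have "\<theta> (\<kappa> (\<theta> x)) = \<kappa> x" using comm[of "\<theta> x"] tt by simp
      ultimately show ?thesis unfolding hPm using Q(2) by auto
    qed
    ultimately show ?thesis using Pm by blast
  qed
  define t where "t = swap h P"
  have tFG: "t \<in> FG" unfolding t_def by (rule FG_swap[OF hF Ps Pd])
  have Pt: "\<theta> x \<in> P" if "x \<in> P" for x using that tt by (auto simp: Pm)
  have tc: "t (\<theta> x) = \<theta> (t x)" for x unfolding t_def by (rule swap_commute[OF FG_bij[OF hF] ht Pt])
  have tQ: "t q = q" if "q \<in> Q" for q
  proof -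
    have qD: "q \<in> D" using that Q(2) by blast
    have "q \<notin> P" unfolding Pm using that Qd tD[OF qD] vQ by blast
    moreover have "q \<notin> h ` P" unfolding hPm comm using kD[OF qD] tkD[OF qD] Q(2) by blast
    ultimately show ?thesis unfolding t_def by (rule swap_out)
  qed
  have tvQ: "t (v q) = \<kappa> q" if "q \<in> Q" for q
    unfolding t_def using that hv Pm by (subst swap_in) auto
  have tD': "t ` (Q \<union> v ` Q) = Q \<union> \<kappa> ` Q"
  proof -
    have "t ` Q = Q" using tQ by simp
    moreover have "t ` v ` Q = \<kappa> ` Q" unfolding image_image by (rule image_cong[OF refl tvQ])
    ultimately show ?thesis by (simp only: image_Un)
  qed
  have D's: "Q \<union> v ` Q \<in> sets M" using Q(1) FG_image[OF v(1) Q(1)] by blast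
  have "t \<circ> flip (Q \<union> v ` Q) = flip2 Q \<circ> t"
    using flip_conj[OF tc FG_bij[OF tFG], of "Q \<union> v ` Q"] unfolding tD' flip2_def .
  then have "\<pi> (flip (Q \<union> v ` Q)) = \<one>"
    using Q D(2) by (intro pi_intertwine_one'[OF tFG flip_FG[OF D's] flip2_FG[OF Q(1)]] flip2) auto
  moreover have "D - (D - (Q \<union> v ` Q)) = Q \<union> v ` Q" using Q(2) vQ by blast
  ultimately show ?thesis using flip_null[OF D(1) Z] by simp
qed

text \<open>\<open>P\<close> and its image under \<open>T\<close> are moved to a cylinder part of
  \<open>X3\<close> and to its \<open>\<theta>\<close>-image; this conjugates the exchange into a
  flip. Fixed windows of five digits leave room for a destination that avoids both original
  sets.\<close>

lemma pi_piece_trivial: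
  assumes flip: "\<And>D. D \<in> sets M \<Longrightarrow> D \<subseteq> X3 \<Longrightarrow> \<pi> (flip D) = \<one>"
    and T: "T \<in> FG" "T \<circ> T = id" and P: "P \<in> sets M" "P \<subseteq> \<Omega>" "P \<inter> T ` P = {}"
    and win: "\<And>x. x \<in> P \<Longrightarrow> S x \<inter> {..<5} = \<rho>" "\<And>x. x \<in> P \<Longrightarrow> S (T x) \<inter> {..<5} = \<rho>'"
  shows "\<pi> (swap T P) = \<one>"
proof -
  \<comment> \<open>Three candidate patterns against two forbidden ones.\<close>
  have "\<exists>c. c \<subseteq> {3,4::nat} \<and> c \<noteq> \<rho> \<inter> {3,4} \<and> c \<noteq> \<rho>' \<inter> {3,4}"
  proof -
    have "{} \<noteq> {3::nat}" "{} \<noteq> {4::nat}" "{3::nat} \<noteq> {4}" by auto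
    then consider "{} \<noteq> \<rho> \<inter> {3,4}" "{} \<noteq> \<rho>' \<inter> {3,4}" | "{3} \<noteq> \<rho> \<inter> {3,4}" "{3} \<noteq> \<rho>' \<inter> {3,4}"
      | "{4} \<noteq> \<rho> \<inter> {3,4}" "{4} \<noteq> \<rho>' \<inter> {3,4}" by metis
    then show ?thesis by cases blast+
  qed
  then obtain c where c: "c \<subseteq> {3,4}" "c \<noteq> \<rho> \<inter> {3,4}" "c \<noteq> \<rho>' \<inter> {3,4}" by blast
  define F where "F = sym_diff (\<rho> \<inter> {..<5}) c"
  have "F \<subseteq> {..<5}" unfolding F_def using c(1) by auto
  have Ff: "finite F" by (rule finite_subset[OF \<open>F \<subseteq> {..<5}\<close>]) simp
  define l where "l = u F"
  have lF: "l \<in> FG" unfolding l_def by (rule u_FG[OF Ff])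
  have tF: "\<theta> \<in> FG" by (rule u_FG) simp
  have tt: "\<theta> (\<theta> x) = x" for x by (rule u_u_same) simp
  have TT: "T (T x) = x" for x by (rule involution_app[OF T(2)])
  have Sl: "S (l x) \<inter> {..<5} = c" "l x \<in> \<Omega>" if "x \<in> P" for x
  proof -
    have x: "x \<in> \<Omega>" using that P(2) by blast
    have "S (l x) = sym_diff (S x) F" unfolding l_def by (rule S_u[OF Ff x])
    then have "S (l x) \<inter> {..<5} = sym_diff (S x \<inter> {..<5}) F" using \<open>F \<subseteq> {..<5}\<close> by auto
    also have "\<dots> = c" unfolding F_def using win(1)[OF that] c(1) by auto
    finally show "S (l x) \<inter> {..<5} = c" .
    show "l x \<in> \<Omega>" unfolding l_def using u_Om[OF Ff] x by blast
  qed
  have sub: "X \<inter> {3,4} = (X \<inter> {..<5}) \<inter> {3,4}" for X :: "nat set" by auto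
  have w1: "S x \<inter> {3,4} \<noteq> c" if "x \<in> P" for x using win(1)[OF that] c sub[of "S x"] by auto
  have w2: "S (T x) \<inter> {3,4} \<noteq> c" if "x \<in> P" for x using win(2)[OF that] c sub[of "S (T x)"] by auto
  have w3: "S (l x) \<inter> {3,4} = c" if "x \<in> P" for x using Sl[OF that] c(1) sub[of "S (l x)"] by auto
  have w4: "S (\<theta> (l x)) \<inter> {3,4} = c" if "x \<in> P" for x
  proof -
    have "S (\<theta> (l x)) \<inter> {3,4} = S (l x) \<inter> {3,4}" using S_theta[OF Sl(2)[OF that]] by auto
    then show ?thesis using w3[OF that] by simp
  qed
  have lX: "l ` P \<subseteq> X3"
  proof
    fix y assume "y \<in> l ` P"
    then obtain x where x: "x \<in> P" "y = l x" by blast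
    have "i \<notin> S (l x)" if "i < 3" for i :: nat
    proof
      assume "i \<in> S (l x)"
      then have "i \<in> c" using Sl(1)[OF x(1)] that by auto
      then show False using c(1) that by auto
    qed
    from this[of 0] this[of 1] this[of 2] show "y \<in> X3" using Sl(2)[OF x(1)] x(2) by (simp add: X3_def)
  qed
  have lX0: "l ` P \<subseteq> X0" using lX by (auto simp: X3_def X0_def)
  have d1: "P \<inter> l ` P = {}" using w1 w3 by blast
  have ne: "T x \<noteq> \<theta> (l y)" "x \<noteq> \<theta> (l y)" "T x \<noteq> l y" if "x \<in> P" "y \<in> P" for x y
    using w1[OF that(1)] w2[OF that(1)] w3[OF that(2)] w4[OF that(2)] by metis+
  \<comment> \<open>On the image of \<open>P\<close> under \<open>T\<close>, first return to
    \<open>P\<close>, then follow \<open>l\<close> and \<open>\<theta>\<close>.\<close>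
  define g where "g = \<theta> \<circ> l \<circ> T"
  have gF: "g \<in> FG" unfolding g_def by (intro FG_comp tF lF T(1))
  have gT: "g ` T ` P = \<theta> ` l ` P" by (simp add: g_def image_image TT)
  have TPs: "T ` P \<in> sets M" by (rule FG_image[OF T(1) P(1)])
  have d2: "T ` P \<inter> g ` T ` P = {}" unfolding gT using ne(1) by auto
  have d3: "P \<inter> \<theta> ` l ` P = {}" "T ` P \<inter> l ` P = {}"  proof -
    have "x \<notin> \<theta> ` l ` P" if "x \<in> P" for x
    proof
      assume "x \<in> \<theta> ` l ` P"
      then obtain y where "y \<in> P" "x = \<theta> (l y)" by (elim imageE) simp
      then show False using ne(2)[OF that] by blast
    qed
    then show "P \<inter> \<theta> ` l ` P = {}" by blast
    have "T x \<notin> l ` P" if "x \<in> P" for x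
    proof
      assume "T x \<in> l ` P"
      then obtain y where "y \<in> P" "T x = l y" by (elim imageE) simp
      then show False using ne(3)[OF that] by blast
    qed
    then show "T ` P \<inter> l ` P = {}" by blast
  qed
  have d4: "l ` P \<inter> \<theta> ` l ` P = {}"
  proof -
    have "\<theta> y \<notin> l ` P" if "y \<in> l ` P" for y using lX0 theta_X0[of y] that by (metis subsetD)
    then show ?thesis by (metis disjoint_iff imageE)
  qed
  define a1 where "a1 = swap l P"
  define a2 where "a2 = swap g (T ` P)"
  define a where "a = a1 \<circ> a2"
  have a1F: "a1 \<in> FG" unfolding a1_def by (rule FG_swap[OF lF P(1) d1])
  have a2F: "a2 \<in> FG" unfolding a2_def by (rule FG_swap[OF gF TPs d2])
  have aF: "a \<in> FG" unfolding a_def by (rule FG_comp[OF a1F a2F])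
  have aP: "a x = l x" if x: "x \<in> P" for x
  proof -
    have "a2 x = x" unfolding a2_def gT[symmetric]
      by (rule swap_out) (use x P(3) d3(1) gT in blast)+
    then show ?thesis using x by (simp add: a_def a1_def swap_in)
  qed
  have aT: "a (T x) = \<theta> (l x)" if x: "x \<in> P" for x
  proof -
    have "a2 (T x) = g (T x)" unfolding a2_def using x by (intro swap_in) blast
    also have "\<dots> = \<theta> (l x)" by (simp add: g_def TT)
    finally have "a2 (T x) = \<theta> (l x)" .
    moreover have "a1 (\<theta> (l x)) = \<theta> (l x)" unfolding a1_def
      by (rule swap_out) (use x d3(1) d4 in blast)+
    ultimately show ?thesis by (simp add: a_def)
  qed
  have ainj: "a x = a y \<Longrightarrow> x = y" for x y using FG_bij[OF aF] by (simp add: bij_is_inj inj_eq)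
  have sT: "swap T P \<in> FG" by (rule FG_swap[OF T(1) P(1,3)])
  have lPs: "l ` P \<in> sets M" by (rule FG_image[OF lF P(1)])
  have "a \<circ> swap T P = flip (l ` P) \<circ> a"
  proof
    fix x
    consider "x \<in> P" | p where "p \<in> P" "x = T p" | "x \<notin> P" "x \<notin> T ` P" by blast
    then show "(a \<circ> swap T P) x = (flip (l ` P) \<circ> a) x"
    proof cases
      case 1
      then have "l x \<in> l ` P" by blast
      then show ?thesis using 1 by (simp add: swap_in aP aT flip_app)
    next
      case 2
      have "l p \<in> l ` P" using 2 by blast
      then have "\<theta> (\<theta> (l p)) \<in> l ` P" unfolding tt .
      moreover have "swap T P (T p) = p" by (rule swap_in'[OF FG_bij[OF T(1)] P(3) 2(1)])
      ultimately show ?thesis using 2 by (simp add: aP aT flip_app tt)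
    next
      case 3
      have "a x \<notin> l ` P"
      proof
        assume "a x \<in> l ` P"
        then obtain p where "p \<in> P" "a x = a p" using aP by auto
        then show False using ainj 3 by blast
      qed
      moreover have "\<theta> (a x) \<notin> l ` P"
      proof
        assume "\<theta> (a x) \<in> l ` P"
        then obtain p where p: "p \<in> P" "\<theta> (a x) = l p" by blast
        then have "a x = a (T p)" using aT[OF p(1)] tt by metis
        then show False using ainj 3 p(1) by blast
      qed
      ultimately show ?thesis using 3 by (simp add: swap_out flip_app)
    qed
  qed
  then show ?thesis by (rule pi_intertwine_one'[OF aF sT flip_FG[OF lPs] _ flip[OF lPs lX]])
qed

text \<open>A section of \<open>T\<close> splits into finitely many pieces by the first five digits
  of \<open>x\<close> and of \<open>T x\<close>, and \<open>T\<close> is almost everywhere the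
  product of the exchanges over the pieces.\<close>

lemma pi_involution_trivial:
  assumes flip: "\<And>D. D \<in> sets M \<Longrightarrow> D \<subseteq> X3 \<Longrightarrow> \<pi> (flip D) = \<one>"
    and T: "T \<in> FG" "T \<circ> T = id"
  shows "\<pi> T = \<one>"
proof -
  obtain A where A: "A \<in> sets M" "A \<inter> T ` A = {}" "\<And>x. T x \<noteq> x \<Longrightarrow> x \<in> A \<union> T ` A \<union> finv T ` A"
    using exists_section[OF T(1)] by blast
  have Ti: "finv T = T" by (rule involution_inv[OF T(2)])
  define P where "P i = A \<inter> {x \<in> \<Omega>. S x \<inter> {..<5} = fst i} \<inter> T -` {x \<in> \<Omega>. S x \<inter> {..<5} = snd i}" for i :: "nat set \<times> nat set"
  have Ps: "P i \<in> sets M" for i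
    unfolding P_def using A(1) S_sets[of "\<lambda>\<tau>. \<tau> = fst i" 5] FG_vimage[OF T(1) S_sets[of "\<lambda>\<tau>. \<tau> = snd i" 5]]
    by (intro sets.Int)
  have PA: "P i \<subseteq> A" for i by (auto simp: P_def)
  have Pd: "P i \<inter> P j = {}" if "i \<noteq> j" for i j using that by (auto simp: P_def prod_eq_iff)
  have 1: "\<pi> (swap T (P i)) = \<one>" for i
  proof (rule pi_piece_trivial[OF flip T Ps])
    show "P i \<subseteq> \<Omega>" by (auto simp: P_def)
    show "P i \<inter> T ` P i = {}" using A(2) PA by blast
    show "S x \<inter> {..<5} = fst i" "S (T x) \<inter> {..<5} = snd i" if "x \<in> P i" for x
      using that by (auto simp: P_def)
  qed
  have fin: "\<pi> (swap T (\<Union>i\<in>K. P i)) = \<one>" if "finite K" for K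
    using that
  proof (induction K rule: finite_induct)
    case empty
    have "swap T (\<Union>i\<in>{}. P i) = id" by (auto simp: swap_def)
    then show ?case by (simp only: pi_id)
  next
    case (insert i K)
    have U: "(\<Union>i\<in>K. P i) \<in> sets M" by (rule sets.finite_UN[OF insert(1) Ps])
    have UA: "P i \<union> (\<Union>i\<in>K. P i) \<subseteq> A" using PA by (intro Un_least UN_least)
    have d: "X \<inter> T ` X = {}" if "X \<subseteq> A" for X using A(2) image_mono[OF that, of T] that by blast
    have "P i \<inter> P j = {}" if "j \<in> K" for j by (rule Pd) (use that insert(2) in blast)
    then have "P i \<inter> (\<Union>i\<in>K. P i) = {}" by blast
    then have "swap T (\<Union>i\<in>insert i K. P i) = swap T (P i) \<circ> swap T (\<Union>i\<in>K. P i)"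
      using swap_union[OF T(2) d[OF UA]] by simp
    moreover have "swap T (P i) \<in> FG" by (rule FG_swap[OF T(1) Ps d[OF PA]])
    moreover have "swap T (\<Union>i\<in>K. P i) \<in> FG" by (rule FG_swap[OF T(1) U d]) (use UA in blast)
    ultimately show ?case using 1 insert.IH by (simp only: pi_comp H.l_one H.one_closed)
  qed
  let ?I = "Pow {..<5} \<times> Pow {..<5::nat}"
  let ?U = "\<Union>i\<in>?I. P i"
  have U: "?U = A \<inter> \<Omega>"
  proof
    show "?U \<subseteq> A \<inter> \<Omega>" by (auto simp: P_def)
    show "A \<inter> \<Omega> \<subseteq> ?U"
    proof
      fix x assume x: "x \<in> A \<inter> \<Omega>"
      have "x \<in> P (S x \<inter> {..<5}, S (T x) \<inter> {..<5})" using x FG_Om[OF T(1), of x] by (simp add: P_def)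
      moreover have "(S x \<inter> {..<5}, S (T x) \<inter> {..<5}) \<in> ?I" by simp
      ultimately show "x \<in> ?U" by (rule UN_I[rotated])
    qed
  qed
  have "\<pi> (swap T (A \<inter> \<Omega>)) = \<one>" using fin[of ?I] unfolding U by simp
  moreover have "\<pi> T = \<pi> (swap T (A \<inter> \<Omega>))"
  proof (rule pi_AE[OF T(1)])
    have "A \<inter> \<Omega> \<in> sets M" using A(1) Om_sets by blast
    then show "swap T (A \<inter> \<Omega>) \<in> FG"       by (rule FG_swap[OF T(1)]) (use A(2) image_mono[of "A \<inter> \<Omega>" A T] in blast)
    have "AE x in M. x \<notin> space M - \<Omega>" by (rule AE_not_in[OF Om_null])
    with AE_space show "AE x in M. T x = swap T (A \<inter> \<Omega>) x"
    proof eventually_elim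
      case (elim x)
      then have x: "x \<in> \<Omega>" "T x \<in> \<Omega>" using FG_Om[OF T(1)] by auto
      have im: "x \<in> T ` X \<longleftrightarrow> T x \<in> X" for X using involution_app[OF T(2)] by (metis image_iff)
      have "T x = x" if "x \<notin> A" "T x \<notin> A" using A(3)[of x] that unfolding Ti Un_iff im by blast
      then show ?case using x by (auto simp: swap_def Ti im)
    qed
  qed
  ultimately show ?thesis by simp
qed

theorem pi_trivial:
  assumes "AE x in M. infinite {y. rel x y}"
    and "topological_group H T" "totally_disconnected T" "separable_space T" and g: "g \<in> FG"
  shows "\<pi> g = \<one>"
proof (rule pi_trivial_if_involutions_trivial[OF _ g])
  have flip2: "\<pi> (flip2 B) = \<one>" if "B \<in> sets M" "B \<subseteq> X3" for B
    by (rule pi_flip2_trivial[OF assms(2-4) that])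
  have flip: "\<pi> (flip D) = \<one>" if "D \<in> sets M" "D \<subseteq> X3" for D
    by (rule pi_flip_trivial[OF assms(1) flip2 that])
  show "\<pi> R = \<one>" if "R \<in> FG" "R \<circ> R = id" for R
    by (rule pi_involution_trivial[OF flip that])
qed

end

section \<open>Classes modulo null sets\<close>

text \<open>Balls of radius \<open>1/(n+1)\<close> about a countable dense set; a ball of radius
  below half the distance cannot contain both points.\<close>

lemma standard_borel_separating:
  assumes "standard_borel_measure M"
  shows "\<exists>sep::nat \<Rightarrow> 'a set. (\<forall>k. sep k \<in> sets M) \<and>
    (\<forall>x\<in>space M. \<forall>y\<in>space M. x \<noteq> y \<longrightarrow> (\<exists>k. x \<in> sep k \<and> y \<notin> sep k))"
proof -
  obtain T where T: "topspace T = space M" "completely_metrizable_space T" "separable_space T"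
    "sets M = sigma_sets (space M) {U. openin T U}"
    using assms unfolding standard_borel_measure_def by blast
  obtain X d where X: "Metric_space X d" "T = Metric_space.mtopology X d"
    using completely_metrizable_imp_metrizable_space[OF T(2)] unfolding metrizable_space_def by blast
  interpret Metric_space X d by (rule X(1))
  have XM: "X = space M" using T(1) X(2) by simp
  obtain C where C: "countable C" "C \<subseteq> X" "mtopology closure_of C = X"
    using T(3) unfolding separable_space_def X(2) by auto
  define sep where "sep j = mball (from_nat_into C (fst (prod_decode j))) (inverse (real (Suc (snd (prod_decode j)))))" for j
  have s: "sep k \<in> sets M" for k
  proof -
    have "openin T (sep k)" unfolding X(2) sep_def by simp
    then show ?thesis unfolding T(4) by (intro sigma_sets.Basic) simp
  qed
  have e: "\<exists>k. x \<in> sep k \<and> y \<notin> sep k" if xy: "x \<in> X" "y \<in> X" "x \<noteq> y" for x y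
  proof -
    have "0 < d x y / 2" using xy by simp
    then obtain n where n: "inverse (real (Suc n)) < d x y / 2" using reals_Archimedean by blast
    let ?e = "inverse (real (Suc n))"
    have "x \<in> mtopology closure_of C" using C(3) xy by simp
    moreover have "x \<in> mball x ?e" using xy by simp
    ultimately obtain c where c: "c \<in> C" "c \<in> mball x ?e"
      unfolding in_closure_of using openin_mball by blast
    have "c \<in> range (from_nat_into C)" using subset_range_from_nat_into[OF C(1)] c(1) by blast
    then obtain i where i: "from_nat_into C i = c" by auto
    have "x \<in> mball c ?e" using c xy by (auto simp: commute)
    moreover have "y \<notin> mball c ?e"
    proof
      assume y: "y \<in> mball c ?e"
      have "d x y \<le> d x c + d c y" using triangle[of x c y] xy y by auto
      then show False using y c n by auto
    qed
    ultimately have "x \<in> sep (prod_encode (i, n)) \<and> y \<notin> sep (prod_encode (i, n))" by (simp add: sep_def i)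
    then show ?thesis by blast
  qed
  show ?thesis using s e XM by (intro exI[of _ sep]) auto
qed

lemma pmp_action_exists:
  assumes "standard_probability_space M" "pmp_equivalence_relation M R"
  shows "\<exists>act sep. pmp_action M act sep \<and> (\<forall>x\<in>space M. \<forall>y. (x, y) \<in> R \<longleftrightarrow> (\<exists>n. y = act n x)) \<and>
    (AE x in M. \<exists>n. act n x \<noteq> x)"
proof -
  have pr: "prob_space M" and sb: "standard_borel_measure M"
    using assms(1) by (simp_all add: standard_probability_space_def)
  obtain sep :: "nat \<Rightarrow> 'a set" where sep: "\<forall>k. sep k \<in> sets M"
    "\<forall>x\<in>space M. \<forall>y\<in>space M. x \<noteq> y \<longrightarrow> (\<exists>k. x \<in> sep k \<and> y \<notin> sep k)"
    using standard_borel_separating[OF sb] by blast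
  obtain G :: "nat monoid" and \<phi> where ga: "group_action G (space M) \<phi>"
    and mp: "\<And>g. g \<in> carrier G \<Longrightarrow> \<phi> g \<in> mp_bijections M"
    and nt: "AE x in M. \<exists>g\<in>carrier G. \<phi> g x \<noteq> x"
    and R: "R = {(x, y). x \<in> space M \<and> y \<in> orbit G \<phi> x}"
    using assms(2) unfolding pmp_equivalence_relation_def by blast
  interpret ga: group_action G "space M" \<phi> by (rule ga)
  interpret G: group G using ga.group_hom by (simp add: group_hom_def)
  \<comment> \<open>Naturals outside the carrier act trivially, so the enumeration is total without
    enlarging any orbit.\<close>
  define act where "act n x = (if n \<in> carrier G \<and> x \<in> space M then \<phi> n x else x)" for n x
  have sp: "\<phi> g x \<in> space M" if "g \<in> carrier G" "x \<in> space M" for g x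
    using mp_bijection_space[OF mp] that by blast
  have inv1: "act (inv\<^bsub>G\<^esub> n) (act n x) = x" if n: "n \<in> carrier G" for n x
    using n sp[OF n] ga.orbit_sym_aux[OF n _ refl] by (auto simp: act_def)
  have inv2: "act n (act (inv\<^bsub>G\<^esub> n) x) = x" if n: "n \<in> carrier G" for n x
    using inv1[OF G.inv_closed[OF n], of x] n by simp
  have comp1: "act m \<circ> act n = act (m \<otimes>\<^bsub>G\<^esub> n)" if "m \<in> carrier G" "n \<in> carrier G" for m n
    using that sp ga.composition_rule by (auto simp: act_def fun_eq_iff)
  have triv: "act n = id" if "n \<notin> carrier G" for n using that by (auto simp: act_def)
  have one: "act \<one>\<^bsub>G\<^esub> = id"
  proof
    fix x show "act \<one>\<^bsub>G\<^esub> x = id x" using ga.id_eq_one by (auto simp: act_def fun_eq_iff restrict_def) metis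
  qed
  have invE: "\<exists>k. finv (act n) = act k \<and> act k \<circ> act n = id \<and> act n \<circ> act k = id" for n
  proof (cases "n \<in> carrier G")
    case True
    have "act (inv\<^bsub>G\<^esub> n) \<circ> act n = id" "act n \<circ> act (inv\<^bsub>G\<^esub> n) = id" using inv1[OF True] inv2[OF True] by auto
    then show ?thesis by (metis inv_unique_comp)
  next
    case False
    then show ?thesis using triv[OF False] inv_unique_comp[of id id] by (metis comp_id)
  qed
  have "pmp_action M act sep"
  proof (rule pmp_action.intro[OF pr], rule pmp_action_axioms.intro)
    show "bij (act n)" for n using invE[of n] o_bij by blast
    show "\<exists>k. finv (act n) = act k" for n using invE by blast
    show "act n x = x" if "x \<notin> space M" for n x using that by (simp add: act_def)
    show "\<exists>k. act k = id" using one by blast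
    show "sep k \<in> sets M" for k using sep(1) by blast
    show "\<exists>k. x \<in> sep k \<and> y \<notin> sep k" if "x \<in> space M" "y \<in> space M" "x \<noteq> y" for x y using sep(2) that by blast
    show "\<exists>k. act m \<circ> act n = act k" for m n
    proof (cases "m \<in> carrier G \<and> n \<in> carrier G")
      case True then show ?thesis using comp1 by blast
    next
      case False
      then have "act m \<circ> act n = act n \<or> act m \<circ> act n = act m" using triv by auto
      then show ?thesis by blast
    qed
    show "act n \<in> M \<rightarrow>\<^sub>M M" for n
    proof (cases "n \<in> carrier G")
      case True
      then have "\<phi> n \<in> M \<rightarrow>\<^sub>M M" using mp by (auto simp: mp_bijections_def)
      then show ?thesis using True by (subst measurable_cong[where g="\<phi> n"]) (auto simp: act_def)
    next
      case False then show ?thesis using triv by (simp add: id_def)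
    qed
    show "distr M M (act n) = M" for n
    proof (cases "n \<in> carrier G")
      case True
      then have "distr M M (\<phi> n) = M" using mp by (auto simp: mp_bijections_def)
      moreover have "distr M M (act n) = distr M M (\<phi> n)" by (rule distr_cong) (use True in \<open>auto simp: act_def\<close>)
      ultimately show ?thesis by simp
    next
      case False then show ?thesis using triv by (simp add: id_def distr_id2)
    qed
  qed
  moreover have "(x, y) \<in> R \<longleftrightarrow> (\<exists>n. y = act n x)" if x: "x \<in> space M" for x y
  proof
    assume "(x, y) \<in> R"
    then obtain g where "g \<in> carrier G" "y = \<phi> g x" by (auto simp: R orbit_def)
    then show "\<exists>n. y = act n x" using x by (intro exI[of _ g]) (simp add: act_def)
  next
    assume "\<exists>n. y = act n x"
    then obtain n where n: "y = act n x" by blast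
    show "(x, y) \<in> R"
    proof (cases "n \<in> carrier G")
      case True then show ?thesis using n x by (auto simp: R orbit_def act_def)
    next
      case False
      then show ?thesis using n triv x ga.orbit_refl by (simp add: R)
    qed
  qed
  moreover have "AE x in M. \<exists>n. act n x \<noteq> x"
    using nt AE_space
  proof eventually_elim
    case (elim x)
    then show ?case by (auto simp: act_def)
  qed
  ultimately show ?thesis by blast
qed

section \<open>Passing between everywhere defined maps and classes modulo null sets\<close>

locale pmp_relation = pmp_action M act sep for M :: "'a measure" and act sep +
  fixes R :: "'a rel"
  assumes R_rel: "x \<in> space M \<Longrightarrow> (x, y) \<in> R \<longleftrightarrow> rel x y"
    and R_equiv: "equiv (space M) R"
begin

definition coset :: "('a \<Rightarrow> 'a) \<Rightarrow> ('a \<Rightarrow> 'a) set" where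
  "coset T = null_bijections M #>\<^bsub>mp_group M\<^esub> (restrict T (space M))"

lemma aperiodic_iff: "aperiodic M R \<longleftrightarrow> (AE x in M. infinite {y. rel x y})"
  unfolding aperiodic_def
proof (rule AE_cong)
  fix x assume "x \<in> space M"
  then have "R `` {x} = {y. rel x y}" using R_rel by blast
  then show "infinite (R `` {x}) \<longleftrightarrow> infinite {y. rel x y}" by simp
qed

lemma restrict_mp:
  assumes T: "bij T" "T \<in> M \<rightarrow>\<^sub>M M" "finv T \<in> M \<rightarrow>\<^sub>M M" "distr M M T = M"
  shows "restrict T (space M) \<in> mp_bijections M"
proof -
  let ?r = "restrict T (space M)"
  have sp: "T x \<in> space M \<longleftrightarrow> x \<in> space M" for x
    using measurable_space[OF T(2), of x] measurable_space[OF T(3), of "T x"] T(1) by (auto simp: bij_is_inj)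
  have bb: "bij_betw ?r (space M) (space M)"
  proof (rule bij_betwI[of _ _ _ "finv T"])
    show "?r \<in> space M \<rightarrow> space M" using sp by auto
    show "finv T \<in> space M \<rightarrow> space M" using T(3) by (auto dest: measurable_space)
    show "finv T (?r x) = x" if "x \<in> space M" for x using that T(1) by (simp add: bij_is_inj)
    show "?r (finv T x) = x" if "x \<in> space M" for x
      using that T(1) measurable_space[OF T(3) that] by (simp add: bij_is_surj surj_f_inv_f)
  qed
  have inv: "inv_into (space M) ?r x = finv T x" if "x \<in> space M" for x
  proof -
    have "finv T x \<in> space M" "?r (finv T x) = x"
      using that T(1) measurable_space[OF T(3) that] by (simp_all add: bij_is_surj surj_f_inv_f)
    then show ?thesis using bb by (metis bij_betw_inv_into_left)
  qed
  have "?r \<in> M \<rightarrow>\<^sub>M M" by (subst measurable_cong[where g=T]) (use T in auto)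
  moreover have "inv_into (space M) ?r \<in> M \<rightarrow>\<^sub>M M" by (subst measurable_cong[where g="finv T"]) (use T inv in auto)
  moreover have "distr M M ?r = M"
  proof -
    have "distr M M ?r = distr M M T" by (rule distr_cong) auto
    then show ?thesis using T(4) by simp
  qed
  moreover have "?r \<in> Bij (space M)" using bb by (simp add: Bij_def)
  ultimately show ?thesis by (simp add: mp_bijections_def)
qed

lemma FG_restrict:
  assumes T: "T \<in> FG"
  shows "restrict T (space M) \<in> mp_bijections M" "AE x in M. (restrict T (space M) x, x) \<in> R"
proof -
  show "restrict T (space M) \<in> mp_bijections M"
    by (rule restrict_mp[OF FG_bij[OF T] FG_meas[OF T] FG_meas_inv[OF T] FG_distr[OF T]])
  show "AE x in M. (restrict T (space M) x, x) \<in> R"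
  proof (rule AE_I2)
    fix x assume x: "x \<in> space M"
    then show "(restrict T (space M) x, x) \<in> R"
      using R_rel[of "T x" x] FG_space[OF T, of x] rel_sym[OF FG_rel[OF T, of x]] by simp
  qed
qed

lemma coset_closed: "T \<in> FG \<Longrightarrow> coset T \<in> carrier (full_group M R)"
  unfolding full_group_eq[OF R_equiv] coset_def using FG_restrict by blast

lemma mp_coset_eq:
  assumes "f \<in> mp_bijections M" "g \<in> mp_bijections M"
  shows "null_bijections M #>\<^bsub>mp_group M\<^esub> f = null_bijections M #>\<^bsub>mp_group M\<^esub> g \<longleftrightarrow> (AE x in M. f x = g x)"
proof -
  interpret N: normal "null_bijections M" "mp_group M" by (rule normal_null_bijections)
  have c: "f \<in> carrier (mp_group M)" "g \<in> carrier (mp_group M)" using assms by (simp_all add: carrier_mp_group)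
  let ?h = "f \<otimes>\<^bsub>mp_group M\<^esub> inv\<^bsub>mp_group M\<^esub> g"
  have gi: "inv\<^bsub>mp_group M\<^esub> g \<in> mp_bijections M" using N.inv_closed[OF c(2)] by (simp add: carrier_mp_group)
  have hc: "?h \<in> mp_bijections M" using N.m_closed[OF c(1) N.inv_closed[OF c(2)]] by (simp add: carrier_mp_group)
  have hx: "?h (g x) = f x" if "x \<in> space M" for x
    using mult_mp_group[OF assms(1) gi mp_bijection_space[OF assms(2) that]] mp_inv_left[OF assms(2) that] by simp
  have "null_bijections M #>\<^bsub>mp_group M\<^esub> f = null_bijections M #>\<^bsub>mp_group M\<^esub> g \<longleftrightarrow> ?h \<in> null_bijections M"
  proof
    assume "null_bijections M #>\<^bsub>mp_group M\<^esub> f = null_bijections M #>\<^bsub>mp_group M\<^esub> g"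
    then have "f \<in> null_bijections M #>\<^bsub>mp_group M\<^esub> g" using N.rcos_self[OF c(1) N.subgroup_axioms] by (rule subst)
    then obtain n where n: "n \<in> null_bijections M" "f = n \<otimes>\<^bsub>mp_group M\<^esub> g" unfolding r_coset_def by blast
    have "n \<in> carrier (mp_group M)" using n(1) by (simp add: carrier_mp_group null_bijections_def)
    then have "?h = n" using n(2) c by (simp add: N.m_assoc)
    then show "?h \<in> null_bijections M" using n(1) by simp
  next
    assume h: "?h \<in> null_bijections M"
    have "f = ?h \<otimes>\<^bsub>mp_group M\<^esub> g" using c by (simp add: N.m_assoc)
    then have "f \<in> null_bijections M #>\<^bsub>mp_group M\<^esub> g" using h unfolding r_coset_def by blast
    then show "null_bijections M #>\<^bsub>mp_group M\<^esub> f = null_bijections M #>\<^bsub>mp_group M\<^esub> g"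
      using N.repr_independence[OF _ c(2) N.subgroup_axioms] by simp
  qed
  also have "\<dots> \<longleftrightarrow> (AE y in M. ?h y = y)" using hc by (simp add: null_bijections_def)
  also have "\<dots> \<longleftrightarrow> (AE x in M. f x = g x)"
  proof
    assume "AE y in M. ?h y = y"
    then have "AE x in M. ?h (g x) = g x" by (rule AE_mp_bijection[OF assms(2)])
    with AE_space show "AE x in M. f x = g x" by eventually_elim (simp add: hx)
  next
    assume "AE x in M. f x = g x"
    then have "AE x in M. f ((inv\<^bsub>mp_group M\<^esub> g) x) = g ((inv\<^bsub>mp_group M\<^esub> g) x)" by (rule AE_mp_bijection[OF gi])
    with AE_space show "AE x in M. ?h x = x"
      by eventually_elim (simp add: mult_mp_group[OF assms(1) gi] mp_inv_right[OF assms(2)])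
  qed
  finally show ?thesis .
qed

lemma coset_eq:
  assumes "S \<in> FG" "T \<in> FG"
  shows "coset S = coset T \<longleftrightarrow> (AE x in M. S x = T x)"
proof -
  have "coset S = coset T \<longleftrightarrow> (AE x in M. restrict S (space M) x = restrict T (space M) x)"
    unfolding coset_def by (rule mp_coset_eq[OF FG_restrict(1) FG_restrict(1)]) fact+
  also have "\<dots> \<longleftrightarrow> (AE x in M. S x = T x)" by (rule AE_cong) simp
  finally show ?thesis .
qed

lemma coset_mult:
  assumes S: "S \<in> FG" and T: "T \<in> FG"
  shows "coset S \<otimes>\<^bsub>full_group M R\<^esub> coset T = coset (S \<circ> T)"
proof -
  interpret N: normal "null_bijections M" "mp_group M" by (rule normal_null_bijections)
  note s = FG_restrict(1)[OF S] and t = FG_restrict(1)[OF T] and st = FG_restrict(1)[OF FG_comp[OF S T]]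
  have "coset S \<otimes>\<^bsub>full_group M R\<^esub> coset T = coset S <#>\<^bsub>mp_group M\<^esub> coset T"
    by (simp add: full_group_def Aut_mp_def FactGroup_def)
  also have "\<dots> = null_bijections M #>\<^bsub>mp_group M\<^esub> (restrict S (space M) \<otimes>\<^bsub>mp_group M\<^esub> restrict T (space M))"
    unfolding coset_def by (rule N.rcos_sum) (use s t in \<open>simp_all add: carrier_mp_group\<close>)
  also have "\<dots> = coset (S \<circ> T)"
  proof -
    have m: "restrict S (space M) \<otimes>\<^bsub>mp_group M\<^esub> restrict T (space M) \<in> mp_bijections M"
      by (rule N.m_closed[unfolded carrier_mp_group, OF s t])
    show ?thesis unfolding coset_def
      by (rule iffD2[OF mp_coset_eq[OF m st]], rule AE_I2) (simp add: mult_mp_group[OF s t] FG_space[OF T])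
  qed
  finally show ?thesis .
qed

lemma null_image:
  assumes T: "bij T" "T \<in> M \<rightarrow>\<^sub>M M" "finv T \<in> M \<rightarrow>\<^sub>M M" "distr M M T = M" and N: "N \<in> null_sets M"
  shows "T ` N \<in> null_sets M" "finv T ` N \<in> null_sets M"
proof -
  have Ns: "N \<in> sets M" using N by blast
  have sp: "T x \<in> space M \<longleftrightarrow> x \<in> space M" for x
    using measurable_space[OF T(2), of x] measurable_space[OF T(3), of "T x"] T(1) by (auto simp: bij_is_inj)
  have i1: "finv T ` N = T -` N \<inter> space M"
  proof -
    have "finv T ` N = T -` N" by (rule bij_vimage_eq_inv_image[OF T(1), symmetric])
    then show ?thesis using sp sets.sets_into_space[OF Ns] by auto
  qed
  have "emeasure M (T -` N \<inter> space M) = emeasure (distr M M T) N"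
    by (rule emeasure_distr[OF T(2) Ns, symmetric])
  also have "\<dots> = 0" using T(4) N by auto
  finally show "finv T ` N \<in> null_sets M" unfolding i1 using measurable_sets[OF T(2) Ns] by auto
  have i2: "T ` N = finv T -` N \<inter> space M"
  proof -
    have "T ` N = finv T -` N" using bij_vimage_eq_inv_image[OF bij_imp_bij_inv[OF T(1)], of N] T(1) by (simp add: inv_inv_eq)
    moreover have "finv T -` N \<subseteq> space M" using sp sets.sets_into_space[OF Ns] T(1) unfolding \<open>T ` N = finv T -` N\<close>[symmetric] by blast
    ultimately show ?thesis by blast
  qed
  have TN: "T ` N \<in> sets M" unfolding i2 by (rule measurable_sets[OF T(3) Ns])
  have "emeasure M (T ` N) = emeasure (distr M M T) (T ` N)" using T(4) by simp
  also have "\<dots> = emeasure M (T -` T ` N \<inter> space M)" by (rule emeasure_distr[OF T(2) TN])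
  also have "T -` T ` N \<inter> space M = N"
    using T(1) sets.sets_into_space[OF Ns] by (auto simp: bij_is_inj inj_vimage_image_eq)
  also have "emeasure M N = 0" using N by (rule null_setsD1)
  finally show "T ` N \<in> null_sets M" using TN by (simp add: null_setsI)
qed

text \<open>A representative respects the relation only almost everywhere. Replacing it by the
  identity on an invariant null set containing all bad points puts it into \<open>FG\<close> without
  changing its class.\<close>

lemma coset_surj:
  assumes "C \<in> carrier (full_group M R)"
  shows "\<exists>T\<in>FG. C = coset T"
proof -
  obtain f where f: "f \<in> mp_bijections M" "AE x in M. (f x, x) \<in> R" and C: "C = null_bijections M #>\<^bsub>mp_group M\<^esub> f"
    using assms unfolding full_group_eq[OF R_equiv] by blast
  let ?i = "inv_into (space M) f"
  have fb: "bij_betw f (space M) (space M)" and fm: "f \<in> M \<rightarrow>\<^sub>M M" and im: "?i \<in> M \<rightarrow>\<^sub>M M" and fd: "distr M M f = M"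
    using f(1) by (auto simp: mp_bijections_def Bij_def)
  define T where "T x = (if x \<in> space M then f x else x)" for x
  define T' where "T' x = (if x \<in> space M then ?i x else x)" for x
  have TT': "T' \<circ> T = id" "T \<circ> T' = id"
    using fb measurable_space[OF fm] measurable_space[OF im]
    by (auto simp: T_def T'_def fun_eq_iff bij_betw_inv_into_left bij_betw_inv_into_right)
  have Tb: "bij T" using TT' o_bij by blast
  have Ti: "finv T = T'" by (rule inv_unique_comp[OF TT'(2,1)])
  have Tm: "T \<in> M \<rightarrow>\<^sub>M M" by (subst measurable_cong[where g=f]) (use fm in \<open>auto simp: T_def\<close>)
  have T'm: "finv T \<in> M \<rightarrow>\<^sub>M M" unfolding Ti by (subst measurable_cong[where g="?i"]) (use im in \<open>auto simp: T'_def\<close>)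
  have Td: "distr M M T = M"
  proof -
    have "distr M M T = distr M M f" by (rule distr_cong) (auto simp: T_def)
    then show ?thesis using fd by simp
  qed
  define bad where "bad = space M - (\<Union>n. {x \<in> space M. T x = act n x})"
  have bads: "bad \<in> sets M" unfolding bad_def using eq_sets[OF Tm act_meas] by blast
  have "AE x in M. x \<notin> bad"
    using f(2) AE_space
  proof eventually_elim
    case (elim x)
    then have "rel (T x) x" using R_rel[of "T x" x] measurable_space[OF fm] by (simp add: T_def)
    then have "rel x (T x)" by (rule rel_sym)
    then show ?case by (auto simp: bad_def rel_def)
  qed
  then have bad0: "bad \<in> null_sets M" using bads by (simp add: AE_iff_null_sets)
  \<comment> \<open>The bad set is saturated under \<open>T\<close> and its inverse, so that
    \<open>T\<close> maps the complement onto itself.\<close>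
  define Z where "Z = rec_nat bad (\<lambda>n Z. Z \<union> T ` Z \<union> finv T ` Z)"
  have Z0: "Z 0 = bad" and ZS: "Z (Suc n) = Z n \<union> T ` Z n \<union> finv T ` Z n" for n by (simp_all add: Z_def)
  have Zn: "Z n \<in> null_sets M" for n
  proof (induction n)
    case (Suc n)
    show ?case unfolding ZS by (intro null_sets.Un Suc null_image[OF Tb Tm T'm Td Suc])
  qed (simp add: Z0 bad0)
  define W where "W = (\<Union>n. Z n)"
  have Wn: "W \<in> null_sets M" unfolding W_def using Zn by blast
  define Y where "Y = space M - W"
  have Ys: "Y \<in> sets M" unfolding Y_def using Wn by auto
  have WT: "T x \<in> W \<longleftrightarrow> x \<in> W" for x
  proof
    assume "x \<in> W"
    then obtain n where "x \<in> Z n" by (auto simp: W_def)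
    then have "T x \<in> Z (Suc n)" by (simp add: ZS)
    then show "T x \<in> W" unfolding W_def by blast
  next
    assume "T x \<in> W"
    then obtain n where n: "T x \<in> Z n" by (auto simp: W_def)
    have "finv T (T x) = x" using Tb by (simp add: bij_is_inj)
    then have "x \<in> finv T ` Z n" using n by (metis image_eqI)
    then have "x \<in> Z (Suc n)" unfolding ZS by blast
    then show "x \<in> W" unfolding W_def by blast
  qed
  have Tsp: "T x \<in> space M \<longleftrightarrow> x \<in> space M" for x using measurable_space[OF fm] by (auto simp: T_def)
  have TY: "T x \<in> Y \<longleftrightarrow> x \<in> Y" for x unfolding Y_def using WT Tsp by blast
  have TYi: "T ` Y = Y"
  proof (intro equalityI subsetI)
    fix y assume y: "y \<in> Y"
    have "T (finv T y) = y" using Tb by (simp add: bij_is_surj surj_f_inv_f)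
    then show "y \<in> T ` Y" using y TY by (metis image_eqI)
  qed (use TY in blast)
  define g where "g = rst T Y"
  have gi: "rst (finv T) Y \<circ> g = id" "g \<circ> rst (finv T) Y = id" unfolding g_def using rst_inverse[OF Tb TYi] by blast+
  have gF: "g \<in> FG"
  proof -
    have "bij g" using gi o_bij by blast
    moreover have "finv g = rst (finv T) Y" by (rule inv_unique_comp[OF gi(2,1)])
    moreover have "g \<in> M \<rightarrow>\<^sub>M M" "rst (finv T) Y \<in> M \<rightarrow>\<^sub>M M"
      unfolding g_def rst_def using Tm T'm Ys by measurable
    moreover have "rel x (g x)" for x
    proof (cases "x \<in> Y")
      case True
      then have "x \<notin> bad" "x \<in> space M" unfolding Y_def W_def using Z0 by blast+
      then show ?thesis using True by (auto simp: bad_def g_def rst_def rel_def)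
    qed (simp add: g_def rst_def rel_refl)
    ultimately show ?thesis by (simp add: FG_def)
  qed
  have "AE x in M. x \<notin> W" by (rule AE_not_in[OF Wn])
  with AE_space have ae: "AE x in M. f x = restrict g (space M) x"
    by eventually_elim (simp add: g_def rst_def Y_def T_def)
  have "C = coset g" unfolding C coset_def
    by (rule iffD2[OF mp_coset_eq[OF f(1) FG_restrict(1)[OF gF]] ae])
  then show ?thesis using gF by blast
qed

lemma fg_hom_of_hom:
  fixes H (structure)
  assumes "group H" "f \<in> hom (full_group M R) H"
  shows "fg_hom M act sep H (\<lambda>T. f (coset T))"
proof -
  interpret H: group H by fact
  show ?thesis
  proof unfold_locales
    show "f (coset T) \<in> carrier H" if "T \<in> FG" for T
      using assms(2) coset_closed[OF that] by (auto simp: hom_def)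
    show "f (coset (S \<circ> T)) = f (coset S) \<otimes> f (coset T)" if "S \<in> FG" "T \<in> FG" for S T
      unfolding coset_mult[OF that, symmetric]
      by (rule hom_mult[OF assms(2) coset_closed[OF that(1)] coset_closed[OF that(2)]])
    show "f (coset S) = f (coset T)" if "S \<in> FG" "T \<in> FG" "AE x in M. S x = T x" for S T
      by (rule arg_cong[OF iffD2[OF coset_eq[OF that(1,2)] that(3)]])
  qed
qed

lemma hom_of_fg_hom:
  fixes H (structure)
  assumes "fg_hom M act sep H \<pi>"
  shows "\<exists>f\<in>hom (full_group M R) H. \<forall>T\<in>FG. f (coset T) = \<pi> T"
proof -
  interpret h: fg_hom M act sep H \<pi> by fact
  define f where "f C = \<pi> (SOME T. T \<in> FG \<and> C = coset T)" for C
  have f: "f (coset T) = \<pi> T" if T: "T \<in> FG" for T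
  proof -
    let ?S = "SOME S. S \<in> FG \<and> coset T = coset S"
    have "?S \<in> FG \<and> coset T = coset ?S" by (rule someI[of _ T]) (use T in simp)
    then have "\<pi> T = \<pi> ?S" using h.pi_AE[OF T] coset_eq[OF T] by blast
    then show ?thesis by (simp add: f_def)
  qed
  have "f \<in> hom (full_group M R) H"
  proof (rule homI)
    fix C assume "C \<in> carrier (full_group M R)"
    then obtain S where S: "S \<in> FG" "C = coset S" using coset_surj by blast
    then show "f C \<in> carrier H" using f h.pi_closed by simp
    fix D assume "D \<in> carrier (full_group M R)"
    then obtain T where T: "T \<in> FG" "D = coset T" using coset_surj by blast
    show "f (C \<otimes>\<^bsub>full_group M R\<^esub> D) = f C \<otimes> f D"
      unfolding S(2) T(2) coset_mult[OF S(1) T(1)] f[OF S(1)] f[OF T(1)] f[OF FG_comp[OF S(1) T(1)]]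
      by (rule h.pi_comp[OF S(1) T(1)])
  qed
  then show ?thesis using f by blast
qed

theorem aperiodic_imp_no_morphisms:
  fixes H (structure)
  assumes "aperiodic M R" and H: "topological_group H T" "totally_disconnected T" "separable_space T"
  shows "no_nontrivial_morphisms (full_group M R) H"
  unfolding no_nontrivial_morphisms_def
proof (intro ballI)
  fix f C assume f: "f \<in> hom (full_group M R) H" and C: "C \<in> carrier (full_group M R)"
  have gr: "group H" using H(1) by (simp add: topological_group_def)
  interpret fg_hom M act sep H "\<lambda>T. f (coset T)" by (rule fg_hom_of_hom[OF gr f])
  have inf: "AE x in M. infinite {y. rel x y}" using assms(1) aperiodic_iff by blast
  obtain \<Omega> S u where "dyadic \<Omega> S u" using dyadic_exists[OF inf] by blast
  then interpret dyadic_hom M act sep H "\<lambda>T. f (coset T)" \<Omega> S u by unfold_locales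
  obtain g where "g \<in> FG" "C = coset g" using coset_surj[OF C] by blast
  then show "f C = \<one>" using pi_trivial[OF inf H] by simp
qed

end

section \<open>Relations that are not aperiodic\<close>

text \<open>A maximal family with the finite intersection property, from Zorn's lemma; maximality
  decides every set.\<close>

lemma ultrafilter_exists:
  fixes \<B> :: "'a set set"
  assumes fip: "\<And>K. finite K \<Longrightarrow> K \<subseteq> \<B> \<Longrightarrow> \<Inter>K \<noteq> {}"
  shows "\<exists>U. \<B> \<subseteq> U \<and> {} \<notin> U \<and> (\<forall>X\<in>U. \<forall>Y\<in>U. X \<inter> Y \<in> U) \<and> (\<forall>X\<in>U. \<forall>Y. X \<subseteq> Y \<longrightarrow> Y \<in> U) \<and>
    (\<forall>X. X \<in> U \<or> - X \<in> U)"
proof -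
  define F where "F = {\<C>. \<B> \<subseteq> \<C> \<and> (\<forall>K. finite K \<longrightarrow> K \<subseteq> \<C> \<longrightarrow> \<Inter>K \<noteq> {})}"
  have "\<exists>U\<in>F. \<forall>X\<in>F. U \<subseteq> X \<longrightarrow> X = U"
  proof (rule subset_Zorn_nonempty)
    have "\<B> \<in> F" using fip by (simp add: F_def)
    then show "F \<noteq> {}" by blast
    fix \<C> assume C: "\<C> \<noteq> {}" "subset.chain F \<C>"
    have CF: "\<C> \<subseteq> F" using C(2) by (simp add: subset_chain_def)
    have "\<B> \<subseteq> \<Union>\<C>" using C(1) CF unfolding F_def by blast
    moreover have "\<Inter>K \<noteq> {}" if K: "finite K" "K \<subseteq> \<Union>\<C>" for K
    proof -
      obtain D where "D \<in> \<C>" "K \<subseteq> D" by (rule finite_subset_Union_chain[OF K C])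
      then show ?thesis using CF K(1) unfolding F_def by blast
    qed
    ultimately show "\<Union>\<C> \<in> F" unfolding F_def by blast
  qed
  then obtain U where U: "U \<in> F" and mx: "\<And>X. X \<in> F \<Longrightarrow> U \<subseteq> X \<Longrightarrow> X = U" by blast
  have UB: "\<B> \<subseteq> U" and Ufip: "\<And>K. finite K \<Longrightarrow> K \<subseteq> U \<Longrightarrow> \<Inter>K \<noteq> {}" using U by (auto simp: F_def)
  have ins: "Y \<in> U" if "\<And>K. finite K \<Longrightarrow> K \<subseteq> U \<Longrightarrow> \<Inter>K \<inter> Y \<noteq> {}" for Y
  proof -
    have "\<Inter>L \<noteq> {}" if L: "finite L" "L \<subseteq> insert Y U" for L
    proof -
      have "\<Inter>(L - {Y}) \<inter> Y \<noteq> {}" using L \<open>\<And>K. finite K \<Longrightarrow> K \<subseteq> U \<Longrightarrow> \<Inter>K \<inter> Y \<noteq> {}\<close> by blast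
      moreover have "\<Inter>(L - {Y}) \<inter> Y \<subseteq> \<Inter>L" by blast
      ultimately show ?thesis by blast
    qed
    then have "insert Y U \<in> F" unfolding F_def using UB by blast
    then have "insert Y U = U" using mx by blast
    then show ?thesis by blast
  qed
  have up: "Y \<in> U" if K: "finite K" "K \<subseteq> U" "\<Inter>K \<subseteq> Y" for K Y
  proof (rule ins)
    fix L assume L: "finite L" "L \<subseteq> U"
    have "\<Inter>(L \<union> K) \<noteq> {}" by (rule Ufip) (use L K in auto)
    moreover have "\<Inter>(L \<union> K) \<subseteq> \<Inter>L \<inter> Y" using K(3) by blast
    ultimately show "\<Inter>L \<inter> Y \<noteq> {}" by blast
  qed
  have Uc: "X \<in> U \<or> - X \<in> U" for X
  proof (rule disjCI)
    assume "- X \<notin> U"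
    then have n: "\<not> \<Inter>K \<subseteq> - X" if "finite K" "K \<subseteq> U" for K using up[OF that, of "- X"] by blast
    show "X \<in> U"
    proof (rule ins)
      fix K assume "finite K" "K \<subseteq> U"
      from n[OF this] show "\<Inter>K \<inter> X \<noteq> {}" by blast
    qed
  qed
  have Ue: "{} \<notin> U" using Ufip[of "{{}}"] by auto
  have Ui: "X \<inter> Y \<in> U" if "X \<in> U" "Y \<in> U" for X Y using up[of "{X, Y}" "X \<inter> Y"] that by simp
  have Uu: "Y \<in> U" if "X \<in> U" "X \<subseteq> Y" for X Y using up[of "{X}" Y] that by simp
  show ?thesis
    by (intro exI[of _ U] conjI ballI allI impI UB Ue Uc) (erule (1) Ui, erule (1) Uu)
qed

context pmp_action begin

lemma separate_finite:
  assumes "finite F" "F \<subseteq> space M" "x \<in> space M" "x \<notin> F"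
  shows "\<exists>K. finite K \<and> x \<in> (\<Inter>k\<in>K. sep k) \<and> F \<inter> (\<Inter>k\<in>K. sep k) = {}"
  using assms
proof (induction F rule: finite_induct)
  case empty
  show ?case by (rule exI[of _ "{}"]) simp
next
  case (insert y F)
  then obtain K where K: "finite K" "x \<in> (\<Inter>k\<in>K. sep k)" "F \<inter> (\<Inter>k\<in>K. sep k) = {}" by auto
  obtain l where l: "x \<in> sep l" "y \<notin> sep l" using sep_ex[of x y] insert.prems by auto
  show ?case by (rule exI[of _ "insert l K"]) (use K l in auto)
qed

text \<open>Where the orbits are finite there is a transversal of positive measure moved off itself by some
  group element: otherwise countably many null sets would cover all finite orbits.\<close>

lemma finite_orbit_transversal:
  assumes fin: "\<not> (AE x in M. infinite {y. rel x y})" and nt: "AE x in M. \<exists>n. act n x \<noteq> x"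
  shows "\<exists>B n. B \<in> sets M \<and> B \<notin> null_sets M \<and> (\<forall>x\<in>B. finite {y. rel x y} \<and> act n x \<noteq> x) \<and>
    (\<forall>x\<in>B. \<forall>y\<in>B. rel x y \<longrightarrow> x = y)"
proof -
  define E where "E m k = {x \<in> space M. act m x = act k x}" for m k
  have Es: "E m k \<in> sets M" for m k unfolding E_def by (rule eq_sets[OF act_meas act_meas])
  obtain e where e: "act e = id" using act_id by blast
  define Fin where "Fin = {x \<in> space M. finite {y. rel x y}}"
  \<comment> \<open>Finiteness of the orbit is rewritten with countable quantifiers over indices to
    make \<open>Fin\<close> measurable.\<close>
  have fin_iff: "finite {y. rel x y} \<longleftrightarrow> (\<exists>N. \<forall>m. \<exists>k<N. act m x = act k x)" for x
  proof
    assume f: "finite {y. rel x y}"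
    have r: "{y. rel x y} = range (\<lambda>n. act n x)" by (auto simp: rel_def)
    obtain L where L: "finite L" "range (\<lambda>n. act n x) = (\<lambda>n. act n x) ` L"
      using f unfolding r by (metis finite_subset_image order_refl)
    obtain N where N: "\<And>k. k \<in> L \<Longrightarrow> k < N" using L(1) by (metis finite_nat_set_iff_bounded)
    have "\<exists>k<N. act m x = act k x" for m
    proof -
      have "act m x \<in> (\<lambda>n. act n x) ` L" using L(2) by blast
      then show ?thesis using N by blast
    qed
    then show "\<exists>N. \<forall>m. \<exists>k<N. act m x = act k x" by blast
  next
    assume "\<exists>N. \<forall>m. \<exists>k<N. act m x = act k x"
    then obtain N where N: "\<And>m. \<exists>k<N. act m x = act k x" by blast
    have "{y. rel x y} \<subseteq> (\<lambda>k. act k x) ` {..<N}" using N by (force simp: rel_def)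
    then show "finite {y. rel x y}" using finite_subset by blast
  qed
  have "Fin = (\<Union>N. \<Inter>m. \<Union>k\<in>{..<N}. E m k)"
  proof (rule Set.set_eqI)
    fix x
    show "x \<in> Fin \<longleftrightarrow> x \<in> (\<Union>N. \<Inter>m. \<Union>k\<in>{..<N}. E m k)"
      unfolding Fin_def fin_iff E_def by (cases "x \<in> space M") (simp_all add: Bex_def)
  qed
  moreover have "(\<Inter>m. \<Union>k\<in>{..<N}. E m k) \<in> sets M" for N
    using Es by (intro sets.countable_INT) auto
  ultimately have Fs: "Fin \<in> sets M" by auto
  define SK where "SK K = space M \<inter> (\<Inter>k\<in>K. sep k)" for K
  have SKs: "SK K \<in> sets M" if "finite K" for K
  proof (cases "K = {}")
    case True then show ?thesis by (simp add: SK_def)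
  next
    case False
    then have "(\<Inter>k\<in>K. sep k) \<in> sets M" using that sep_sets by (intro sets.finite_INT) auto
    then show ?thesis by (simp add: SK_def)
  qed
  \<comment> \<open>Points with finite orbit that are moved by \<open>act n\<close> and are alone in
    their orbit inside \<open>SK K\<close>. A finite orbit is separated by finitely many
    \<open>sep k\<close>, so countably many such sets suffice.\<close>
  define B where "B K n = (Fin \<inter> SK K - (\<Union>m. act m -` SK K - E m e)) - E n e" for K n
  have Bs: "B K n \<in> sets M" if "finite K" for K n
  proof -
    have "act m -` SK K - E m e \<in> sets M" for m using FG_vimage[OF FG_act SKs[OF that]] Es by blast
    then show ?thesis unfolding B_def using Fs SKs[OF that] Es by (intro sets.Diff sets.Int sets.countable_UN) auto
  qed
  have Bx: "x \<in> space M" "finite {y. rel x y}" "act n x \<noteq> x" "\<And>m. act m x \<in> SK K \<Longrightarrow> act m x = x" "x \<in> SK K"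
    if "x \<in> B K n" for x K n
    using that e by (auto simp: B_def Fin_def E_def)
  have "\<exists>K n. finite K \<and> B K n \<notin> null_sets M"
  proof (rule ccontr)
    assume neg: "\<nexists>K n. finite K \<and> B K n \<notin> null_sets M"
    have cK: "countable {K::nat set. finite K}" by (rule countable_Collect_finite)
    have ae: "AE x in M. \<forall>K\<in>{K. finite K}. \<forall>n. x \<notin> B K n"
    proof (subst AE_ball_countable[OF cK], intro ballI)
      fix K :: "nat set" assume "K \<in> {K. finite K}"
      then have "AE x in M. x \<notin> B K n" for n using neg AE_not_in by blast
      then show "AE x in M. \<forall>n. x \<notin> B K n" by (simp add: AE_all_countable)
    qed
    have "AE x in M. infinite {y. rel x y}"
      using ae nt AE_space
    proof eventually_elim
      case (elim x)
      show ?case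
      proof
        assume f: "finite {y. rel x y}"
        obtain n where n: "act n x \<noteq> x" using elim(2) by blast
        have sp: "{y. rel x y} \<subseteq> space M" using rel_space elim(3) by blast
        obtain K where K: "finite K" "x \<in> (\<Inter>k\<in>K. sep k)" "({y. rel x y} - {x}) \<inter> (\<Inter>k\<in>K. sep k) = {}"
          using separate_finite[of "{y. rel x y} - {x}" x] f sp elim(3) by blast
        have "x \<in> B K n"
        proof -
          have "x \<in> Fin" using elim(3) f by (simp add: Fin_def)
          moreover have "x \<in> SK K" using elim(3) K(2) by (simp add: SK_def)
          moreover have "act m x = x" if "act m x \<in> SK K" for m
          proof -
            have "rel x (act m x)" unfolding rel_def by blast
            then show ?thesis using that K(3) unfolding SK_def by blast
          qed
          then have "x \<notin> (\<Union>m. act m -` SK K - E m e)" using elim(3) e by (auto simp: E_def)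
          moreover have "x \<notin> E n e" using n e by (simp add: E_def)
          ultimately show ?thesis by (simp add: B_def)
        qed
        then show False using elim(1) K(1) by blast
      qed
    qed
    then show False using fin by blast
  qed
  then obtain K n where K: "finite K" "B K n \<notin> null_sets M" by blast
  have tr: "x = y" if x: "x \<in> B K n" and y: "y \<in> B K n" and r: "rel x y" for x y
  proof -
    obtain m where m: "y = act m x" using r by (auto simp: rel_def)
    then show ?thesis using Bx(4)[OF x, of m] Bx(5)[OF y] by simp
  qed
  have 1: "\<forall>x\<in>B K n. finite {y. rel x y} \<and> act n x \<noteq> x" using Bx(2,3) by (intro ballI conjI)
  have 2: "\<forall>x\<in>B K n. \<forall>y\<in>B K n. rel x y \<longrightarrow> x = y" using tr by (intro ballI impI)
  show ?thesis by (rule exI[of _ "B K n"], rule exI[of _ n], intro conjI Bs[OF K(1)] K(2) 1 2)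
qed

text \<open>The signature of the restriction to a finite orbit, evaluated along an ultrafilter.\<close>

lemma signature_hom:
  fixes H (structure)
  assumes H: "group H" and a: "a \<in> carrier H" "a \<otimes> a = \<one>"
    and fin: "\<not> (AE x in M. infinite {y. rel x y})" and nt: "AE x in M. \<exists>n. act n x \<noteq> x"
  shows "\<exists>\<pi> g. fg_hom M act sep H \<pi> \<and> g \<in> FG \<and> \<pi> g = a"
proof -
  interpret H: group H by (rule H)
  obtain B n where B: "B \<in> sets M" "B \<notin> null_sets M" and Bf: "\<And>x. x \<in> B \<Longrightarrow> finite {y. rel x y}"
    and Bn: "\<And>x. x \<in> B \<Longrightarrow> act n x \<noteq> x" and Bt: "\<And>x y. x \<in> B \<Longrightarrow> y \<in> B \<Longrightarrow> rel x y \<Longrightarrow> x = y"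
    using finite_orbit_transversal[OF fin nt] by metis
  \<comment> \<open>\<open>B\<close> is not null, so these sets have the finite intersection
    property; an ultrafilter above them contains no null set.\<close>
  define \<B> where "\<B> = {B - N | N. N \<in> null_sets M}"
  have base: "\<exists>N\<in>null_sets M. B - N \<subseteq> \<Inter>K" if "finite K" "K \<subseteq> \<B>" for K
    using that
  proof (induction K rule: finite_induct)
    case empty show ?case by (rule bexI[of _ "{}"]) auto
  next
    case (insert X K)
    then obtain N where N: "N \<in> null_sets M" "B - N \<subseteq> \<Inter>K" by blast
    obtain N' where N': "N' \<in> null_sets M" "X = B - N'" using insert.prems unfolding \<B>_def by blast
    have "B - (N \<union> N') \<subseteq> \<Inter>(insert X K)" using N(2) N'(2) by blast
    then show ?case using null_sets.Un[OF N(1) N'(1)] by blast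
  qed
  have Bne: "B - N \<noteq> {}" if "N \<in> null_sets M" for N
  proof
    assume "B - N = {}"
    then have "B \<subseteq> N" by blast
    then show False using B null_sets_subset[OF that B(1)] by blast
  qed
  have fip: "\<Inter>K \<noteq> {}" if "finite K" "K \<subseteq> \<B>" for K using base[OF that] Bne by blast
  obtain U where U: "\<B> \<subseteq> U" "{} \<notin> U" and Ui: "\<And>X Y. X \<in> U \<Longrightarrow> Y \<in> U \<Longrightarrow> X \<inter> Y \<in> U"
    and Uu: "\<And>X Y. X \<in> U \<Longrightarrow> X \<subseteq> Y \<Longrightarrow> Y \<in> U" and Uc: "\<And>X. X \<in> U \<or> - X \<in> U"
    using ultrafilter_exists[of \<B>, OF fip] by metis
  have Un: "\<not> (X \<in> U \<and> Y \<in> U)" if "X \<inter> Y = {}" for X Y using Ui[of X Y] U(2) that by auto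
  \<comment> \<open>Membership in an ultrafilter turns symmetric difference into addition modulo 2,
    which makes the parity of \<open>T\<close> a morphism.\<close>
  have Usd: "sym_diff X Y \<in> U \<longleftrightarrow> (X \<in> U) \<noteq> (Y \<in> U)" for X Y
  proof -
    have 1: "sym_diff X Y \<in> U" if "X \<in> U" "Y \<notin> U" for X Y
    proof -
      have "X \<inter> - Y \<in> U" using Ui that Uc by blast
      then show ?thesis by (rule Uu) blast
    qed
    have 2: "sym_diff X Y \<notin> U" if "X \<in> U" "Y \<in> U"
    proof -
      have "X \<inter> Y \<in> U" using Ui that by blast
      moreover have "(X \<inter> Y) \<inter> sym_diff X Y = {}" by blast
      ultimately show ?thesis using Un by blast
    qed
    have 3: "sym_diff X Y \<notin> U" if "X \<notin> U" "Y \<notin> U"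
    proof -
      have "- X \<inter> - Y \<in> U" using Ui that Uc by blast
      moreover have "(- X \<inter> - Y) \<inter> sym_diff X Y = {}" by blast
      ultimately show ?thesis using Un by blast
    qed
    have "sym_diff X Y = sym_diff Y X" by blast
    then show ?thesis using 1[of X Y] 1[of Y X] 2 3 by auto
  qed
  define cl where "cl x = {y. rel x y}" for x
  have clT: "T y \<in> cl x \<longleftrightarrow> y \<in> cl x" if "T \<in> FG" for T x y
    unfolding cl_def using FG_rel[OF that, of y] rel_trans rel_sym by blast
  have clTi: "T ` cl x = cl x" if T: "T \<in> FG" for T x
  proof (intro equalityI subsetI)
    fix y assume y: "y \<in> cl x"
    have "T (finv T y) = y" using FG_bij[OF T] by (simp add: bij_is_surj surj_f_inv_f)
    then show "y \<in> T ` cl x" using y clT[OF T] by (metis image_eqI)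
  qed (use clT[OF T] in blast)
  have perm: "permutation (rst T (cl x))" if T: "T \<in> FG" and f: "finite (cl x)" for T x
  proof -
    have "bij (rst T (cl x))" using rst_inverse[OF FG_bij[OF T] clTi[OF T]] o_bij by blast
    moreover have "{y. rst T (cl x) y \<noteq> y} \<subseteq> cl x" by (auto simp: rst_def)
    ultimately show ?thesis unfolding permutation using f finite_subset by blast
  qed
  define Odd where "Odd T = {x. finite (cl x) \<and> \<not> evenperm (rst T (cl x))}" for T
  have Odd_comp: "Odd (S \<circ> T) = sym_diff (Odd S) (Odd T)" if S: "S \<in> FG" and T: "T \<in> FG" for S T
  proof -
    have "rst (S \<circ> T) (cl x) = rst S (cl x) \<circ> rst T (cl x)" for x
      using clT[OF T] by (auto simp: rst_def fun_eq_iff)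
    then have "evenperm (rst (S \<circ> T) (cl x)) \<longleftrightarrow> evenperm (rst S (cl x)) = evenperm (rst T (cl x))"
      if "finite (cl x)" for x
      using evenperm_comp[OF perm[OF S that] perm[OF T that]] by metis
    then show ?thesis unfolding Odd_def by blast
  qed
  have Odd_AE: "Odd T \<in> U" if S: "S \<in> FG" and T: "T \<in> FG" and ae: "AE x in M. S x = T x" and O: "Odd S \<in> U" for S T
  proof -
    \<comment> \<open>Parity at \<open>x\<close> depends on the whole orbit, so agreement almost
      everywhere is first spread along the orbit.\<close>
    have "AE x in M. \<forall>k. S (act k x) = T (act k x)"
      using FG_AE[OF FG_act ae] by (simp add: AE_all_countable)
    then obtain N where N: "{x \<in> space M. \<not> (\<forall>k. S (act k x) = T (act k x))} \<subseteq> N" "N \<in> null_sets M"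
      by (rule AE_E) (auto simp: null_sets_def)
    have "B - N \<in> U" using U(1) N(2) unfolding \<B>_def by blast
    then have "Odd S \<inter> (B - N) \<in> U" using Ui O by blast
    moreover have "Odd S \<inter> (B - N) \<subseteq> Odd T"
    proof
      fix x assume x: "x \<in> Odd S \<inter> (B - N)"
      then have "x \<in> space M" using sets.sets_into_space[OF B(1)] by blast
      then have "\<forall>k. S (act k x) = T (act k x)" using N(1) x by blast
      then have "S y = T y" if "y \<in> cl x" for y using that unfolding cl_def rel_def by blast
      then have "rst S (cl x) = rst T (cl x)" by (auto simp: rst_def)
      then show "x \<in> Odd T" using x by (simp add: Odd_def)
    qed
    ultimately show ?thesis by (rule Uu)
  qed
  define \<pi> where "\<pi> T = (if Odd T \<in> U then a else \<one>)" for T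
  have hom: "fg_hom M act sep H \<pi>"
  proof unfold_locales
    show "\<pi> T \<in> carrier H" if "T \<in> FG" for T using a(1) by (simp add: \<pi>_def)
    show "\<pi> (S \<circ> T) = \<pi> S \<otimes> \<pi> T" if "S \<in> FG" "T \<in> FG" for S T
      unfolding \<pi>_def Odd_comp[OF that] Usd using a by simp
    show "\<pi> S = \<pi> T" if "S \<in> FG" "T \<in> FG" "AE x in M. S x = T x" for S T
    proof -
      have "AE x in M. T x = S x" using that(3) by eventually_elim simp
      then have "Odd S \<in> U \<longleftrightarrow> Odd T \<in> U" using Odd_AE that by blast
      then show ?thesis by (simp add: \<pi>_def)
    qed
  qed
  \<comment> \<open>On the orbit of a point of the transversal this is a single transposition, hence
    odd throughout \<open>B\<close>.\<close>
  define g where "g = swap (act n) B"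
  have dis: "B \<inter> act n ` B = {}"
  proof -
    have "act n x \<notin> B" if "x \<in> B" for x
    proof
      assume "act n x \<in> B"
      moreover have "rel x (act n x)" unfolding rel_def by blast
      ultimately show False using Bt[OF that] Bn[OF that] by metis
    qed
    then show ?thesis by blast
  qed
  have gF: "g \<in> FG" unfolding g_def by (rule FG_swap[OF FG_act B(1) dis])
  have "B \<subseteq> Odd g"
  proof
    fix x assume x: "x \<in> B"
    have "rst g (cl x) = Transposition.transpose x (act n x)"
    proof
      fix y
      have xa: "rel x (act n x)" unfolding rel_def by blast
      consider "y = x" | "y = act n x" | "y \<noteq> x" "y \<noteq> act n x" "y \<in> cl x" | "y \<noteq> x" "y \<noteq> act n x" "y \<notin> cl x" by blast
      then show "rst g (cl x) y = Transposition.transpose x (act n x) y"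
      proof cases
        case 1
        then show ?thesis using x by (simp add: rst_def cl_def rel_refl g_def swap_in)
      next
        case 2
        have "g (act n x) = x" unfolding g_def by (rule swap_in'[OF act_bij dis x])
        then show ?thesis using 2 xa by (simp add: rst_def cl_def)
      next
        case 3
        have "y \<notin> B" using Bt[OF x, of y] 3 by (auto simp: cl_def)
        moreover have "y \<notin> act n ` B"
        proof
          assume "y \<in> act n ` B"
          then obtain b where b: "b \<in> B" "y = act n b" by blast
          then have "rel b y" unfolding rel_def by blast
          then have "rel x b" using 3(3) rel_trans rel_sym unfolding cl_def by blast
          then show False using Bt[OF x b(1)] b(2) 3(2) by blast
        qed
        ultimately have "g y = y" unfolding g_def by (rule swap_out)
        then show ?thesis using 3 by (simp add: rst_def)
      next
        case 4
        then show ?thesis by (simp add: rst_def)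
      qed
    qed
    then have "\<not> evenperm (rst g (cl x))" using Bn[OF x] by (simp add: evenperm_swap)
    then show "x \<in> Odd g" using Bf[OF x] by (simp add: Odd_def cl_def)
  qed
  moreover have "B \<in> U"
  proof -
    have "B - {} \<in> \<B>" unfolding \<B>_def by blast
    then show ?thesis using U(1) by auto
  qed
  ultimately have "Odd g \<in> U" using Uu by blast
  then have "\<pi> g = a" by (simp add: \<pi>_def)
  then show ?thesis using hom gF by blast
qed

end

text \<open>A copy of the group of order two on a type of sets of sets, since the second equivalence
  fixes the type of its targets as \<open>nat set set\<close>.\<close>

definition two_group :: "'b set set monoid" where
  "two_group = \<lparr>carrier = {{}, {{}}}, monoid.mult = sym_diff, one = {}\<rparr>"

lemma group_two_group: "group two_group"
proof (rule groupI)
  show "\<exists>y\<in>carrier two_group. y \<otimes>\<^bsub>two_group\<^esub> x = \<one>\<^bsub>two_group\<^esub>" if "x \<in> carrier two_group" for x :: "'b set set"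
    by (rule bexI[of _ x]) (use that in \<open>simp_all add: two_group_def\<close>)
qed (auto simp: two_group_def)

lemma topological_group_discrete:
  assumes "group H"
  shows "topological_group H (discrete_topology (carrier H))"
  using assms unfolding topological_group_def
  by (auto simp: prod_topology_discrete_topology[symmetric] intro: group.inv_closed monoid.m_closed group.is_monoid)

lemma totally_disconnected_discrete: "totally_disconnected (discrete_topology U)"
  by (simp add: totally_disconnected_def connected_component_of_discrete_topology)

context pmp_relation begin

lemma not_aperiodic_imp_morphism:
  fixes H (structure)
  assumes "group H" "a \<in> carrier H" "a \<otimes> a = \<one>" "a \<noteq> \<one>"
    and "\<not> aperiodic M R" "AE x in M. \<exists>n. act n x \<noteq> x"
  shows "\<not> no_nontrivial_morphisms (full_group M R) H"
proof -
  obtain \<pi> g where h: "fg_hom M act sep H \<pi>" and g: "g \<in> FG" "\<pi> g = a"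
    using signature_hom[OF assms(1-3) _ assms(6)] assms(5) aperiodic_iff by blast
  obtain f where f: "f \<in> hom (full_group M R) H" "f (coset g) = \<pi> g"
    using hom_of_fg_hom[OF h] g(1) by blast
  then show ?thesis
    unfolding no_nontrivial_morphisms_def using coset_closed[OF g(1)] g(2) assms(4) by metis
qed

end

text \<open>An equivalence can quantify over targets of one type only; the last conjunct gives the
  positive direction for targets on an arbitrary type. For the converses the group of order two is
  used, with the discrete topology in the topological case.\<close>

theorem theorem1p14:
  fixes M :: "'a measure" and R :: "'a rel"
  assumes "standard_probability_space M"
    and "pmp_equivalence_relation M R"
  shows
    "(aperiodic M R \<longleftrightarrow> no_nontrivial_morphisms (full_group M R) (integer_mod_group 2)) \<and>
     (aperiodic M R \<longleftrightarrow>
        (\<forall>(H :: nat set set monoid) T.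
           topological_group H T \<and> totally_disconnected T \<and> separable_space T \<longrightarrow>
           no_nontrivial_morphisms (full_group M R) H)) \<and>
     (aperiodic M R \<longrightarrow>
        (\<forall>(H :: 'g monoid) T.
           topological_group H T \<and> totally_disconnected T \<and> separable_space T \<longrightarrow>
           no_nontrivial_morphisms (full_group M R) H))"
proof -
  obtain act sep where act: "pmp_action M act sep"
    and rel: "\<forall>x\<in>space M. \<forall>y. (x, y) \<in> R \<longleftrightarrow> (\<exists>n. y = act n x)"
    and nt: "AE x in M. \<exists>n. act n x \<noteq> x"
    using pmp_action_exists[OF assms] by blast
  interpret pmp_action M act sep by (rule act)
  interpret pmp_relation M act sep R
    by unfold_locales (use rel equiv_pmp_equivalence_relation[OF assms(2)] in \<open>auto simp: rel_def\<close>)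
  let ?Z = "integer_mod_group 2" and ?D = "two_group :: nat set set monoid"
  have Z: "group ?Z" "1 \<in> carrier ?Z" "1 \<otimes>\<^bsub>?Z\<^esub> 1 = \<one>\<^bsub>?Z\<^esub>" "1 \<noteq> \<one>\<^bsub>?Z\<^esub>"
    by (simp_all add: carrier_integer_mod_group)
  have D: "group ?D" "{{}} \<in> carrier ?D" "{{}} \<otimes>\<^bsub>?D\<^esub> {{}} = \<one>\<^bsub>?D\<^esub>" "{{}} \<noteq> \<one>\<^bsub>?D\<^esub>"
    by (simp_all add: group_two_group) (simp_all add: two_group_def)
  have sepZ: "separable_space (discrete_topology (carrier ?Z))"
    by (simp add: separable_space_discrete_topology carrier_integer_mod_group countable_finite)
  have sepD: "separable_space (discrete_topology (carrier ?D))"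
    by (simp add: separable_space_discrete_topology two_group_def countable_finite)
  have 1: "aperiodic M R \<longleftrightarrow> no_nontrivial_morphisms (full_group M R) ?Z"
    using aperiodic_imp_no_morphisms[OF _ topological_group_discrete[OF Z(1)] totally_disconnected_discrete sepZ]
      not_aperiodic_imp_morphism[OF Z _ nt] by blast
  have 2: "no_nontrivial_morphisms (full_group M R) H"
    if "aperiodic M R" "topological_group H T \<and> totally_disconnected T \<and> separable_space T"
    for H :: "'x monoid" and T
    by (intro aperiodic_imp_no_morphisms[of H T] that that(2)[THEN conjunct1]
        that(2)[THEN conjunct2, THEN conjunct1] that(2)[THEN conjunct2, THEN conjunct2])
  have 3: "aperiodic M R" if all: "\<forall>(H :: nat set set monoid) T.
      topological_group H T \<and> totally_disconnected T \<and> separable_space T \<longrightarrow>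
      no_nontrivial_morphisms (full_group M R) H"
  proof (rule ccontr)
    assume "\<not> aperiodic M R"
    then have "\<not> no_nontrivial_morphisms (full_group M R) ?D" by (rule not_aperiodic_imp_morphism[OF D _ nt])
    moreover have "no_nontrivial_morphisms (full_group M R) ?D"
      using all topological_group_discrete[OF D(1)] totally_disconnected_discrete sepD by blast
    ultimately show False by blast
  qed
  show ?thesis
    by (rule conjI[OF 1], rule conjI, rule iffI, (intro allI impI, erule (1) 2), erule 3,
        intro impI allI, erule (1) 2)
qed

end
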